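(* Let $\mathsf k$ be an algebraically closed field, $G$ a finite abelian group such that $\mathrm{char}(\mathsf k)$ does not divide $|G|$, and let $\mathcal B$ and $\mathcal C$ be idempotent complete additive $\mathsf k$-linear categories. Suppose $\mathcal B\cong\mathcal C^G$ for some action of $G$ on $\mathcal C$. Then $\mathcal C\cong\mathcal B^{G^\vee}$ for some action of the dual group $G^\vee=\mathrm{Hom}(G,\mathsf k^* )$ on $\mathcal B$.
   Context: $\cong$ denotes equivalence of $\mathsf k$-linear categories. A category is idempotent complete if every endomorphism $p\colon X\to X$ with $p^2=p$ splits, i.e. $p=is$ with $si=1_{X'}$ for some object $X'$ and morphisms $i\colon X'\to X$, $s\colon X\to X'$. A (right) action of a finite group $G$ on a $\mathsf k$-linear category $\mathcal C$ consists of ($\mathsf k$-linear) autoequivalences $\phi_g\colon\mathcal C\to\mathcal C$ ($g\in G$) and isomorphisms of functors $\varepsilon_{g,h}\colon\phi_g\phi_h\to\phi_{hg}$ with $\varepsilon_{f,hg}\circ\phi_f(\varepsilon_{g,h})=\varepsilon_{gf,h}\circ(\varepsilon_{f,g}\phi_h)$ for all $f,g,h\in G$. A $G$-equivariant object is a pair $(F,(\theta_g)_{g\in G})$ with $F\in\mathcal C$ and isomorphisms $\theta_g\colon F\to\phi_g(F)$ such that $\theta_{hg}=\varepsilon_{g,h}\circ\phi_g(\theta_h)\circ\theta_g$ for all $g,h$. A morphism $(F_1,(\theta^1_g))\to(F_2,(\theta^2_g))$ is a morphism $f\colon F_1\to F_2$ with $\theta^2_g f=\phi_g(f)\theta^1_g$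 for all $g$. The category of $G$-equivariant objects is denoted $\mathcal C^G$. *)

theory Defs
  imports
    "HOL-Algebra.Coset"
    "HOL-Computational_Algebra.Polynomial"
begin

section \<open>Linear categories\<close>

text \<open>
  A category is given by a set of objects and a set of arrows with domain and codomain, so that
  different Hom-sets are disjoint. The maps of the record are only constrained on objects, on
  arrows and on composable or parallel pairs of arrows. The operation \<open>hsum\<close> is the addition of
  parallel arrows and \<open>hzero C X Y\<close> is the zero arrow from \<open>X\<close> to \<open>Y\<close>.
\<close>

record ('k, 'o, 'm) lincat =
  Ob :: "'o set"
  Ar :: "'m set"
  Dom :: "'m \<Rightarrow> 'o"
  Cod :: "'m \<Rightarrow> 'o"
  Ident :: "'o \<Rightarrow> 'm"
  Comp :: "'m \<Rightarrow> 'm \<Rightarrow> 'm"  (infixl "\<cdot>\<index>" 70)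
  hsum :: "'m \<Rightarrow> 'm \<Rightarrow> 'm"
  hzero :: "'o \<Rightarrow> 'o \<Rightarrow> 'm"
  hscale :: "'k \<Rightarrow> 'm \<Rightarrow> 'm"

definition Hom :: "('k, 'o, 'm) lincat \<Rightarrow> 'o \<Rightarrow> 'o \<Rightarrow> 'm set" where
  "Hom C X Y = {f \<in> Ar C. Dom C f = X \<and> Cod C f = Y}"

definition Hom_group :: "('k, 'o, 'm) lincat \<Rightarrow> 'o \<Rightarrow> 'o \<Rightarrow> 'm monoid" where
  "Hom_group C X Y = \<lparr>carrier = Hom C X Y, monoid.mult = hsum C, monoid.one = hzero C X Y\<rparr>"

locale linear_category =
  fixes C :: "('k::field, 'o, 'm) lincat" (structure)
  assumes Dom_Ob: "f \<in> Ar C \<Longrightarrow> Dom C f \<in> Ob C"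
    and Cod_Ob: "f \<in> Ar C \<Longrightarrow> Cod C f \<in> Ob C"
    and Ident_Hom: "X \<in> Ob C \<Longrightarrow> Ident C X \<in> Hom C X X"
    and Comp_Hom: "\<lbrakk>f \<in> Hom C X Y; g \<in> Hom C Y Z\<rbrakk> \<Longrightarrow> g \<cdot> f \<in> Hom C X Z"
    and Comp_assoc: "\<lbrakk>f \<in> Hom C W X; g \<in> Hom C X Y; h \<in> Hom C Y Z\<rbrakk>
          \<Longrightarrow> (h \<cdot> g) \<cdot> f = h \<cdot> (g \<cdot> f)"
    and Comp_Ident_left: "f \<in> Hom C X Y \<Longrightarrow> Ident C Y \<cdot> f = f"
    and Comp_Ident_right: "f \<in> Hom C X Y \<Longrightarrow> f \<cdot> Ident C X = f"
    and Hom_comm_group: "\<lbrakk>X \<in> Ob C; Y \<in> Ob C\<rbrakk> \<Longrightarrow> comm_group (Hom_group C X Y)"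
    and hscale_Hom: "f \<in> Hom C X Y \<Longrightarrow> hscale C a f \<in> Hom C X Y"
    and hscale_one: "f \<in> Hom C X Y \<Longrightarrow> hscale C 1 f = f"
    and hscale_hscale: "f \<in> Hom C X Y \<Longrightarrow> hscale C a (hscale C b f) = hscale C (a * b) f"
    and hscale_add: "f \<in> Hom C X Y
          \<Longrightarrow> hscale C (a + b) f = hsum C (hscale C a f) (hscale C b f)"
    and hscale_hsum: "\<lbrakk>f \<in> Hom C X Y; g \<in> Hom C X Y\<rbrakk>
          \<Longrightarrow> hscale C a (hsum C f g) = hsum C (hscale C a f) (hscale C a g)"
    and Comp_hsum_left: "\<lbrakk>f \<in> Hom C X Y; g \<in> Hom C Y Z; g' \<in> Hom C Y Z\<rbrakk>
          \<Longrightarrow> hsum C g g' \<cdot> f = hsum C (g \<cdot> f) (g' \<cdot> f)"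
    and Comp_hsum_right: "\<lbrakk>f \<in> Hom C X Y; f' \<in> Hom C X Y; g \<in> Hom C Y Z\<rbrakk>
          \<Longrightarrow> g \<cdot> hsum C f f' = hsum C (g \<cdot> f) (g \<cdot> f')"
    and Comp_hscale_left: "\<lbrakk>f \<in> Hom C X Y; g \<in> Hom C Y Z\<rbrakk>
          \<Longrightarrow> hscale C a g \<cdot> f = hscale C a (g \<cdot> f)"
    and Comp_hscale_right: "\<lbrakk>f \<in> Hom C X Y; g \<in> Hom C Y Z\<rbrakk>
          \<Longrightarrow> g \<cdot> hscale C a f = hscale C a (g \<cdot> f)"

definition is_iso :: "('k, 'o, 'm) lincat \<Rightarrow> 'o \<Rightarrow> 'o \<Rightarrow> 'm \<Rightarrow> bool" where
  "is_iso C X Y f \<longleftrightarrow> f \<in> Hom C X Y \<and>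
     (\<exists>g \<in> Hom C Y X. g \<cdot>\<^bsub>C\<^esub> f = Ident C X \<and> f \<cdot>\<^bsub>C\<^esub> g = Ident C Y)"

definition is_zero_object :: "('k, 'o, 'm) lincat \<Rightarrow> 'o \<Rightarrow> bool" where
  "is_zero_object C Z \<longleftrightarrow> Z \<in> Ob C \<and>
     (\<forall>X \<in> Ob C. (\<exists>!f. f \<in> Hom C X Z) \<and> (\<exists>!f. f \<in> Hom C Z X))"

definition is_biproduct :: "('k, 'o, 'm) lincat \<Rightarrow> 'o \<Rightarrow> 'o \<Rightarrow> 'o \<Rightarrow> 'm \<Rightarrow> 'm \<Rightarrow> 'm \<Rightarrow> 'm \<Rightarrow> bool" where
  "is_biproduct C X Y S i j p q \<longleftrightarrow> S \<in> Ob C \<and>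
     i \<in> Hom C X S \<and> j \<in> Hom C Y S \<and> p \<in> Hom C S X \<and> q \<in> Hom C S Y \<and>
     p \<cdot>\<^bsub>C\<^esub> i = Ident C X \<and> q \<cdot>\<^bsub>C\<^esub> j = Ident C Y \<and>
     p \<cdot>\<^bsub>C\<^esub> j = hzero C Y X \<and> q \<cdot>\<^bsub>C\<^esub> i = hzero C X Y \<and>
     hsum C (i \<cdot>\<^bsub>C\<^esub> p) (j \<cdot>\<^bsub>C\<^esub> q) = Ident C S"

locale additive_category = linear_category +
  assumes has_zero_object: "\<exists>Z. is_zero_object C Z"
    and has_biproducts: "\<lbrakk>X \<in> Ob C; Y \<in> Ob C\<rbrakk> \<Longrightarrow> \<exists>S i j p q. is_biproduct C X Y S i j p q"

definition idempotent_complete :: "('k, 'o, 'm) lincat \<Rightarrow> bool" where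
  "idempotent_complete C \<longleftrightarrow>
     (\<forall>X \<in> Ob C. \<forall>p \<in> Hom C X X. p \<cdot>\<^bsub>C\<^esub> p = p \<longrightarrow>
        (\<exists>X' \<in> Ob C. \<exists>i \<in> Hom C X' X. \<exists>s \<in> Hom C X X'.
           p = i \<cdot>\<^bsub>C\<^esub> s \<and> s \<cdot>\<^bsub>C\<^esub> i = Ident C X'))"


section \<open>Functors, natural isomorphisms and equivalences\<close>

record ('o, 'm, 'p, 'n) functr =
  ob_map :: "'o \<Rightarrow> 'p"
  ar_map :: "'m \<Rightarrow> 'n"

definition id_functr :: "('o, 'm, 'o, 'm) functr" where
  "id_functr = \<lparr>ob_map = (\<lambda>X. X), ar_map = (\<lambda>f. f)\<rparr>"

definition comp_functr ::
  "('p, 'n, 'q, 'r) functr \<Rightarrow> ('o, 'm, 'p, 'n) functr \<Rightarrow> ('o, 'm, 'q, 'r) functr" where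
  "comp_functr F' F = \<lparr>ob_map = ob_map F' \<circ> ob_map F, ar_map = ar_map F' \<circ> ar_map F\<rparr>"

locale linear_functor =
  A: linear_category A + B: linear_category B
  for A :: "('k::field, 'o, 'm) lincat"
    and B :: "('k, 'p, 'n) lincat"
    and F :: "('o, 'm, 'p, 'n) functr" +
  assumes ob_map_Ob: "X \<in> Ob A \<Longrightarrow> ob_map F X \<in> Ob B"
    and ar_map_Hom: "f \<in> Hom A X Y \<Longrightarrow> ar_map F f \<in> Hom B (ob_map F X) (ob_map F Y)"
    and ar_map_Ident: "X \<in> Ob A \<Longrightarrow> ar_map F (Ident A X) = Ident B (ob_map F X)"
    and ar_map_Comp: "\<lbrakk>f \<in> Hom A X Y; g \<in> Hom A Y Z\<rbrakk>
          \<Longrightarrow> ar_map F (g \<cdot>\<^bsub>A\<^esub> f) = ar_map F g \<cdot>\<^bsub>B\<^esub> ar_map F f"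
    and ar_map_hsum: "\<lbrakk>f \<in> Hom A X Y; g \<in> Hom A X Y\<rbrakk>
          \<Longrightarrow> ar_map F (hsum A f g) = hsum B (ar_map F f) (ar_map F g)"
    and ar_map_hscale: "f \<in> Hom A X Y \<Longrightarrow> ar_map F (hscale A a f) = hscale B a (ar_map F f)"

locale natural_isomorphism =
  F: linear_functor A B F + F': linear_functor A B F'
  for A :: "('k::field, 'o, 'm) lincat"
    and B :: "('k, 'p, 'n) lincat"
    and F :: "('o, 'm, 'p, 'n) functr"
    and F' :: "('o, 'm, 'p, 'n) functr"
    and \<eta> :: "'o \<Rightarrow> 'n" +
  assumes component_iso: "X \<in> Ob A \<Longrightarrow> is_iso B (ob_map F X) (ob_map F' X) (\<eta> X)"
    and naturality: "f \<in> Hom A X Y \<Longrightarrow> \<eta> Y \<cdot>\<^bsub>B\<^esub> ar_map F f = ar_map F' f \<cdot>\<^bsub>B\<^esub> \<eta> X"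

definition linear_equivalence ::
  "('k::field, 'o, 'm) lincat \<Rightarrow> ('k, 'p, 'n) lincat \<Rightarrow> ('o, 'm, 'p, 'n) functr \<Rightarrow> bool" where
  "linear_equivalence A B F \<longleftrightarrow> linear_functor A B F \<and>
     (\<exists>F' \<eta> \<eta>'. linear_functor B A F' \<and>
        natural_isomorphism A A (comp_functr F' F) id_functr \<eta> \<and>
        natural_isomorphism B B (comp_functr F F') id_functr \<eta>')"

definition equivalent_categories ::
  "('k::field, 'o, 'm) lincat \<Rightarrow> ('k, 'p, 'n) lincat \<Rightarrow> bool"  (infix "\<cong>\<^sub>l\<^sub>i\<^sub>n" 50) where
  "A \<cong>\<^sub>l\<^sub>i\<^sub>n B \<longleftrightarrow> (\<exists>F. linear_equivalence A B F)"


section \<open>Group actions and equivariant objects\<close>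

text \<open>
  In the cocycle condition \<open>(\<epsilon>\<^sub>f\<^sub>,\<^sub>g \<phi>\<^sub>h)\<^sub>X\<close> is the component of \<open>\<epsilon>\<^sub>f\<^sub>,\<^sub>g\<close> at \<open>\<phi>\<^sub>h(X)\<close>, and
  \<open>\<phi>\<^sub>f(\<epsilon>\<^sub>g\<^sub>,\<^sub>h)\<^sub>X\<close> is the image under \<open>\<phi>\<^sub>f\<close> of the component of \<open>\<epsilon>\<^sub>g\<^sub>,\<^sub>h\<close> at \<open>X\<close>.
\<close>

locale categorical_action =
  group G + C: linear_category C
  for G :: "'g monoid" (structure)
    and C :: "('k::field, 'o, 'm) lincat"
    and \<phi> :: "'g \<Rightarrow> ('o, 'm, 'o, 'm) functr"
    and \<epsilon> :: "'g \<Rightarrow> 'g \<Rightarrow> 'o \<Rightarrow> 'm" +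
  assumes autoequivalence: "g \<in> carrier G \<Longrightarrow> linear_equivalence C C (\<phi> g)"
    and comparison_iso: "\<lbrakk>g \<in> carrier G; h \<in> carrier G\<rbrakk>
          \<Longrightarrow> natural_isomorphism C C (comp_functr (\<phi> g) (\<phi> h)) (\<phi> (h \<otimes> g)) (\<epsilon> g h)"
    and cocycle: "\<lbrakk>f \<in> carrier G; g \<in> carrier G; h \<in> carrier G; X \<in> Ob C\<rbrakk>
          \<Longrightarrow> \<epsilon> f (h \<otimes> g) X \<cdot>\<^bsub>C\<^esub> ar_map (\<phi> f) (\<epsilon> g h X)
            = \<epsilon> (g \<otimes> f) h X \<cdot>\<^bsub>C\<^esub> \<epsilon> f g (ob_map (\<phi> h) X)"

text \<open>
  The families \<open>\<theta>\<close> are required to be extensional, so that they are really indexed by the elements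
  of \<open>G\<close>.
\<close>

definition equivariant_objects ::
  "'g monoid \<Rightarrow> ('k, 'o, 'm) lincat \<Rightarrow> ('g \<Rightarrow> ('o, 'm, 'o, 'm) functr) \<Rightarrow>
   ('g \<Rightarrow> 'g \<Rightarrow> 'o \<Rightarrow> 'm) \<Rightarrow> ('o \<times> ('g \<Rightarrow> 'm)) set" where
  "equivariant_objects G C \<phi> \<epsilon> =
     {(X, \<theta>). X \<in> Ob C \<and> \<theta> \<in> extensional (carrier G) \<and>
        (\<forall>g \<in> carrier G. is_iso C X (ob_map (\<phi> g) X) (\<theta> g)) \<and>
        (\<forall>g \<in> carrier G. \<forall>h \<in> carrier G.
           \<theta> (h \<otimes>\<^bsub>G\<^esub> g) = \<epsilon> g h X \<cdot>\<^bsub>C\<^esub> ar_map (\<phi> g) (\<theta> h) \<cdot>\<^bsub>C\<^esub> \<theta> g)}"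

text \<open>
  An arrow of the equivariant category carries its source and its target, because the same arrow
  of \<open>C\<close> may be compatible with several equivariant structures on its domain and codomain.
\<close>

definition equivariant_arrows ::
  "'g monoid \<Rightarrow> ('k, 'o, 'm) lincat \<Rightarrow> ('g \<Rightarrow> ('o, 'm, 'o, 'm) functr) \<Rightarrow>
   ('g \<Rightarrow> 'g \<Rightarrow> 'o \<Rightarrow> 'm) \<Rightarrow>
   (('o \<times> ('g \<Rightarrow> 'm)) \<times> ('o \<times> ('g \<Rightarrow> 'm)) \<times> 'm) set" where
  "equivariant_arrows G C \<phi> \<epsilon> =
     {((X\<^sub>1, \<theta>\<^sub>1), (X\<^sub>2, \<theta>\<^sub>2), f).
        (X\<^sub>1, \<theta>\<^sub>1) \<in> equivariant_objects G C \<phi> \<epsilon> \<and> (X\<^sub>2, \<theta>\<^sub>2) \<in> equivariant_objects G C \<phi> \<epsilon> \<and>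
        f \<in> Hom C X\<^sub>1 X\<^sub>2 \<and>
        (\<forall>g \<in> carrier G. \<theta>\<^sub>2 g \<cdot>\<^bsub>C\<^esub> f = ar_map (\<phi> g) f \<cdot>\<^bsub>C\<^esub> \<theta>\<^sub>1 g)}"

definition equivariant_category ::
  "'g monoid \<Rightarrow> ('k, 'o, 'm) lincat \<Rightarrow> ('g \<Rightarrow> ('o, 'm, 'o, 'm) functr) \<Rightarrow>
   ('g \<Rightarrow> 'g \<Rightarrow> 'o \<Rightarrow> 'm) \<Rightarrow>
   ('k, 'o \<times> ('g \<Rightarrow> 'm), ('o \<times> ('g \<Rightarrow> 'm)) \<times> ('o \<times> ('g \<Rightarrow> 'm)) \<times> 'm) lincat" where
  "equivariant_category G C \<phi> \<epsilon> =
     \<lparr>Ob = equivariant_objects G C \<phi> \<epsilon>,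
      Ar = equivariant_arrows G C \<phi> \<epsilon>,
      Dom = (\<lambda>(P, Q, f). P),
      Cod = (\<lambda>(P, Q, f). Q),
      Ident = (\<lambda>P. (P, P, Ident C (fst P))),
      Comp = (\<lambda>(Q', R, g) (P, Q, f). (P, R, g \<cdot>\<^bsub>C\<^esub> f)),
      hsum = (\<lambda>(P, Q, f) (P', Q', f'). (P, Q, hsum C f f')),
      hzero = (\<lambda>P Q. (P, Q, hzero C (fst P) (fst Q))),
      hscale = (\<lambda>a (P, Q, f). (P, Q, hscale C a f))\<rparr>"


section \<open>The dual group\<close>

definition units_group :: "'k::field monoid" where
  "units_group = \<lparr>carrier = UNIV - {0}, monoid.mult = (*), monoid.one = 1\<rparr>"

definition dual_group :: "'g monoid \<Rightarrow> ('g \<Rightarrow> 'k::field) monoid" where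
  "dual_group G =
     \<lparr>carrier = hom G units_group \<inter> extensional (carrier G),
      monoid.mult = (\<lambda>\<chi> \<psi>. \<lambda>g \<in> carrier G. \<chi> g * \<psi> g),
      monoid.one = (\<lambda>g \<in> carrier G. 1)\<rparr>"

end

theory Submission
  imports Defs "HOL-Algebra.Multiplicative_Group"
begin

text \<open>
  The dual group acts strictly on \<open>C\<^sup>G\<close> by \<open>\<chi> \<cdot> (X, \<theta>) = (X, \<chi>\<theta>)\<close>; conjugating with an equivalence
  \<open>F\<close> from \<open>B\<close> to \<open>C\<^sup>G\<close> and its quasi-inverse gives an action on \<open>B\<close>, whose cocycle condition is
  just naturality of the counit. An equivariant object \<open>Y\<close> of \<open>B\<close> then amounts to \<open>F(Y) = (X, \<theta>)\<close>
  together with automorphisms \<open>a\<^sub>\<chi>\<close> of \<open>X\<close> in \<open>C\<close> representing the dual group and satisfying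
  \<open>\<phi>\<^sub>g(a\<^sub>\<chi>) \<theta>\<^sub>g = \<chi>(g) \<theta>\<^sub>g a\<^sub>\<chi>\<close>. Hence \<open>X\<close> is the sum of the isotypic components of the \<open>a\<^sub>\<chi>\<close>, and
  \<open>\<theta>\<^sub>g\<close> identifies them with the translates \<open>\<phi>\<^sub>g(X\<^sub>0)\<close> of the invariant part \<open>X\<^sub>0\<close>, the image of the
  projector \<open>|G|\<^sup>-\<^sup>1 \<Sum>\<^sub>\<chi> a\<^sub>\<chi>\<close>. So \<open>Y \<mapsto> X\<^sub>0\<close> is fully faithful, and the induced objects
  \<open>\<Oplus>\<^sub>g \<phi>\<^sub>g(Z)\<close> show that it is essentially surjective.
\<close>

section \<open>Calculus of arrows in a linear category\<close>

text \<open>The isotypic components are indexed by elements of G rather than by characters of the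
  dual group. Let p be the invariant projector. The relation between a_\<chi> and \<theta>_g turns
  p_g = \<theta>_g^-1 \<phi>_g(p) \<theta>_g into |G|^-1 times the sum over \<chi> of \<chi>(g)
  a_\<chi>. That the p_g add up to 1 is the vanishing of the sum over g of \<chi>(g) for nontrivial
  \<chi>; that p p_g = 0 for g other than 1 is the vanishing of the sum over \<chi> of \<chi>(g).
  The second relation is where the field matters: some character must be nontrivial on g, and this
  takes a nontrivial root of unity of suitable order.

  The obstacle is a missing unit: an action comes with no isomorphism between \<phi>_1 and the
  identity functor. On equivariant objects \<theta>_1 supplies one, natural even for arrows that are
  not equivariant, and this makes the extension of an arrow of invariant parts restrict to the given
  arrow. For essential surjectivity an object Z is first replaced by a preimage under the
  autoequivalence \<phi>_1.\<close>

lemma Hom_iff: "f \<in> Hom C X Y \<longleftrightarrow> f \<in> Ar C \<and> Dom C f = X \<and> Cod C f = Y"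
  by (auto simp: Hom_def)

text \<open>Membership mentions neither source nor target, so it is a premise that rewriting can
  discharge; \<open>is_iso\<close> carries both objects as arguments.\<close>

definition isos :: "('k, 'o, 'm) lincat \<Rightarrow> 'm set" where
  "isos C = {f \<in> Ar C. is_iso C (Dom C f) (Cod C f) f}"

definition inverse_arrow :: "('k, 'o, 'm) lincat \<Rightarrow> 'm \<Rightarrow> 'm" where
  "inverse_arrow C f =
     (SOME g. g \<in> Hom C (Cod C f) (Dom C f) \<and>
        g \<cdot>\<^bsub>C\<^esub> f = Ident C (Dom C f) \<and> f \<cdot>\<^bsub>C\<^esub> g = Ident C (Cod C f))"

lemma is_iso_iff: "is_iso C X Y f \<longleftrightarrow> f \<in> isos C \<and> Dom C f = X \<and> Cod C f = Y"
  by (auto simp: isos_def is_iso_def Hom_iff)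

text \<open>The product of \<open>Hom_group\<close> is the addition of parallel arrows, so the
  multiplicative \<open>finprod\<close> is a sum here. Source and target are arguments because the
  empty sum has to be a definite zero arrow.\<close>

definition Hom_sum :: "('k, 'o, 'm) lincat \<Rightarrow> 'o \<Rightarrow> 'o \<Rightarrow> ('i \<Rightarrow> 'm) \<Rightarrow> 'i set \<Rightarrow> 'm" where
  "Hom_sum C X Y f A = finprod (Hom_group C X Y) f A"

context linear_category
begin

lemma Dom_Cod_Ob [simp]:
  assumes "f \<in> Ar C"
  shows "Dom C f \<in> Ob C" "Cod C f \<in> Ob C"
  using assms Dom_Ob Cod_Ob by auto

lemma Ident_Ar [simp]:
  assumes "X \<in> Ob C"
  shows "Ident C X \<in> Ar C" "Dom C (Ident C X) = X" "Cod C (Ident C X) = X"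
  using Ident_Hom[OF assms] by (auto simp: Hom_iff)

text \<open>In \<open>Comp_Hom\<close> the middle object occurs only in the premises. With
  \<open>Dom\<close> and \<open>Cod\<close> the typing conditions become equations solved by
  rewriting; the rules that follow have the same form, and \<open>Comp_assoc_Ar\<close> makes
  bracketing to the right the normal form.\<close>

lemma Comp_Ar [simp]:
  assumes "f \<in> Ar C" "g \<in> Ar C" "Cod C f = Dom C g"
  shows "g \<cdot> f \<in> Ar C" "Dom C (g \<cdot> f) = Dom C f" "Cod C (g \<cdot> f) = Cod C g"
  using Comp_Hom[of f "Dom C f" "Cod C f" g "Cod C g"] assms by (auto simp: Hom_iff)

lemma Comp_assoc_Ar [simp]:
  assumes "f \<in> Ar C" "g \<in> Ar C" "h \<in> Ar C" "Cod C f = Dom C g" "Cod C g = Dom C h"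
  shows "(h \<cdot> g) \<cdot> f = h \<cdot> (g \<cdot> f)"
  using Comp_assoc[of f "Dom C f" "Cod C f" g "Cod C g" h "Cod C h"] assms by (auto simp: Hom_iff)

lemma Comp_Ident [simp]:
  shows "f \<in> Ar C \<Longrightarrow> Cod C f = Y \<Longrightarrow> Ident C Y \<cdot> f = f"
    and "f \<in> Ar C \<Longrightarrow> Dom C f = X \<Longrightarrow> f \<cdot> Ident C X = f"
  using Comp_Ident_left[of f "Dom C f" "Cod C f"] Comp_Ident_right[of f "Dom C f" "Cod C f"]
  by (auto simp: Hom_iff)

lemma hscale_Ar [simp]:
  assumes "f \<in> Ar C"
  shows "hscale C a f \<in> Ar C" "Dom C (hscale C a f) = Dom C f" "Cod C (hscale C a f) = Cod C f"
  using hscale_Hom[of f "Dom C f" "Cod C f" a] assms by (auto simp: Hom_iff)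

lemma hscale_simps [simp]:
  assumes "f \<in> Ar C"
  shows "hscale C 1 f = f" "hscale C a (hscale C b f) = hscale C (a * b) f"
  using hscale_one[of f "Dom C f" "Cod C f"] hscale_hscale[of f "Dom C f" "Cod C f" a] assms
  by (auto simp: Hom_iff)

lemma Comp_hscale [simp]:
  assumes "f \<in> Ar C" "g \<in> Ar C" "Cod C f = Dom C g"
  shows "hscale C a g \<cdot> f = hscale C a (g \<cdot> f)" "g \<cdot> hscale C a f = hscale C a (g \<cdot> f)"
  using Comp_hscale_left[of f "Dom C f" "Cod C f" g "Cod C g" a]
    Comp_hscale_right[of f "Dom C f" "Cod C f" g "Cod C g" a] assms
  by (auto simp: Hom_iff)

lemma hscale_cancel:
  assumes "f \<in> Ar C" "g \<in> Ar C" "a \<noteq> 0" "hscale C a f = hscale C a g"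
  shows "f = g"
proof -
  have "hscale C (inverse a) (hscale C a f) = hscale C (inverse a) (hscale C a g)"
    using assms(4) by (rule arg_cong)
  then show ?thesis using assms(1-3) by simp
qed

lemma Hom_sum_group:
  assumes "X \<in> Ob C" "Y \<in> Ob C"
  shows "comm_monoid (Hom_group C X Y)"
  using Hom_comm_group[OF assms] by (simp add: comm_group_def)

lemma Hom_group_simps [simp]:
  "carrier (Hom_group C X Y) = Hom C X Y" "monoid.mult (Hom_group C X Y) = hsum C"
  "monoid.one (Hom_group C X Y) = hzero C X Y"
  by (auto simp: Hom_group_def)

lemma hzero_Ar [simp]:
  assumes "X \<in> Ob C" "Y \<in> Ob C"
  shows "hzero C X Y \<in> Ar C" "Dom C (hzero C X Y) = X" "Cod C (hzero C X Y) = Y"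
proof -
  interpret comm_group "Hom_group C X Y" using assms by (rule Hom_comm_group)
  show "hzero C X Y \<in> Ar C" "Dom C (hzero C X Y) = X" "Cod C (hzero C X Y) = Y"
    using one_closed by (simp_all add: Hom_iff)
qed

lemma hsum_Ar [simp]:
  assumes "f \<in> Ar C" "g \<in> Ar C" "Dom C f = Dom C g" "Cod C f = Cod C g"
  shows "hsum C f g \<in> Ar C" "Dom C (hsum C f g) = Dom C f" "Cod C (hsum C f g) = Cod C f"
proof -
  interpret comm_group "Hom_group C (Dom C f) (Cod C f)"
    using assms by (intro Hom_comm_group) auto
  show "hsum C f g \<in> Ar C" "Dom C (hsum C f g) = Dom C f" "Cod C (hsum C f g) = Cod C f"
    using m_closed[of f g] assms by (simp_all add: Hom_iff)
qed

lemma hsum_hzero: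
  assumes "f \<in> Hom C X Y"
  shows "hsum C (hzero C X Y) f = f" "hsum C f (hzero C X Y) = f"
proof -
  interpret comm_group "Hom_group C X Y"
    using assms by (intro Hom_comm_group) (auto simp: Hom_iff)
  show "hsum C (hzero C X Y) f = f" "hsum C f (hzero C X Y) = f"
    using l_one[of f] r_one[of f] assms by simp_all
qed

text \<open>Distributivity over 0 + 0 shows that the arrow equals its own double, and in a group
  only the neutral element does.\<close>

lemma hscale_0 [simp]:
  assumes "f \<in> Ar C"
  shows "hscale C 0 f = hzero C (Dom C f) (Cod C f)"
proof -
  interpret comm_group "Hom_group C (Dom C f) (Cod C f)"
    using assms by (intro Hom_comm_group) auto
  let ?z = "hscale C 0 f"
  have z: "?z \<in> Hom C (Dom C f) (Cod C f)"
    using assms by (simp add: Hom_iff)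
  have "hsum C ?z ?z = ?z"
    using hscale_add[of f "Dom C f" "Cod C f" 0 0] assms by (simp add: Hom_iff)
  then show ?thesis
    using z l_cancel_one[of ?z ?z] by simp
qed

lemma hscale_hzero [simp]:
  assumes "X \<in> Ob C" "Y \<in> Ob C"
  shows "hscale C a (hzero C X Y) = hzero C X Y"
proof -
  have "hscale C a (hscale C 0 (hzero C X Y)) = hscale C 0 (hzero C X Y)"
    using assms by (subst hscale_simps) (auto simp del: hscale_0)
  then show ?thesis using assms by simp
qed

text \<open>A zero arrow is 0 times itself; the scalar is pulled out of the composite and
  \<open>hscale_0\<close> applies.\<close>

lemma Comp_hzero [simp]:
  assumes "f \<in> Ar C"
  shows "W \<in> Ob C \<Longrightarrow> Dom C f = X \<Longrightarrow> f \<cdot> hzero C W X = hzero C W (Cod C f)"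
    and "Z \<in> Ob C \<Longrightarrow> Cod C f = Y \<Longrightarrow> hzero C Y Z \<cdot> f = hzero C (Dom C f) Z"
proof -
  assume "W \<in> Ob C" "Dom C f = X"
  then have "f \<cdot> hscale C 0 (hzero C W X) = hscale C 0 (f \<cdot> hzero C W X)"
    using assms by (subst Comp_hscale) auto
  then show "f \<cdot> hzero C W X = hzero C W (Cod C f)"
    using assms \<open>W \<in> Ob C\<close> \<open>Dom C f = X\<close> by auto
next
  assume "Z \<in> Ob C" "Cod C f = Y"
  then have "hscale C 0 (hzero C Y Z) \<cdot> f = hscale C 0 (hzero C Y Z \<cdot> f)"
    using assms by (subst Comp_hscale) auto
  then show "hzero C Y Z \<cdot> f = hzero C (Dom C f) Z"
    using assms \<open>Z \<in> Ob C\<close> \<open>Cod C f = Y\<close> by auto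
qed

section \<open>Finite sums of parallel arrows\<close>

lemma Hom_sum_empty:
  assumes "X \<in> Ob C" "Y \<in> Ob C"
  shows "Hom_sum C X Y f {} = hzero C X Y"
proof -
  interpret comm_monoid "Hom_group C X Y" using assms by (rule Hom_sum_group)
  show ?thesis by (simp add: Hom_sum_def)
qed

lemma Hom_sum_insert:
  assumes "finite A" "a \<notin> A" "\<And>x. x \<in> insert a A \<Longrightarrow> f x \<in> Hom C X Y"
  shows "Hom_sum C X Y f (insert a A) = hsum C (f a) (Hom_sum C X Y f A)"
proof -
  interpret comm_monoid "Hom_group C X Y"
    using assms(3)[of a] by (intro Hom_sum_group) (auto simp: Hom_iff)
  show ?thesis using assms by (simp add: Hom_sum_def)
qed

lemma Hom_sum_Hom:
  assumes "X \<in> Ob C" "Y \<in> Ob C" "\<And>x. x \<in> A \<Longrightarrow> f x \<in> Hom C X Y"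
  shows "Hom_sum C X Y f A \<in> Hom C X Y"
proof -
  interpret comm_monoid "Hom_group C X Y" using assms(1,2) by (rule Hom_sum_group)
  show ?thesis using finprod_closed[of f A] assms by (auto simp add: Hom_sum_def)
qed

lemma Hom_sum_Ar [simp]:
  assumes "X \<in> Ob C" "Y \<in> Ob C" "\<And>x. x \<in> A \<Longrightarrow> f x \<in> Hom C X Y"
  shows "Hom_sum C X Y f A \<in> Ar C" "Dom C (Hom_sum C X Y f A) = X" "Cod C (Hom_sum C X Y f A) = Y"
  using Hom_sum_Hom[OF assms(1,2), of A f] assms(3) by (simp_all add: Hom_iff)

lemma Hom_sum_cong:
  assumes "X \<in> Ob C" "Y \<in> Ob C" "A = B"
    "\<And>x. x \<in> B \<Longrightarrow> f x = g x" "\<And>x. x \<in> B \<Longrightarrow> g x \<in> Hom C X Y"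
  shows "Hom_sum C X Y f A = Hom_sum C X Y g B"
proof -
  interpret comm_monoid "Hom_group C X Y" using assms(1,2) by (rule Hom_sum_group)
  show ?thesis unfolding Hom_sum_def using assms by (intro finprod_cong') auto
qed

lemma Hom_sum_hzero:
  assumes "X \<in> Ob C" "Y \<in> Ob C" "\<And>x. x \<in> A \<Longrightarrow> f x = hzero C X Y"
  shows "Hom_sum C X Y f A = hzero C X Y"
proof -
  interpret comm_monoid "Hom_group C X Y" using assms(1,2) by (rule Hom_sum_group)
  show ?thesis using finprod_one_eqI[of A f] assms by (simp add: Hom_sum_def)
qed

lemma Hom_sum_hsum:
  assumes "X \<in> Ob C" "Y \<in> Ob C"
    "\<And>x. x \<in> A \<Longrightarrow> f x \<in> Hom C X Y" "\<And>x. x \<in> A \<Longrightarrow> g x \<in> Hom C X Y"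
  shows "Hom_sum C X Y (\<lambda>x. hsum C (f x) (g x)) A
    = hsum C (Hom_sum C X Y f A) (Hom_sum C X Y g A)"
proof -
  interpret comm_monoid "Hom_group C X Y" using assms(1,2) by (rule Hom_sum_group)
  show ?thesis using finprod_multf[of f A g] assms by (simp add: Hom_sum_def Pi_iff)
qed

lemma Hom_sum_reindex:
  assumes "X \<in> Ob C" "Y \<in> Ob C" "bij_betw r A B" "\<And>x. x \<in> B \<Longrightarrow> f x \<in> Hom C X Y"
  shows "Hom_sum C X Y (\<lambda>x. f (r x)) A = Hom_sum C X Y f B"
proof -
  interpret comm_monoid "Hom_group C X Y" using assms(1,2) by (rule Hom_sum_group)
  have "r ` A = B" "inj_on r A" using assms(3) by (auto simp: bij_betw_def)
  then show ?thesis using finprod_reindex[of f r A] assms(4) by (auto simp add: Hom_sum_def Pi_iff)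
qed

lemma Hom_sum_delta:
  assumes "finite A" "a \<in> A" "f a \<in> Hom C X Y"
    "\<And>x. x \<in> A \<Longrightarrow> x \<noteq> a \<Longrightarrow> f x = hzero C X Y"
  shows "Hom_sum C X Y f A = f a"
proof -
  have XY: "X \<in> Ob C" "Y \<in> Ob C" using assms(3) by (auto simp: Hom_iff)
  have f: "f x \<in> Hom C X Y" if "x \<in> A" for x
    using assms XY that by (cases "x = a") (auto simp: Hom_iff)
  have "Hom_sum C X Y f (insert a (A - {a})) = hsum C (f a) (Hom_sum C X Y f (A - {a}))"
    using assms(1,2) f by (intro Hom_sum_insert) auto
  also have "Hom_sum C X Y f (A - {a}) = hzero C X Y"
    using assms XY by (intro Hom_sum_hzero) auto
  finally show ?thesis using assms by (simp add: insert_absorb hsum_hzero)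
qed

lemma Hom_sum_swap:
  assumes "finite A" "finite B" "X \<in> Ob C" "Y \<in> Ob C"
    "\<And>x y. x \<in> A \<Longrightarrow> y \<in> B \<Longrightarrow> f x y \<in> Hom C X Y"
  shows "Hom_sum C X Y (\<lambda>x. Hom_sum C X Y (f x) B) A
    = Hom_sum C X Y (\<lambda>y. Hom_sum C X Y (\<lambda>x. f x y) A) B"
  using assms(1,5)
proof (induction A rule: finite_induct)
  case empty
  then show ?case using assms(3,4) by (simp add: Hom_sum_empty Hom_sum_hzero)
next
  case (insert a A)
  have "Hom_sum C X Y (\<lambda>x. Hom_sum C X Y (f x) B) (insert a A)
      = hsum C (Hom_sum C X Y (f a) B) (Hom_sum C X Y (\<lambda>x. Hom_sum C X Y (f x) B) A)"
    using insert assms(3,4) by (intro Hom_sum_insert Hom_sum_Hom) auto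
  also have "\<dots> = Hom_sum C X Y (\<lambda>y. hsum C (f a y) (Hom_sum C X Y (\<lambda>x. f x y) A)) B"
    using insert assms(3,4) by (subst Hom_sum_hsum) (auto intro!: Hom_sum_Hom)
  also have "\<dots> = Hom_sum C X Y (\<lambda>y. Hom_sum C X Y (\<lambda>x. f x y) (insert a A)) B"
    using insert assms(3,4) by (intro Hom_sum_cong Hom_sum_insert[symmetric] Hom_sum_Hom) auto
  finally show ?case .
qed

lemma Comp_hsum:
  assumes "f \<in> Hom C X Y" "f' \<in> Hom C X Y"
  shows "g \<in> Hom C Y Z \<Longrightarrow> g \<cdot> hsum C f f' = hsum C (g \<cdot> f) (g \<cdot> f')"
    and "g \<in> Hom C W X \<Longrightarrow> hsum C f f' \<cdot> g = hsum C (f \<cdot> g) (f' \<cdot> g)"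
  using assms by (auto intro: Comp_hsum_left Comp_hsum_right)

lemma Comp_hsum_Ar [simp]:
  assumes "f \<in> Ar C" "f' \<in> Ar C" "g \<in> Ar C" "Dom C f = Dom C f'" "Cod C f = Cod C f'"
  shows "Dom C g = Cod C f' \<Longrightarrow> g \<cdot> hsum C f f' = hsum C (g \<cdot> f) (g \<cdot> f')"
    and "Cod C g = Dom C f' \<Longrightarrow> hsum C f f' \<cdot> g = hsum C (f \<cdot> g) (f' \<cdot> g)"
  using assms Comp_hsum(1)[of f "Dom C f'" "Cod C f'" f' g "Cod C g"]
    Comp_hsum(2)[of f "Dom C f'" "Cod C f'" f' g "Dom C g"] by (auto simp: Hom_iff)

lemma Comp_Hom_sum_right:
  assumes "finite A" "\<And>x. x \<in> A \<Longrightarrow> f x \<in> Hom C X Y" "X \<in> Ob C" "g \<in> Hom C Y Z"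
  shows "g \<cdot> Hom_sum C X Y f A = Hom_sum C X Z (\<lambda>x. g \<cdot> f x) A"
proof -
  have YZ: "Y \<in> Ob C" "Z \<in> Ob C" using assms(4) by (auto simp: Hom_iff)
  show ?thesis
    using assms(1,2)
  proof (induction A rule: finite_induct)
    case empty
    then show ?case using YZ assms(3,4) by (auto simp add: Hom_sum_empty Hom_iff)
  next
    case (insert a A)
    have "g \<cdot> Hom_sum C X Y f (insert a A) = g \<cdot> hsum C (f a) (Hom_sum C X Y f A)"
      using insert by (subst Hom_sum_insert) auto
    also have "\<dots> = hsum C (g \<cdot> f a) (g \<cdot> Hom_sum C X Y f A)"
      using insert YZ assms(3,4) by (intro Comp_hsum(1)[of _ X Y]) (auto intro!: Hom_sum_Hom)
    also have "\<dots> = Hom_sum C X Z (\<lambda>x. g \<cdot> f x) (insert a A)"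
      using insert YZ assms(3,4) by (subst Hom_sum_insert) (auto simp: Hom_iff)
    finally show ?case .
  qed
qed

lemma Comp_Hom_sum_left:
  assumes "finite A" "\<And>x. x \<in> A \<Longrightarrow> f x \<in> Hom C X Y" "Y \<in> Ob C" "g \<in> Hom C W X"
  shows "Hom_sum C X Y f A \<cdot> g = Hom_sum C W Y (\<lambda>x. f x \<cdot> g) A"
proof -
  have WX: "X \<in> Ob C" "W \<in> Ob C" using assms(4) by (auto simp: Hom_iff)
  show ?thesis
    using assms(1,2)
  proof (induction A rule: finite_induct)
    case empty
    then show ?case using WX assms(3,4) by (auto simp add: Hom_sum_empty Hom_iff)
  next
    case (insert a A)
    have "Hom_sum C X Y f (insert a A) \<cdot> g = hsum C (f a) (Hom_sum C X Y f A) \<cdot> g"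
      using insert by (subst Hom_sum_insert) auto
    also have "\<dots> = hsum C (f a \<cdot> g) (Hom_sum C X Y f A \<cdot> g)"
      using insert WX assms(3,4) by (intro Comp_hsum(2)[of _ X Y]) (auto intro!: Hom_sum_Hom)
    also have "\<dots> = Hom_sum C W Y (\<lambda>x. f x \<cdot> g) (insert a A)"
      using insert WX assms(3,4) by (subst Hom_sum_insert) (auto simp: Hom_iff)
    finally show ?case .
  qed
qed

lemma hscale_Hom_sum:
  assumes "finite A" "\<And>x. x \<in> A \<Longrightarrow> f x \<in> Hom C X Y" "X \<in> Ob C" "Y \<in> Ob C"
  shows "hscale C c (Hom_sum C X Y f A) = Hom_sum C X Y (\<lambda>x. hscale C c (f x)) A"
  using assms(1,2)
proof (induction A rule: finite_induct)
  case empty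
  then show ?case using assms by (auto simp add: Hom_sum_empty)
next
  case (insert a A)
  have "hscale C c (Hom_sum C X Y f (insert a A)) = hscale C c (hsum C (f a) (Hom_sum C X Y f A))"
    using insert by (subst Hom_sum_insert) auto
  also have "\<dots> = hsum C (hscale C c (f a)) (hscale C c (Hom_sum C X Y f A))"
    using insert assms(3,4) by (intro hscale_hsum[of _ X Y]) (auto intro!: Hom_sum_Hom)
  also have "\<dots> = Hom_sum C X Y (\<lambda>x. hscale C c (f x)) (insert a A)"
    using insert by (subst Hom_sum_insert) (auto simp: Hom_iff)
  finally show ?case .
qed

lemma Hom_sum_scalars:
  assumes "finite A" "f \<in> Hom C X Y"
  shows "Hom_sum C X Y (\<lambda>x. hscale C (c x) f) A = hscale C (sum c A) f"
proof -
  have XY: "X \<in> Ob C" "Y \<in> Ob C" using assms by (auto simp: Hom_iff)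
  show ?thesis
    using assms(1)
  proof (induction A rule: finite_induct)
    case empty
    then show ?case using assms XY by (auto simp add: Hom_sum_empty Hom_iff)
  next
    case (insert a A)
    have "Hom_sum C X Y (\<lambda>x. hscale C (c x) f) (insert a A)
        = hsum C (hscale C (c a) f) (Hom_sum C X Y (\<lambda>x. hscale C (c x) f) A)"
      using insert assms(2) by (intro Hom_sum_insert) (auto simp: Hom_iff)
    also have "\<dots> = hscale C (sum c (insert a A)) f"
      using insert hscale_add[OF assms(2)] by simp
    finally show ?case .
  qed
qed

section \<open>Isomorphisms, chosen inverses and cancellation\<close>

lemma isos_Ar [simp]: "f \<in> isos C \<Longrightarrow> f \<in> Ar C"
  by (simp add: isos_def)

lemma inverse_arrow_spec:
  assumes "f \<in> isos C"
  shows "inverse_arrow C f \<in> Hom C (Cod C f) (Dom C f) \<and>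
    inverse_arrow C f \<cdot> f = Ident C (Dom C f) \<and> f \<cdot> inverse_arrow C f = Ident C (Cod C f)"
proof -
  have "\<exists>g. g \<in> Hom C (Cod C f) (Dom C f) \<and>
      g \<cdot> f = Ident C (Dom C f) \<and> f \<cdot> g = Ident C (Cod C f)"
    using assms unfolding isos_def is_iso_def by blast
  then show ?thesis unfolding inverse_arrow_def by (rule someI_ex)
qed

lemma inverse_arrow_Ar [simp]:
  assumes "f \<in> isos C"
  shows "inverse_arrow C f \<in> Ar C" "Dom C (inverse_arrow C f) = Cod C f"
    "Cod C (inverse_arrow C f) = Dom C f" "inverse_arrow C f \<cdot> f = Ident C (Dom C f)"
    "f \<cdot> inverse_arrow C f = Ident C (Cod C f)"
  using inverse_arrow_spec[OF assms] by (auto simp: Hom_iff)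

lemma inverse_arrow_cancel [simp]:
  assumes "f \<in> isos C" "w \<in> Ar C"
  shows "Cod C w = Dom C f \<Longrightarrow> inverse_arrow C f \<cdot> (f \<cdot> w) = w"
    and "Cod C w = Cod C f \<Longrightarrow> f \<cdot> (inverse_arrow C f \<cdot> w) = w"
proof -
  assume "Cod C w = Dom C f"
  then show "inverse_arrow C f \<cdot> (f \<cdot> w) = w"
    using assms by (subst Comp_assoc_Ar[symmetric]) (auto simp del: Comp_assoc_Ar)
next
  assume "Cod C w = Cod C f"
  then show "f \<cdot> (inverse_arrow C f \<cdot> w) = w"
    using assms by (subst Comp_assoc_Ar[symmetric]) (auto simp del: Comp_assoc_Ar)
qed

lemma isosI:
  assumes "f \<in> Ar C" "g \<in> Ar C" "g \<cdot> f = Ident C (Dom C f)" "f \<cdot> g = Ident C (Cod C f)"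
    "Dom C g = Cod C f" "Cod C g = Dom C f"
  shows "f \<in> isos C"
proof -
  have "f \<in> Hom C (Dom C f) (Cod C f)" "g \<in> Hom C (Cod C f) (Dom C f)"
    using assms by (simp_all only: Hom_iff simp_thms)
  then show ?thesis
    unfolding isos_def is_iso_def using assms by blast
qed

lemma Ident_isos [simp]: "X \<in> Ob C \<Longrightarrow> Ident C X \<in> isos C"
  by (intro isosI[of _ "Ident C X"]) auto

lemma inverse_arrow_isos [simp]: "f \<in> isos C \<Longrightarrow> inverse_arrow C f \<in> isos C"
  by (intro isosI[of _ f]) auto

lemma Comp_isos [simp]:
  assumes "f \<in> isos C" "g \<in> isos C" "Cod C f = Dom C g"
  shows "g \<cdot> f \<in> isos C"
  using assms by (intro isosI[of _ "inverse_arrow C f \<cdot> inverse_arrow C g"]) auto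

lemma isos_cancel_left:
  assumes "f \<in> isos C" "u \<in> Ar C" "v \<in> Ar C" "Cod C u = Dom C f" "Cod C v = Dom C f"
    "f \<cdot> u = f \<cdot> v"
  shows "u = v"
  using arg_cong[OF assms(6), of "\<lambda>w. inverse_arrow C f \<cdot> w"] assms(1-5) by simp

lemma isos_cancel_right:
  assumes "f \<in> isos C" "u \<in> Ar C" "v \<in> Ar C" "Dom C u = Cod C f" "Dom C v = Cod C f"
    "u \<cdot> f = v \<cdot> f"
  shows "u = v"
  using arg_cong[OF assms(6), of "\<lambda>w. w \<cdot> inverse_arrow C f"] assms(1-5) by simp

lemma inverse_arrow_unique:
  assumes "f \<in> Ar C" "g \<in> Ar C" "g \<cdot> f = Ident C (Dom C f)" "f \<cdot> g = Ident C (Cod C f)"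
    "Dom C g = Cod C f" "Cod C g = Dom C f"
  shows "inverse_arrow C f = g"
  by (rule isos_cancel_left[of f]) (use isosI[OF assms] assms in \<open>auto\<close>)

lemma hscale_isos [simp]:
  assumes "f \<in> isos C" "a \<noteq> 0"
  shows "hscale C a f \<in> isos C"
  using assms by (intro isosI[of _ "hscale C (inverse a) (inverse_arrow C f)"]) auto

end


section \<open>Functors and equivalences\<close>

context linear_functor
begin

lemma ob_map_in_Ob [simp]: "X \<in> Ob A \<Longrightarrow> ob_map F X \<in> Ob B"
  by (rule ob_map_Ob)

lemma ar_map_Ar [simp]:
  assumes "f \<in> Ar A"
  shows "ar_map F f \<in> Ar B" "Dom B (ar_map F f) = ob_map F (Dom A f)"
    "Cod B (ar_map F f) = ob_map F (Cod A f)"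
  using ar_map_Hom[of f "Dom A f" "Cod A f"] assms by (auto simp: Hom_iff)

lemma ar_map_Ident_Comp [simp]:
  shows "X \<in> Ob A \<Longrightarrow> ar_map F (Ident A X) = Ident B (ob_map F X)"
    and "f \<in> Ar A \<Longrightarrow> g \<in> Ar A \<Longrightarrow> Cod A f = Dom A g \<Longrightarrow>
      ar_map F (g \<cdot>\<^bsub>A\<^esub> f) = ar_map F g \<cdot>\<^bsub>B\<^esub> ar_map F f"
    and "f \<in> Ar A \<Longrightarrow> ar_map F (hscale A a f) = hscale B a (ar_map F f)"
  by (auto intro: ar_map_Ident ar_map_Comp[of f "Dom A f" "Cod A f"]
      ar_map_hscale[of f "Dom A f" "Cod A f"] simp: Hom_iff)

lemma ar_map_hsum_Ar [simp]:
  assumes "f \<in> Ar A" "g \<in> Ar A" "Dom A f = Dom A g" "Cod A f = Cod A g"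
  shows "ar_map F (hsum A f g) = hsum B (ar_map F f) (ar_map F g)"
  using ar_map_hsum[of f "Dom A g" "Cod A g" g] assms by (auto simp: Hom_iff)

lemma ar_map_hzero [simp]:
  assumes "X \<in> Ob A" "Y \<in> Ob A"
  shows "ar_map F (hzero A X Y) = hzero B (ob_map F X) (ob_map F Y)"
proof -
  have "ar_map F (hscale A 0 (hzero A X Y)) = hscale B 0 (ar_map F (hzero A X Y))"
    using assms by (subst ar_map_Ident_Comp) auto
  then show ?thesis using assms by simp
qed

lemma ar_map_isos [simp]:
  assumes "f \<in> isos A"
  shows "ar_map F f \<in> isos B"
proof -
  have "ar_map F (inverse_arrow A f) \<cdot>\<^bsub>B\<^esub> ar_map F f = ar_map F (inverse_arrow A f \<cdot>\<^bsub>A\<^esub> f)"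
    using assms by (subst ar_map_Ident_Comp) auto
  moreover have "ar_map F f \<cdot>\<^bsub>B\<^esub> ar_map F (inverse_arrow A f) = ar_map F (f \<cdot>\<^bsub>A\<^esub> inverse_arrow A f)"
    using assms by (subst ar_map_Ident_Comp) auto
  ultimately show ?thesis
    using assms by (intro B.isosI[of _ "ar_map F (inverse_arrow A f)"]) auto
qed

lemma ar_map_inverse_arrow [simp]:
  assumes "f \<in> isos A"
  shows "ar_map F (inverse_arrow A f) = inverse_arrow B (ar_map F f)"
proof -
  have "ar_map F f \<cdot>\<^bsub>B\<^esub> ar_map F (inverse_arrow A f) = ar_map F (f \<cdot>\<^bsub>A\<^esub> inverse_arrow A f)"
    using assms by (subst ar_map_Ident_Comp) auto
  note eq = this
  show ?thesis
    by (rule B.isos_cancel_left[of "ar_map F f"]) (use assms eq in \<open>auto\<close>)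
qed

lemma ar_map_Hom_sum:
  assumes "finite I" "\<And>x. x \<in> I \<Longrightarrow> f x \<in> Hom A X Y" "X \<in> Ob A" "Y \<in> Ob A"
  shows "ar_map F (Hom_sum A X Y f I)
    = Hom_sum B (ob_map F X) (ob_map F Y) (\<lambda>x. ar_map F (f x)) I"
  using assms(1,2)
proof (induction I rule: finite_induct)
  case empty
  then show ?case using assms by (auto simp: A.Hom_sum_empty B.Hom_sum_empty)
next
  case (insert a I)
  have "ar_map F (Hom_sum A X Y f (insert a I)) = ar_map F (hsum A (f a) (Hom_sum A X Y f I))"
    using insert by (subst A.Hom_sum_insert) auto
  also have "\<dots> = hsum B (ar_map F (f a)) (ar_map F (Hom_sum A X Y f I))"
    using insert assms(3,4) by (intro ar_map_hsum[of _ X Y]) (auto intro!: A.Hom_sum_Hom)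
  also have "\<dots> = Hom_sum B (ob_map F X) (ob_map F Y) (\<lambda>x. ar_map F (f x)) (insert a I)"
    using insert by (subst B.Hom_sum_insert) (auto intro: ar_map_Hom)
  finally show ?case .
qed

end

context natural_isomorphism
begin

lemma component [simp]:
  assumes "X \<in> Ob A"
  shows "\<eta> X \<in> isos B" "Dom B (\<eta> X) = ob_map F X" "Cod B (\<eta> X) = ob_map F' X"
  using component_iso[OF assms] by (auto simp: is_iso_iff)

lemma component_Ar [simp]: "X \<in> Ob A \<Longrightarrow> \<eta> X \<in> Ar B"
  using component by simp

lemma naturality_Ar:
  assumes "f \<in> Ar A"
  shows "\<eta> (Cod A f) \<cdot>\<^bsub>B\<^esub> ar_map F f = ar_map F' f \<cdot>\<^bsub>B\<^esub> \<eta> (Dom A f)"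
  using naturality[of f "Dom A f" "Cod A f"] assms by (simp add: Hom_iff)

end

lemma comp_functr_simps [simp]:
  "ob_map (comp_functr F' F) X = ob_map F' (ob_map F X)"
  "ar_map (comp_functr F' F) f = ar_map F' (ar_map F f)"
  by (auto simp: comp_functr_def)

lemma id_functr_simps [simp]: "ob_map id_functr X = X" "ar_map id_functr f = f"
  by (auto simp: id_functr_def)

lemma linear_functor_comp:
  assumes "linear_functor A B F" "linear_functor B C F'"
  shows "linear_functor A C (comp_functr F' F)"
proof -
  interpret F: linear_functor A B F by fact
  interpret F': linear_functor B C F' by fact
  show ?thesis
    by unfold_locales
      (auto simp: Hom_iff)
qed

lemma linear_functor_id:
  assumes "linear_category A"
  shows "linear_functor A A id_functr"
proof -
  interpret linear_category A by fact
  show ?thesis by unfold_locales auto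
qed

section \<open>Equivalences as fully faithful, essentially surjective functors\<close>

definition fully_faithful ::
  "('k, 'o, 'm) lincat \<Rightarrow> ('k, 'p, 'n) lincat \<Rightarrow> ('o, 'm, 'p, 'n) functr \<Rightarrow> bool" where
  "fully_faithful A B F \<longleftrightarrow> (\<forall>X \<in> Ob A. \<forall>Y \<in> Ob A.
     bij_betw (ar_map F) (Hom A X Y) (Hom B (ob_map F X) (ob_map F Y)))"

definition essentially_surjective ::
  "('k, 'o, 'm) lincat \<Rightarrow> ('k, 'p, 'n) lincat \<Rightarrow> ('o, 'm, 'p, 'n) functr \<Rightarrow> bool" where
  "essentially_surjective A B F \<longleftrightarrow>
     (\<forall>Z \<in> Ob B. \<exists>X \<in> Ob A. \<exists>f \<in> isos B. Dom B f = ob_map F X \<and> Cod B f = Z)"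

lemma fully_faithfulI:
  assumes "linear_functor A B F"
    and "\<And>u v. u \<in> Ar A \<Longrightarrow> v \<in> Ar A \<Longrightarrow> Dom A u = Dom A v \<Longrightarrow> Cod A u = Cod A v \<Longrightarrow>
      ar_map F u = ar_map F v \<Longrightarrow> u = v"
    and "\<And>X Y v. X \<in> Ob A \<Longrightarrow> Y \<in> Ob A \<Longrightarrow> v \<in> Hom B (ob_map F X) (ob_map F Y) \<Longrightarrow>
      \<exists>u \<in> Hom A X Y. ar_map F u = v"
  shows "fully_faithful A B F"
proof -
  interpret linear_functor A B F by fact
  show ?thesis
    unfolding fully_faithful_def bij_betw_def inj_on_def
  proof (intro ballI conjI impI)
    fix X Y assume X: "X \<in> Ob A" "Y \<in> Ob A"
    show "u = v" if "u \<in> Hom A X Y" "v \<in> Hom A X Y" "ar_map F u = ar_map F v" for u v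
      using assms(2)[of u v] that by (auto simp: Hom_iff)
    show "ar_map F ` Hom A X Y = Hom B (ob_map F X) (ob_map F Y)"
      using assms(3)[OF X] ar_map_Hom by fast
  qed
qed

lemma fully_faithful_faithful:
  assumes "fully_faithful A B F" "linear_functor A B F"
    "u \<in> Ar A" "v \<in> Ar A" "Dom A u = Dom A v" "Cod A u = Cod A v" "ar_map F u = ar_map F v"
  shows "u = v"
proof -
  interpret linear_functor A B F by fact
  have "inj_on (ar_map F) (Hom A (Dom A u) (Cod A u))"
    using assms unfolding fully_faithful_def bij_betw_def by auto
  then show ?thesis using assms by (auto simp: inj_on_def Hom_iff)
qed

lemma fully_faithful_full:
  assumes "fully_faithful A B F" "X \<in> Ob A" "Y \<in> Ob A"
    "v \<in> Ar B" "Dom B v = ob_map F X" "Cod B v = ob_map F Y"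
  obtains u where "u \<in> Ar A" "Dom A u = X" "Cod A u = Y" "ar_map F u = v"
proof -
  have "v \<in> ar_map F ` Hom A X Y"
    using assms unfolding fully_faithful_def bij_betw_def by (auto simp: Hom_iff)
  then show ?thesis using that by (auto simp: Hom_iff)
qed

lemma fully_faithful_reflects_isos:
  assumes "fully_faithful A B F" "linear_functor A B F" "u \<in> Ar A" "ar_map F u \<in> isos B"
  shows "u \<in> isos A"
proof -
  interpret linear_functor A B F by fact
  obtain v where v: "v \<in> Ar A" "Dom A v = Cod A u" "Cod A v = Dom A u"
      "ar_map F v = inverse_arrow B (ar_map F u)"
    using fully_faithful_full[of A B F "Cod A u" "Dom A u" "inverse_arrow B (ar_map F u)"] assms
    by auto
  have "v \<cdot>\<^bsub>A\<^esub> u = Ident A (Dom A u)"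
    by (rule fully_faithful_faithful[OF assms(1,2)]) (use v assms in \<open>auto\<close>)
  moreover have "u \<cdot>\<^bsub>A\<^esub> v = Ident A (Cod A u)"
    by (rule fully_faithful_faithful[OF assms(1,2)]) (use v assms in \<open>auto\<close>)
  ultimately show ?thesis using v assms by (intro A.isosI[of _ v]) auto
qed

lemma linear_equivalence_imp:
  assumes "linear_equivalence A B F"
  shows "fully_faithful A B F" "essentially_surjective A B F"
proof -
  obtain F' \<eta> \<eta>' where F: "linear_functor A B F" "linear_functor B A F'"
      "natural_isomorphism A A (comp_functr F' F) id_functr \<eta>"
      "natural_isomorphism B B (comp_functr F F') id_functr \<eta>'"
    using assms unfolding linear_equivalence_def by blast
  interpret F: linear_functor A B F by fact
  interpret F': linear_functor B A F' by fact
  interpret \<eta>: natural_isomorphism A A "comp_functr F' F" id_functr \<eta> by fact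
  interpret \<eta>': natural_isomorphism B B "comp_functr F F'" id_functr \<eta>' by fact
  note [simp] = \<eta>.component[unfolded comp_functr_simps id_functr_simps]
    \<eta>'.component[unfolded comp_functr_simps id_functr_simps]
  \<comment> \<open>As \<eta> is invertible, naturality expresses u through \<open>F'(F(u))\<close>,
    so F separates parallel arrows. The counit does the same for \<open>F'\<close>, which fullness
    uses below.\<close>
  have faithful: "u = v" if uv: "u \<in> Ar A" "v \<in> Ar A" "Dom A u = Dom A v" "Cod A u = Cod A v"
      "ar_map F u = ar_map F v" for u v
    by (rule F.A.isos_cancel_right[of "\<eta> (Dom A u)"]) (use \<eta>.naturality_Ar[of u] \<eta>.naturality_Ar[of v] uv in \<open>auto\<close>)
  have faithful': "u = v" if uv: "u \<in> Ar B" "v \<in> Ar B" "Dom B u = Dom B v" "Cod B u = Cod B v"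
      "ar_map F' u = ar_map F' v" for u v
    by (rule F.B.isos_cancel_right[of "\<eta>' (Dom B u)"]) (use \<eta>'.naturality_Ar[of u] \<eta>'.naturality_Ar[of v] uv in \<open>auto\<close>)
  show "fully_faithful A B F"
  proof (rule fully_faithfulI[OF F(1) faithful])
    fix X Y v assume XY: "X \<in> Ob A" "Y \<in> Ob A" and "v \<in> Hom B (ob_map F X) (ob_map F Y)"
    then have v: "v \<in> Ar B" "Dom B v = ob_map F X" "Cod B v = ob_map F Y"
      by (auto simp: Hom_iff)
    \<comment> \<open>If F(u) = v, naturality of \<eta> leaves only this candidate. Conversely
      naturality gives \<open>F'(F(u)) = F'(v)\<close>, and faithfulness of \<open>F'\<close>
      removes \<open>F'\<close>.\<close>
    let ?u = "\<eta> Y \<cdot>\<^bsub>A\<^esub> (ar_map F' v \<cdot>\<^bsub>A\<^esub> inverse_arrow A (\<eta> X))"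
    have u: "?u \<in> Ar A" "Dom A ?u = X" "Cod A ?u = Y"
      using v XY by auto
    have "\<eta> Y \<cdot>\<^bsub>A\<^esub> ar_map F' (ar_map F ?u) = ?u \<cdot>\<^bsub>A\<^esub> \<eta> X"
      using \<eta>.naturality_Ar[of ?u] u by (simp del: F.ar_map_Ident_Comp F'.ar_map_Ident_Comp)
    also have "\<dots> = \<eta> Y \<cdot>\<^bsub>A\<^esub> ar_map F' v"
      using v XY by simp
    finally have eq: "\<eta> Y \<cdot>\<^bsub>A\<^esub> ar_map F' (ar_map F ?u) = \<eta> Y \<cdot>\<^bsub>A\<^esub> ar_map F' v" .
    have eq': "ar_map F' (ar_map F ?u) = ar_map F' v"
      by (rule F.A.isos_cancel_left[of "\<eta> Y"]) (use eq v XY u in \<open>auto simp del: F.ar_map_Ident_Comp F'.ar_map_Ident_Comp\<close>)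
    have "ar_map F ?u = v"
      by (rule faithful') (use eq' u v in \<open>auto simp del: F.ar_map_Ident_Comp F'.ar_map_Ident_Comp\<close>)
    then show "\<exists>u \<in> Hom A X Y. ar_map F u = v"
      using u by (intro bexI[of _ ?u]) (auto simp: Hom_iff)
  qed auto
  show "essentially_surjective A B F"
    unfolding essentially_surjective_def
  proof
    fix Z assume "Z \<in> Ob B"
    then show "\<exists>X \<in> Ob A. \<exists>f \<in> isos B. Dom B f = ob_map F X \<and> Cod B f = Z"
      by (intro bexI[of _ "ob_map F' Z"] bexI[of _ "\<eta>' Z"]) auto
  qed
qed

text \<open>The quasi-inverse consists of choices: \<open>r\<close> and \<open>e\<close> from
  essential surjectivity, then \<open>m v\<close> as the arrow lying over the conjugate of v by
  \<open>e\<close>. Preimages under a faithful functor are unique, so each functor law follows from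
  the same law after applying F.\<close>

lemma linear_equivalenceI:
  assumes F: "linear_functor A B F" and ff: "fully_faithful A B F"
    and es: "essentially_surjective A B F"
  shows "linear_equivalence A B F"
proof -
  interpret F: linear_functor A B F by fact
  have "\<exists>r e. \<forall>Z \<in> Ob B. r Z \<in> Ob A \<and> e Z \<in> isos B \<and> Dom B (e Z) = ob_map F (r Z) \<and> Cod B (e Z) = Z"
    using es unfolding essentially_surjective_def by metis
  then obtain r e where re [simp]: "\<And>Z. Z \<in> Ob B \<Longrightarrow> r Z \<in> Ob A" "\<And>Z. Z \<in> Ob B \<Longrightarrow> e Z \<in> isos B"
      "\<And>Z. Z \<in> Ob B \<Longrightarrow> Dom B (e Z) = ob_map F (r Z)" "\<And>Z. Z \<in> Ob B \<Longrightarrow> Cod B (e Z) = Z"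
    by metis
  define conj_e where "conj_e v = inverse_arrow B (e (Cod B v)) \<cdot>\<^bsub>B\<^esub> (v \<cdot>\<^bsub>B\<^esub> e (Dom B v))" for v
  have conj_e [simp]: "conj_e v \<in> Ar B" "Dom B (conj_e v) = ob_map F (r (Dom B v))"
      "Cod B (conj_e v) = ob_map F (r (Cod B v))" if "v \<in> Ar B" for v
    using that by (auto simp: conj_e_def)
  have "\<exists>m. \<forall>v \<in> Ar B. m v \<in> Ar A \<and> Dom A (m v) = r (Dom B v) \<and> Cod A (m v) = r (Cod B v) \<and>
      ar_map F (m v) = conj_e v"
  proof (rule bchoice, rule ballI)
    fix v assume "v \<in> Ar B"
    then show "\<exists>w. w \<in> Ar A \<and> Dom A w = r (Dom B v) \<and> Cod A w = r (Cod B v) \<and> ar_map F w = conj_e v"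
      using fully_faithful_full[OF ff, of "r (Dom B v)" "r (Cod B v)" "conj_e v"] by auto
  qed
  then obtain m where m [simp]: "\<And>v. v \<in> Ar B \<Longrightarrow> m v \<in> Ar A"
      "\<And>v. v \<in> Ar B \<Longrightarrow> Dom A (m v) = r (Dom B v)" "\<And>v. v \<in> Ar B \<Longrightarrow> Cod A (m v) = r (Cod B v)"
      "\<And>v. v \<in> Ar B \<Longrightarrow> ar_map F (m v) = conj_e v"
    by metis
  \<comment> \<open>Preimages of the arrows \<open>e (ob_map F X)\<close> form the remaining natural
    isomorphism; F reflects their invertibility.\<close>
  have "\<exists>n. \<forall>X \<in> Ob A. n X \<in> Ar A \<and> Dom A (n X) = r (ob_map F X) \<and> Cod A (n X) = X \<and>
      ar_map F (n X) = e (ob_map F X)"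
  proof (rule bchoice, rule ballI)
    fix X assume "X \<in> Ob A"
    then show "\<exists>w. w \<in> Ar A \<and> Dom A w = r (ob_map F X) \<and> Cod A w = X \<and> ar_map F w = e (ob_map F X)"
      using fully_faithful_full[OF ff, of "r (ob_map F X)" X "e (ob_map F X)"] by auto
  qed
  then obtain n where n [simp]: "\<And>X. X \<in> Ob A \<Longrightarrow> n X \<in> Ar A"
      "\<And>X. X \<in> Ob A \<Longrightarrow> Dom A (n X) = r (ob_map F X)" "\<And>X. X \<in> Ob A \<Longrightarrow> Cod A (n X) = X"
      "\<And>X. X \<in> Ob A \<Longrightarrow> ar_map F (n X) = e (ob_map F X)"
    by metis
  have n_isos [simp]: "n X \<in> isos A" if "X \<in> Ob A" for X
    using that by (intro fully_faithful_reflects_isos[OF ff F]) auto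
  note eqI = fully_faithful_faithful[OF ff F]
  define F' where "F' = \<lparr>ob_map = r, ar_map = m\<rparr>"
  have F'_simps [simp]: "ob_map F' = r" "ar_map F' = m" by (auto simp: F'_def)
  have F': "linear_functor B A F'"
  proof
    fix f X Y assume "f \<in> Hom B X Y"
    then show "ar_map F' f \<in> Hom A (ob_map F' X) (ob_map F' Y)" by (auto simp: Hom_iff)
  next
    fix X assume X: "X \<in> Ob B"
    show "ar_map F' (Ident B X) = Ident A (ob_map F' X)"
      by (rule eqI) (use X in \<open>auto simp: conj_e_def\<close>)
  next
    fix f g X Y Z assume fg: "f \<in> Hom B X Y" "g \<in> Hom B Y Z"
    show "ar_map F' (g \<cdot>\<^bsub>B\<^esub> f) = ar_map F' g \<cdot>\<^bsub>A\<^esub> ar_map F' f"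
      by (rule eqI) (use fg in \<open>auto simp: conj_e_def Hom_iff\<close>)
  next
    fix f g X Y assume fg: "f \<in> Hom B X Y" "g \<in> Hom B X Y"
    then have "conj_e (hsum B f g) = hsum B (conj_e f) (conj_e g)"
      by (auto simp: conj_e_def Hom_iff)
    note eq = this
    have eq': "ar_map F (hsum A (m f) (m g)) = hsum B (conj_e f) (conj_e g)"
      using fg by (subst F.ar_map_hsum[of _ "r X" "r Y"]) (auto simp: Hom_iff)
    show "ar_map F' (hsum B f g) = hsum A (ar_map F' f) (ar_map F' g)"
      by (rule eqI) (use eq eq' fg in \<open>auto simp: Hom_iff\<close>)
  next
    fix f X Y a assume f: "f \<in> Hom B X Y"
    show "ar_map F' (hscale B a f) = hscale A a (ar_map F' f)"
      by (rule eqI) (use f in \<open>auto simp: conj_e_def Hom_iff\<close>)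
  qed auto
  have "natural_isomorphism B B (comp_functr F F') id_functr e"
    using linear_functor_comp[OF F' F] linear_functor_id[OF F.B.linear_category_axioms]
    by (intro natural_isomorphism.intro natural_isomorphism_axioms.intro)
      (auto simp: is_iso_iff Hom_iff conj_e_def)
  moreover have "natural_isomorphism A A (comp_functr F' F) id_functr n"
    using linear_functor_comp[OF F F'] linear_functor_id[OF F.A.linear_category_axioms]
    by (intro natural_isomorphism.intro natural_isomorphism_axioms.intro)
      (auto simp: is_iso_iff Hom_iff conj_e_def intro!: eqI)
  ultimately show ?thesis
    unfolding linear_equivalence_def using F F' by blast
qed

text \<open>Full faithfulness and essential surjectivity compose directly, which avoids whiskering
  two pairs of natural isomorphisms.\<close>

lemma linear_equivalence_comp:
  assumes "linear_equivalence A B F" "linear_equivalence B C F'"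
  shows "linear_equivalence A C (comp_functr F' F)"
proof -
  have lin: "linear_functor A B F" "linear_functor B C F'"
    using assms by (auto simp: linear_equivalence_def)
  interpret F: linear_functor A B F by fact
  interpret F': linear_functor B C F' by fact
  note ff = linear_equivalence_imp[OF assms(1)] linear_equivalence_imp[OF assms(2)]
  show ?thesis
  proof (rule linear_equivalenceI)
    show "linear_functor A C (comp_functr F' F)" by (rule linear_functor_comp) fact+
    show "fully_faithful A C (comp_functr F' F)"
      unfolding fully_faithful_def
    proof (intro ballI)
      fix X Y assume "X \<in> Ob A" "Y \<in> Ob A"
      then have "bij_betw (ar_map F' \<circ> ar_map F) (Hom A X Y)
          (Hom C (ob_map F' (ob_map F X)) (ob_map F' (ob_map F Y)))"
        using ff unfolding fully_faithful_def
        by (intro bij_betw_trans[of _ _ "Hom B (ob_map F X) (ob_map F Y)"]) auto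
      then show "bij_betw (ar_map (comp_functr F' F)) (Hom A X Y)
          (Hom C (ob_map (comp_functr F' F) X) (ob_map (comp_functr F' F) Y))"
        by (simp add: comp_functr_def)
    qed
    show "essentially_surjective A C (comp_functr F' F)"
      unfolding essentially_surjective_def
    proof
      fix Z assume "Z \<in> Ob C"
      then obtain Y f where Y: "Y \<in> Ob B" "f \<in> isos C" "Dom C f = ob_map F' Y" "Cod C f = Z"
        using ff(4) unfolding essentially_surjective_def by blast
      obtain X g where X: "X \<in> Ob A" "g \<in> isos B" "Dom B g = ob_map F X" "Cod B g = Y"
        using ff(2) Y(1) unfolding essentially_surjective_def by blast
      show "\<exists>X \<in> Ob A. \<exists>f \<in> isos C. Dom C f = ob_map (comp_functr F' F) X \<and> Cod C f = Z"
        using X Y by (intro bexI[of _ X] bexI[of _ "f \<cdot>\<^bsub>C\<^esub> ar_map F' g"]) auto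
    qed
  qed
qed

lemma linear_equivalence_sym:
  assumes "linear_equivalence A B F"
  shows "B \<cong>\<^sub>l\<^sub>i\<^sub>n A"
  using assms unfolding linear_equivalence_def equivalent_categories_def by blast


section \<open>Characters of finite abelian groups\<close>

text \<open>Values outside \<open>H\<close> stay arbitrary, so characters on growing subgroups share
  one type; the restriction to extensional functions is made only once the domain is all of
  G.\<close>

definition subgroup_character :: "('g, 'b) monoid_scheme \<Rightarrow> 'g set \<Rightarrow> ('g \<Rightarrow> 'k::field) \<Rightarrow> bool" where
  "subgroup_character G H \<chi> \<longleftrightarrow> subgroup H G \<and> (\<forall>h \<in> H. \<chi> h \<noteq> 0) \<and>
     (\<forall>h \<in> H. \<forall>k \<in> H. \<chi> (h \<otimes>\<^bsub>G\<^esub> k) = \<chi> h * \<chi> k)"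

context comm_group
begin

text \<open>Here \<open>n\<close> is the order of x modulo H, so every element of the subgroup
  generated by H and x is uniquely h x^k with k < n. Sending it to \<chi>(h) z^k respects the carry
  of x^n into H precisely because z^n = \<chi>(x^n). The value z at x is prescribed in advance so
  that a separating character can be requested.\<close>

lemma extend_character_by_element:
  fixes \<chi> :: "'a \<Rightarrow> 'k::field" and z :: 'k
  assumes \<chi>: "subgroup_character G H \<chi>" and x: "x \<in> carrier G"
    and n: "n > 0" "x [^] n \<in> H" and min: "\<And>m. 0 < m \<Longrightarrow> m < n \<Longrightarrow> x [^] m \<notin> H"
    and z: "z ^ n = \<chi> (x [^] n)"
  shows "\<exists>K \<chi>'. subgroup_character G K \<chi>' \<and> H \<subseteq> K \<and> x \<in> K \<and>
    (\<forall>h \<in> H. \<chi>' h = \<chi> h) \<and> \<chi>' x = z"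
proof -
  interpret H: subgroup H G using \<chi> by (simp add: subgroup_character_def)
  have \<chi>_simps [simp]: "\<chi> (h \<otimes> k) = \<chi> h * \<chi> k" "\<chi> h \<noteq> 0" if "h \<in> H" "k \<in> H" for h k
    using \<chi> that by (auto simp: subgroup_character_def)
  have z0: "z \<noteq> 0" using z n \<chi>_simps(2)[OF n(2) n(2)] by (auto simp: power_0_left)
  define e where "e = (\<lambda>(h, k). h \<otimes> x [^] (k::nat))"
  define K where "K = e ` (H \<times> {..<n})"
  \<comment> \<open>The equation puts x^(k-k') into H, and minimality of n forces k = k'. The case k
    < k' is reduced to this one by symmetry.\<close>
  have e_inj: "h = h' \<and> k = k'"
    if "h \<in> H" "h' \<in> H" "k < n" "h \<otimes> x [^] k = h' \<otimes> x [^] k'" "k' \<le> k" for h h' k k'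
  proof -
    have "h \<otimes> x [^] (k - k') \<otimes> x [^] k' = h' \<otimes> x [^] k'"
      using that x by (simp add: m_assoc nat_pow_mult)
    then have eq: "h \<otimes> x [^] (k - k') = h'"
      using that x by (meson H.mem_carrier m_closed nat_pow_closed right_cancel)
    then have "x [^] (k - k') = inv h \<otimes> h'"
      using that x by (metis H.mem_carrier inv_solve_left nat_pow_closed)
    then have "x [^] (k - k') \<in> H"
      using that by auto
    then have "k - k' = 0"
      using min[of "k - k'"] that by (cases "k - k' = 0") auto
    then show ?thesis using eq that by auto
  qed
  have inj: "inj_on e (H \<times> {..<n})"
    unfolding inj_on_def
  proof (intro ballI impI)
    fix u v assume *: "u \<in> H \<times> {..<n}" "v \<in> H \<times> {..<n}" "e u = e v"
    show "u = v"
      using e_inj[of "fst u" "fst v" "snd u" "snd v"] e_inj[of "fst v" "fst u" "snd v" "snd u"] *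
      by (cases "snd v \<le> snd u") (auto simp: e_def)
  qed
  define \<chi>' where "\<chi>' = (\<lambda>y. case inv_into (H \<times> {..<n}) e y of (h, k) \<Rightarrow> \<chi> h * z ^ k)"
  have \<chi>'_e: "\<chi>' (h \<otimes> x [^] k) = \<chi> h * z ^ k" if "h \<in> H" "k < n" for h k
    using inv_into_f_f[OF inj, of "(h, k)"] that by (simp add: \<chi>'_def e_def)
  have KI: "h \<otimes> x [^] k \<in> K" if "h \<in> H" "k < n" for h k
    using that unfolding K_def e_def by force
  have KE: "\<exists>h k. y = h \<otimes> x [^] k \<and> h \<in> H \<and> k < n" if "y \<in> K" for y
    using that unfolding K_def e_def by auto
  \<comment> \<open>Exponents add with carry: an overflow beyond n is absorbed into the factor from
    H.\<close>
  have mult: "h \<otimes> x [^] k \<otimes> (h' \<otimes> x [^] k') =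
      (if k + k' < n then h \<otimes> h' \<otimes> x [^] (k + k')
       else h \<otimes> h' \<otimes> x [^] n \<otimes> x [^] (k + k' - n))"
    if "h \<in> H" "h' \<in> H" for h h' k k'
  proof -
    have "h \<otimes> x [^] k \<otimes> (h' \<otimes> x [^] k') = h \<otimes> h' \<otimes> x [^] (k + k')"
      using that x by (simp add: nat_pow_mult[symmetric] m_ac)
    moreover have "x [^] (k + k') = x [^] n \<otimes> x [^] (k + k' - n)" if "\<not> k + k' < n"
      using that x by (simp add: nat_pow_mult)
    ultimately show ?thesis using that x n by (simp add: m_assoc)
  qed
  have K_mult: "y \<otimes> y' \<in> K \<and> \<chi>' (y \<otimes> y') = \<chi>' y * \<chi>' y'" if yK: "y \<in> K" "y' \<in> K" for y y'
  proof -
    obtain h k where y: "y = h \<otimes> x [^] k" "h \<in> H" "k < n" using KE[OF yK(1)] by blast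
    obtain h' k' where y': "y' = h' \<otimes> x [^] k'" "h' \<in> H" "k' < n" using KE[OF yK(2)] by blast
    show ?thesis
    proof (cases "k + k' < n")
      case True
      then show ?thesis
        using mult[OF y(2) y'(2), of k k'] y y' KI[of "h \<otimes> h'" "k + k'"]
        by (simp add: \<chi>'_e power_add)
    next
      case False
      then have "z ^ k * z ^ k' = z ^ n * z ^ (k + k' - n)"
        by (simp add: power_add[symmetric])
      moreover have "k + k' - n < n" using y y' False by simp
      ultimately show ?thesis
        using mult[OF y(2) y'(2), of k k'] y y' KI[of "h \<otimes> h' \<otimes> x [^] n" "k + k' - n"] False z n
        by (simp add: \<chi>'_e ac_simps)
    qed
  qed
  have H_K: "h \<in> K \<and> \<chi>' h = \<chi> h" if "h \<in> H" for h
    using KI[of h 0] \<chi>'_e[of h 0] that n by simp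
  \<comment> \<open>For n = 1 the exponent 1 is out of range, but then x itself lies in H and z =
    \<chi>(x).\<close>
  have xK: "x \<in> K \<and> \<chi>' x = z"
  proof (cases "n = 1")
    case True
    then show ?thesis using H_K[of x] n z x by simp
  next
    case False
    have "\<chi> \<one> = \<chi> \<one> * \<chi> \<one>" using \<chi>_simps(1)[of \<one> \<one>] by simp
    then have "\<chi> \<one> = 1" using \<chi>_simps(2)[of \<one> \<one>] by simp
    then show ?thesis using KI[of \<one> 1] \<chi>'_e[of \<one> 1] False n x by simp
  qed
  have shuffle: "a \<otimes> b \<otimes> c \<otimes> (d \<otimes> e) = (a \<otimes> d) \<otimes> (b \<otimes> (c \<otimes> e))"
    if "a \<in> carrier G" "b \<in> carrier G" "c \<in> carrier G" "d \<in> carrier G" "e \<in> carrier G"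
    for a b c d e
    using that by (simp add: m_ac)
  have "subgroup K G"
  proof (rule subgroupI)
    show "K \<subseteq> carrier G" using x KE by fastforce
    show "K \<noteq> {}" using H_K[of \<one>] by auto
    show "y \<otimes> y' \<in> K" if "y \<in> K" "y' \<in> K" for y y' using K_mult that by blast
    fix y assume "y \<in> K"
    then obtain h k where y: "y = h \<otimes> x [^] k" "h \<in> H" "k < n" using KE by blast
    show "inv y \<in> K"
    proof (cases "k = 0")
      case True
      then show ?thesis using y H_K[of "inv h"] by simp
    next
      case False
      \<comment> \<open>As k is positive, n - k is again below n, so this expression for the inverse
        is in normal form.\<close>
      have "(inv h \<otimes> inv (x [^] n) \<otimes> x [^] (n - k)) \<otimes> (h \<otimes> x [^] k)
          = (inv h \<otimes> h) \<otimes> (inv (x [^] n) \<otimes> (x [^] (n - k) \<otimes> x [^] k))"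
        using shuffle[of "inv h" "inv (x [^] n)" "x [^] (n - k)" h "x [^] k"] y x by simp
      also have "\<dots> = \<one>" using y x by (simp add: nat_pow_mult)
      finally have "inv y = inv h \<otimes> inv (x [^] n) \<otimes> x [^] (n - k)"
        using y x n by (intro inv_equality) auto
      then show ?thesis
        using KI[of "inv h \<otimes> inv (x [^] n)" "n - k"] False y n by simp
    qed
  qed
  moreover have "\<chi>' y \<noteq> 0" if "y \<in> K" for y
    using KE[OF that] \<chi>'_e z0 by auto
  ultimately show ?thesis
    using K_mult H_K xK unfolding subgroup_character_def by (intro exI[of _ K] exI[of _ \<chi>']) auto
qed

text \<open>Adjoining one element strictly enlarges H, so the induction reaches G by finiteness.
  Algebraic closedness supplies the n-th root of \<chi>(x^n) that each step requires.\<close>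

lemma extend_character:
  fixes \<chi> :: "'a \<Rightarrow> 'k::alg_closed_field"
  assumes "finite (carrier G)" "subgroup_character G H \<chi>"
  shows "\<exists>\<chi>'. subgroup_character G (carrier G) \<chi>' \<and> (\<forall>h \<in> H. \<chi>' h = \<chi> h)"
  using assms(2)
proof (induction "card (carrier G) - card H" arbitrary: H \<chi> rule: less_induct)
  case less
  interpret H: subgroup H G using less.prems by (simp add: subgroup_character_def)
  show ?case
  proof (cases "H = carrier G")
    case True
    then show ?thesis using less.prems by blast
  next
    case False
    then obtain x where x: "x \<in> carrier G" "x \<notin> H" using H.subset by blast
    define n :: nat where "n = (LEAST n. n > 0 \<and> x [^] n \<in> H)"
    have "Coset.order G > 0 \<and> x [^] Coset.order G \<in> H"
      using pow_order_eq_1[OF x(1)] assms(1) by (simp_all add: order_gt_0_iff_finite)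
    then have n: "n > 0 \<and> x [^] n \<in> H" unfolding n_def
      using LeastI[of "\<lambda>m. m > 0 \<and> x [^] m \<in> H" "Coset.order G"] by blast
    have min: "x [^] m \<notin> H" if "0 < m" "m < n" for m
      using not_less_Least[of m] that unfolding n_def by blast
    obtain z where z: "z ^ n = \<chi> (x [^] n)"
      using nth_root_exists[of n "\<chi> (x [^] n)"] n by blast
    obtain K \<chi>' where K: "subgroup_character G K \<chi>'" "H \<subseteq> K" "x \<in> K"
        "\<And>h. h \<in> H \<Longrightarrow> \<chi>' h = \<chi> h" "\<chi>' x = z"
      using extend_character_by_element[OF less.prems x(1) conjunct1[OF n] conjunct2[OF n] min z]
      by blast
    have "K \<subseteq> carrier G" using K(1) subgroup.subset by (auto simp: subgroup_character_def)
    then have "card H < card K" "card K \<le> card (carrier G)"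
      using K x assms(1) by (auto intro!: psubset_card_mono card_mono intro: finite_subset)
    then have "card (carrier G) - card K < card (carrier G) - card H" by simp
    from less.hyps[OF this K(1)] obtain \<psi> where
        "subgroup_character G (carrier G) \<psi>" "\<forall>h \<in> K. \<psi> h = \<chi>' h" by blast
    then show ?thesis using K(2,4) by (intro exI[of _ \<psi>]) auto
  qed
qed

end

section \<open>The dual group: finiteness, separation of points and orthogonality\<close>

lemma dual_group_simps:
  "\<chi> \<in> carrier (dual_group G) \<longleftrightarrow> \<chi> \<in> extensional (carrier G) \<and> (\<forall>g \<in> carrier G. \<chi> g \<noteq> 0) \<and>
     (\<forall>g \<in> carrier G. \<forall>h \<in> carrier G. \<chi> (g \<otimes>\<^bsub>G\<^esub> h) = \<chi> g * \<chi> h)"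
  "g \<in> carrier G \<Longrightarrow> (\<chi> \<otimes>\<^bsub>dual_group G\<^esub> \<psi>) g = \<chi> g * \<psi> g"
  "g \<in> carrier G \<Longrightarrow> \<one>\<^bsub>dual_group G\<^esub> g = 1"
  by (auto simp: dual_group_def hom_def units_group_def)

lemma comm_group_dual_group:
  assumes "group G"
  shows "comm_group (dual_group G :: ('g \<Rightarrow> 'k::field) monoid)"
proof -
  interpret group G by fact
  show ?thesis
  proof (rule comm_groupI)
    fix \<chi> :: "'g \<Rightarrow> 'k" assume \<chi>: "\<chi> \<in> carrier (dual_group G)"
    show "\<exists>\<psi> \<in> carrier (dual_group G). \<psi> \<otimes>\<^bsub>dual_group G\<^esub> \<chi> = \<one>\<^bsub>dual_group G\<^esub>"
      using \<chi> by (intro bexI[of _ "\<lambda>g \<in> carrier G. inverse (\<chi> g)"])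
        (auto simp: dual_group_def hom_def units_group_def Pi_iff intro!: restrict_ext)
  qed (auto simp: dual_group_def hom_def units_group_def Pi_iff mult.assoc mult.commute
      intro!: restrict_ext extensionalityI)
qed

text \<open>The field enters through its type alone; the \<open>itself\<close> parameter fixes that
  type, so that \<open>Gd\<close> denotes one group throughout.\<close>

locale dualizable_group = comm_group G for G :: "'g monoid" (structure) +
  fixes field_type :: "'k::alg_closed_field itself"
  assumes finite_carrier [simp]: "finite (carrier G)"
    and char_not_dvd: "\<not> CHAR('k) dvd card (carrier G)"
begin

abbreviation Gd :: "('g \<Rightarrow> 'k) monoid" where "Gd \<equiv> dual_group G"

sublocale Gd: comm_group Gd
  by (rule comm_group_dual_group) (rule is_group)

lemma character_nonzero [simp]: "\<chi> \<in> carrier Gd \<Longrightarrow> g \<in> carrier G \<Longrightarrow> \<chi> g \<noteq> 0"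
  by (simp add: dual_group_simps)

lemma character_mult [simp]:
  "\<chi> \<in> carrier Gd \<Longrightarrow> g \<in> carrier G \<Longrightarrow> h \<in> carrier G \<Longrightarrow> \<chi> (g \<otimes> h) = \<chi> g * \<chi> h"
  by (simp add: dual_group_simps)

lemma character_one [simp]: "\<chi> \<in> carrier Gd \<Longrightarrow> \<chi> \<one> = 1"
  using character_mult[of \<chi> \<one> \<one>] character_nonzero[of \<chi> \<one>] by simp

lemma character_inv:
  assumes "\<chi> \<in> carrier Gd" "g \<in> carrier G"
  shows "\<chi> (inv g) = inverse (\<chi> g)"
  using character_mult[of \<chi> g "inv g"] assms by (intro inverse_unique[symmetric]) simp

lemma dual_mult_apply [simp]:
  "g \<in> carrier G \<Longrightarrow> (\<chi> \<otimes>\<^bsub>Gd\<^esub> \<psi>) g = \<chi> g * \<psi> g" "g \<in> carrier G \<Longrightarrow> \<one>\<^bsub>Gd\<^esub> g = 1"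
  by (simp_all add: dual_group_simps)

lemma dual_inv_apply: "\<chi> \<in> carrier Gd \<Longrightarrow> g \<in> carrier G \<Longrightarrow> (inv\<^bsub>Gd\<^esub> \<chi>) g = inverse (\<chi> g)"
  using dual_mult_apply(1)[of g \<chi> "inv\<^bsub>Gd\<^esub> \<chi>"] Gd.r_inv[of \<chi>] by (simp add: field_simps)

lemma character_eqI:
  "\<chi> \<in> carrier Gd \<Longrightarrow> \<psi> \<in> carrier Gd \<Longrightarrow> (\<And>g. g \<in> carrier G \<Longrightarrow> \<chi> g = \<psi> g) \<Longrightarrow> \<chi> = \<psi>"
  unfolding dual_group_simps(1) by (rule extensionalityI[of _ "carrier G"]) blast+

lemma card_nonzero [simp]: "(of_nat (card (carrier G)) :: 'k) \<noteq> 0"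
  using char_not_dvd by (simp add: of_nat_eq_0_iff_char_dvd)

text \<open>All values are roots of X^|G| - 1, which are finitely many, and extensional functions
  from a finite set to a finite set are finitely many.\<close>

lemma finite_dual [simp]: "finite (carrier Gd)"
proof (rule finite_subset)
  let ?R = "{z :: 'k. z ^ Coset.order G = 1}"
  have pos: "Coset.order G > 0" by (simp add: order_gt_0_iff_finite)
  show "carrier Gd \<subseteq> (\<Pi>\<^sub>E g \<in> carrier G. ?R)"
  proof
    fix \<chi> assume \<chi>: "\<chi> \<in> carrier Gd"
    have "\<chi> (g [^] n) = \<chi> g ^ n" if "g \<in> carrier G" for g and n :: nat
      using \<chi> that by (induction n) (auto simp: mult.commute)
    then have "\<chi> g ^ Coset.order G = 1" if "g \<in> carrier G" for g
      using pow_order_eq_1[OF that] \<chi> that by (metis character_one)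
    then show "\<chi> \<in> (\<Pi>\<^sub>E g \<in> carrier G. ?R)" using \<chi> by (auto simp: dual_group_simps PiE_def)
  qed
  have "finite {z. poly (Polynomial.monom 1 (Coset.order G) - 1 :: 'k poly) z = 0}"
  proof (rule poly_roots_finite)
    have "Polynomial.coeff (Polynomial.monom 1 (Coset.order G) - 1 :: 'k poly) (Coset.order G) = 1"
      using pos by simp
    then show "Polynomial.monom 1 (Coset.order G) - 1 \<noteq> (0 :: 'k poly)" by (metis coeff_0 zero_neq_one)
  qed
  then have "finite ?R" by (simp add: poly_monom)
  then show "finite (\<Pi>\<^sub>E g \<in> carrier G. ?R)" by (intro finite_PiE) auto
qed

text \<open>A character of the cyclic subgroup generated by g is obtained by sending g to a
  nontrivial root of unity whose exponent is the order of g; it is then extended to G.\<close>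

lemma character_separates:
  assumes g: "g \<in> carrier G" "g \<noteq> \<one>"
  obtains \<chi> where "\<chi> \<in> carrier Gd" "\<chi> g \<noteq> 1"
proof -
  define n where "n = ord g"
  have "n \<noteq> 1" using g ord_eq_1[of g] by (simp add: n_def)
  moreover have "n > 0" unfolding n_def using g ord_ge_1[of g] by simp
  ultimately have n: "n > 1" by simp
  \<comment> \<open>A root of 1 + X + ... + X^(n-1), of positive degree because n > 1, satisfies z^n
    = 1. It is not 1: otherwise n = 0 in the field, although n divides |G|.\<close>
  have "\<exists>z :: 'k. (\<Sum>k\<le>n - 1. 1 * z ^ k) = 0"
    by (rule alg_closed) (use n in auto)
  then obtain z :: 'k where "(\<Sum>k\<le>n - 1. z ^ k) = 0" by auto
  moreover have "{..n - 1} = {..<n}" using n by auto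
  ultimately have z: "(\<Sum>k<n. z ^ k) = 0" by simp
  have "z ^ n - 1 = (z - 1) * (\<Sum>k<n. z ^ k)" by (rule power_diff_1_eq)
  then have zn: "z ^ n = 1" using z by simp
  have "z \<noteq> 1"
  proof
    assume "z = 1"
    then have "CHAR('k) dvd n" using z by (simp add: of_nat_eq_0_iff_char_dvd)
    then show False
      using ord_dvd_group_order[OF g(1)] char_not_dvd by (auto simp: n_def Coset.order_def)
  qed
  have triv: "subgroup_character G {\<one>} (\<lambda>_. 1 :: 'k)"
    by (simp add: subgroup_character_def triv_subgroup)
  have min: "g [^] m \<notin> {\<one>}" if "0 < m" "m < n" for m
    using that g pow_eq_id[of g m] by (auto simp: n_def dest: dvd_imp_le)
  have "0 < n" "g [^] n \<in> {\<one>}" using n g by (auto simp: n_def)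
  from extend_character_by_element[OF triv g(1) this min zn]
  obtain K \<chi> where K: "subgroup_character G K \<chi>" "g \<in> K" "\<chi> g = z" by blast
  obtain \<chi>' where \<chi>': "subgroup_character G (carrier G) \<chi>'" "\<And>h. h \<in> K \<Longrightarrow> \<chi>' h = \<chi> h"
    using extend_character[OF finite_carrier K(1)] by blast
  let ?\<chi> = "restrict \<chi>' (carrier G)"
  have "?\<chi> \<in> carrier Gd" using \<chi>'(1) unfolding dual_group_simps(1) subgroup_character_def by auto
  moreover have "?\<chi> g \<noteq> 1" using \<chi>'(2)[OF K(2)] K(3) g(1) \<open>z \<noteq> 1\<close> by simp
  ultimately show ?thesis using that by blast
qed

text \<open>Translation by an h with \<chi>(h) other than 1 permutes the summands and multiplies the
  sum by \<chi>(h).\<close>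

lemma sum_character:
  assumes \<chi>: "\<chi> \<in> carrier Gd" "\<chi> \<noteq> \<one>\<^bsub>Gd\<^esub>"
  shows "(\<Sum>g \<in> carrier G. \<chi> g) = 0"
proof -
  obtain h where h: "h \<in> carrier G" "\<chi> h \<noteq> 1"
    using \<chi> character_eqI[OF \<chi>(1) Gd.one_closed] by auto
  have "(\<Sum>g \<in> carrier G. \<chi> g) = (\<Sum>g \<in> carrier G. \<chi> (h \<otimes> g))"
    using h by (intro sum.reindex_bij_betw[symmetric] bij_betwI[of _ _ _ "\<lambda>g. inv h \<otimes> g"])
      (auto simp: m_assoc[symmetric])
  also have "\<dots> = \<chi> h * (\<Sum>g \<in> carrier G. \<chi> g)"
    using \<chi> h by (simp add: sum_distrib_left)
  finally show ?thesis using h by simp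
qed

text \<open>The mirror image of \<open>sum_character\<close>: multiplication by a character that is
  nontrivial on g permutes the characters.\<close>

lemma sum_characters_apply:
  assumes g: "g \<in> carrier G" "g \<noteq> \<one>"
  shows "(\<Sum>\<chi> \<in> carrier Gd. \<chi> g) = 0"
proof -
  obtain \<psi> where \<psi>: "\<psi> \<in> carrier Gd" "\<psi> g \<noteq> 1" using character_separates[OF g] .
  have "(\<Sum>\<chi> \<in> carrier Gd. \<chi> g) = (\<Sum>\<chi> \<in> carrier Gd. (\<psi> \<otimes>\<^bsub>Gd\<^esub> \<chi>) g)"
    using \<psi> by (intro sum.reindex_bij_betw[symmetric]
        bij_betwI[of _ _ _ "\<lambda>\<chi>. inv\<^bsub>Gd\<^esub> \<psi> \<otimes>\<^bsub>Gd\<^esub> \<chi>"]) (auto simp: Gd.m_assoc[symmetric])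
  also have "\<dots> = \<psi> g * (\<Sum>\<chi> \<in> carrier Gd. \<chi> g)"
    using g by (simp add: sum_distrib_left)
  finally show ?thesis using \<psi> by simp
qed

text \<open>The double sum of all \<chi>(g) is evaluated in two ways: summing over \<chi> first
  leaves only g = 1, summing over g first leaves only the trivial character. Averages over the dual
  group can thus be normalised by |G|.\<close>

lemma card_dual: "(of_nat (card (carrier Gd)) :: 'k) = of_nat (card (carrier G))"
proof -
  have "(of_nat (card (carrier Gd)) :: 'k) = (\<Sum>\<chi> \<in> carrier Gd. \<chi> \<one>)" by simp
  also have "\<dots> = (\<Sum>g \<in> carrier G. \<Sum>\<chi> \<in> carrier Gd. \<chi> g)"
    using sum_characters_apply by (subst sum.remove[of "carrier G" \<one>]) auto
  also have "\<dots> = (\<Sum>\<chi> \<in> carrier Gd. \<Sum>g \<in> carrier G. \<chi> g)" by (rule sum.swap)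
  also have "\<dots> = (\<Sum>g \<in> carrier G. \<one>\<^bsub>Gd\<^esub> g)"
    using sum_character by (subst sum.remove[of "carrier Gd" "\<one>\<^bsub>Gd\<^esub>"]) auto
  finally show ?thesis by simp
qed

end


section \<open>Equivariant categories\<close>

abbreviation arr :: "'a \<times> 'b \<times> 'm \<Rightarrow> 'm" where "arr u \<equiv> snd (snd u)"

context categorical_action
begin

abbreviation D where "D \<equiv> equivariant_category G C \<phi> \<epsilon>"

lemma linear_functor_\<phi>: "g \<in> carrier G \<Longrightarrow> linear_functor C C (\<phi> g)"
  using autoequivalence by (auto simp: linear_equivalence_def)

text \<open>\<open>\<phi> g\<close> is a functor only for g in the carrier, so the functor rules are
  imported with that premise rather than by interpreting the locale.\<close>

lemmas \<phi>_simps [simp] =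
  linear_functor.ob_map_in_Ob[OF linear_functor_\<phi>] linear_functor.ar_map_Ar[OF linear_functor_\<phi>]
  linear_functor.ar_map_Ident_Comp[OF linear_functor_\<phi>] linear_functor.ar_map_hsum_Ar[OF linear_functor_\<phi>]
  linear_functor.ar_map_hzero[OF linear_functor_\<phi>] linear_functor.ar_map_isos[OF linear_functor_\<phi>]
  linear_functor.ar_map_inverse_arrow[OF linear_functor_\<phi>]

lemmas \<phi>_faithful = fully_faithful_faithful[OF linear_equivalence_imp(1)[OF autoequivalence]
    linear_functor_\<phi>]

lemmas \<epsilon>_simps [simp] =
  natural_isomorphism.component[OF comparison_iso, unfolded comp_functr_simps]
  natural_isomorphism.component_Ar[OF comparison_iso, unfolded comp_functr_simps]

lemmas \<epsilon>_natural = natural_isomorphism.naturality_Ar[OF comparison_iso, unfolded comp_functr_simps]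

lemma D_simps:
  "Dom D u = fst u" "Cod D u = fst (snd u)" "Ident D P = (P, P, Ident C (fst P))"
  "hzero D P Q = (P, Q, hzero C (fst P) (fst Q))"
  "v \<cdot>\<^bsub>D\<^esub> u = (fst u, fst (snd v), arr v \<cdot>\<^bsub>C\<^esub> arr u)"
  "hsum D u v = (fst u, fst (snd u), hsum C (arr u) (arr v))"
  "hscale D a u = (fst u, fst (snd u), hscale C a (arr u))"
  by (auto simp: equivariant_category_def split: prod.splits)

lemma Ob_D_iff: "P \<in> Ob D \<longleftrightarrow> fst P \<in> Ob C \<and> snd P \<in> extensional (carrier G) \<and>
    (\<forall>g \<in> carrier G. is_iso C (fst P) (ob_map (\<phi> g) (fst P)) (snd P g)) \<and>
    (\<forall>g \<in> carrier G. \<forall>h \<in> carrier G. snd P (h \<otimes> g)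
      = \<epsilon> g h (fst P) \<cdot>\<^bsub>C\<^esub> ar_map (\<phi> g) (snd P h) \<cdot>\<^bsub>C\<^esub> snd P g)"
  by (cases P) (simp add: equivariant_category_def equivariant_objects_def)

lemma Ob_D [simp]:
  assumes "P \<in> Ob D"
  shows "fst P \<in> Ob C" "g \<in> carrier G \<Longrightarrow> snd P g \<in> isos C"
    "g \<in> carrier G \<Longrightarrow> Dom C (snd P g) = fst P"
    "g \<in> carrier G \<Longrightarrow> Cod C (snd P g) = ob_map (\<phi> g) (fst P)"
  using assms by (auto simp: Ob_D_iff is_iso_iff)

text \<open>The definition brackets to the left; this version has the normal form of
  \<open>Comp_assoc_Ar\<close>.\<close>

lemma Ob_D_cocycle:
  assumes "P \<in> Ob D" "g \<in> carrier G" "h \<in> carrier G"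
  shows "snd P (h \<otimes> g) = \<epsilon> g h (fst P) \<cdot>\<^bsub>C\<^esub> (ar_map (\<phi> g) (snd P h) \<cdot>\<^bsub>C\<^esub> snd P g)"
proof -
  have "\<epsilon> g h (fst P) \<cdot>\<^bsub>C\<^esub> ar_map (\<phi> g) (snd P h) \<cdot>\<^bsub>C\<^esub> snd P g
      = \<epsilon> g h (fst P) \<cdot>\<^bsub>C\<^esub> (ar_map (\<phi> g) (snd P h) \<cdot>\<^bsub>C\<^esub> snd P g)"
    using assms by (intro C.Comp_assoc_Ar) auto
  then show ?thesis using assms unfolding Ob_D_iff by metis
qed

lemma Ob_DI:
  assumes "X \<in> Ob C" "\<theta> \<in> extensional (carrier G)"
    "\<And>g. g \<in> carrier G \<Longrightarrow> \<theta> g \<in> isos C \<and> Dom C (\<theta> g) = X \<and> Cod C (\<theta> g) = ob_map (\<phi> g) X"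
    "\<And>g h. g \<in> carrier G \<Longrightarrow> h \<in> carrier G \<Longrightarrow>
      \<theta> (h \<otimes> g) = \<epsilon> g h X \<cdot>\<^bsub>C\<^esub> (ar_map (\<phi> g) (\<theta> h) \<cdot>\<^bsub>C\<^esub> \<theta> g)"
  shows "(X, \<theta>) \<in> Ob D"
  unfolding Ob_D_iff fst_conv snd_conv
proof (intro conjI ballI)
  fix g h assume gh: "g \<in> carrier G" "h \<in> carrier G"
  have "\<epsilon> g h X \<cdot>\<^bsub>C\<^esub> ar_map (\<phi> g) (\<theta> h) \<cdot>\<^bsub>C\<^esub> \<theta> g = \<epsilon> g h X \<cdot>\<^bsub>C\<^esub> (ar_map (\<phi> g) (\<theta> h) \<cdot>\<^bsub>C\<^esub> \<theta> g)"
    using assms(1) assms(3)[OF gh(1)] assms(3)[OF gh(2)] gh by (intro C.Comp_assoc_Ar) auto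
  then show "\<theta> (h \<otimes> g) = \<epsilon> g h X \<cdot>\<^bsub>C\<^esub> ar_map (\<phi> g) (\<theta> h) \<cdot>\<^bsub>C\<^esub> \<theta> g"
    using assms(4)[OF gh] by (simp only:)
qed (use assms(1-3) in \<open>auto simp: is_iso_iff\<close>)

lemma Ar_D_iff: "u \<in> Ar D \<longleftrightarrow> fst u \<in> Ob D \<and> fst (snd u) \<in> Ob D \<and>
    arr u \<in> Ar C \<and> Dom C (arr u) = fst (fst u) \<and> Cod C (arr u) = fst (fst (snd u)) \<and>
    (\<forall>g \<in> carrier G. snd (fst (snd u)) g \<cdot>\<^bsub>C\<^esub> arr u
      = ar_map (\<phi> g) (arr u) \<cdot>\<^bsub>C\<^esub> snd (fst u) g)"
  by (cases u) (auto simp: equivariant_category_def equivariant_arrows_def Hom_iff)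

lemma Ar_D:
  assumes "u \<in> Ar D"
  shows "fst u \<in> Ob D" "fst (snd u) \<in> Ob D" "arr u \<in> Ar C" "Dom C (arr u) = fst (fst u)"
    "Cod C (arr u) = fst (fst (snd u))"
  using assms unfolding Ar_D_iff by blast+

lemma Ar_D_equivariant:
  assumes "u \<in> Ar D" "g \<in> carrier G"
  shows "snd (fst (snd u)) g \<cdot>\<^bsub>C\<^esub> arr u = ar_map (\<phi> g) (arr u) \<cdot>\<^bsub>C\<^esub> snd (fst u) g"
  using assms unfolding Ar_D_iff by blast

lemma linear_category_D: "linear_category D"
proof -
  note [simp] = D_simps Ar_D
  show ?thesis
  proof (rule linear_category.intro)
    fix u assume "u \<in> Ar D"
    then show "Dom D u \<in> Ob D" "Cod D u \<in> Ob D" by auto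
  next
    fix P assume P: "P \<in> Ob D"
    then show "Ident D P \<in> Hom D P P"
      by (auto simp: Hom_iff Ar_D_iff)
  next
    fix u v P Q R assume "u \<in> Hom D P Q" "v \<in> Hom D Q R"
    then have uv: "u \<in> Ar D" "v \<in> Ar D" "P = fst u" "R = fst (snd v)" "fst (snd u) = fst v"
      by (auto simp: Hom_iff)
    have "snd (fst (snd v)) g \<cdot>\<^bsub>C\<^esub> (arr v \<cdot>\<^bsub>C\<^esub> arr u)
        = ar_map (\<phi> g) (arr v) \<cdot>\<^bsub>C\<^esub> (ar_map (\<phi> g) (arr u) \<cdot>\<^bsub>C\<^esub> snd (fst u) g)"
      if g: "g \<in> carrier G" for g
    proof -
      have "snd (fst (snd v)) g \<cdot>\<^bsub>C\<^esub> (arr v \<cdot>\<^bsub>C\<^esub> arr u)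
          = (snd (fst (snd v)) g \<cdot>\<^bsub>C\<^esub> arr v) \<cdot>\<^bsub>C\<^esub> arr u"
        using uv g by simp
      also have "\<dots> = ar_map (\<phi> g) (arr v) \<cdot>\<^bsub>C\<^esub> (snd (fst v) g \<cdot>\<^bsub>C\<^esub> arr u)"
        using uv g by (simp only: Ar_D_equivariant) simp
      also have "snd (fst v) g \<cdot>\<^bsub>C\<^esub> arr u = ar_map (\<phi> g) (arr u) \<cdot>\<^bsub>C\<^esub> snd (fst u) g"
        using Ar_D_equivariant[OF uv(1) g] uv(5) by simp
      finally show ?thesis .
    qed
    then show "v \<cdot>\<^bsub>D\<^esub> u \<in> Hom D P R"
      using uv by (auto simp: Hom_iff Ar_D_iff[of "(_, _)"])
  next
    fix u a P Q assume "u \<in> Hom D P Q"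
    then show "hscale D a u \<in> Hom D P Q"
      using Ar_D_equivariant[of u] by (auto simp: Hom_iff Ar_D_iff[of "(_, _)"])
  next
    fix P Q assume PQ: "P \<in> Ob D" "Q \<in> Ob D"
    interpret H: comm_group "Hom_group C (fst P) (fst Q)"
      using PQ by (intro C.Hom_comm_group) auto
    have sum: "hsum D u v \<in> Hom D P Q" if "u \<in> Hom D P Q" "v \<in> Hom D P Q" for u v
      using that Ar_D_equivariant[of u] Ar_D_equivariant[of v]
      by (auto simp: Hom_iff Ar_D_iff[of "(_, _)"])
    have arr_Hom: "arr u \<in> carrier (Hom_group C (fst P) (fst Q))" if "u \<in> Hom D P Q" for u
      using that by (auto simp: Hom_iff)
    show "comm_group (Hom_group D P Q)"
    proof (rule comm_groupI, simp_all only: Hom_group_def partial_object.simps monoid.simps)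
      fix u v w assume uvw: "u \<in> Hom D P Q" "v \<in> Hom D P Q" "w \<in> Hom D P Q"
      show "hsum D (hsum D u v) w = hsum D u (hsum D v w)"
        using H.m_assoc[OF uvw[THEN arr_Hom]] by simp
    next
      fix u v assume uv: "u \<in> Hom D P Q" "v \<in> Hom D P Q"
      show "hsum D u v = hsum D v u"
        using H.m_comm[OF uv[THEN arr_Hom]] uv by (auto simp: Hom_iff)
    next
      fix u assume u: "u \<in> Hom D P Q"
      show "hsum D (hzero D P Q) u = u"
        using H.l_one[OF u[THEN arr_Hom]] u by (auto simp: Hom_iff prod_eq_iff)
      \<comment> \<open>The multiple by -1 serves as additive inverse because scalar multiples
        visibly remain equivariant.\<close>
      have "hscale D (-1) u \<in> Hom D P Q"
        using u Ar_D_equivariant[of u] by (auto simp: Hom_iff Ar_D_iff[of "(_, _)"])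
      moreover have "hsum C (hscale C (- 1) (arr u)) (arr u) = hzero C (fst P) (fst Q)"
        using C.hscale_add[of "arr u" "fst P" "fst Q" "-1" 1] u by (auto simp: Hom_iff)
      ultimately show "\<exists>v \<in> Hom D P Q. hsum D v u = hzero D P Q"
        using u by (intro bexI[of _ "hscale D (-1) u"]) (auto simp: Hom_iff)
    next
      show "hzero D P Q \<in> Hom D P Q"
        using PQ by (auto simp: Hom_iff Ar_D_iff[of "(_, _)"])
    qed (use sum in auto)
  next
    fix u a b P Q assume u: "u \<in> Hom D P Q"
    then show "hscale D (a + b) u = hsum D (hscale D a u) (hscale D b u)"
      using C.hscale_add[of "arr u" "fst P" "fst Q" a b] by (auto simp: Hom_iff)
  next
    fix u v a P Q assume u: "u \<in> Hom D P Q" "v \<in> Hom D P Q"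
    then show "hscale D a (hsum D u v) = hsum D (hscale D a u) (hscale D a v)"
      using C.hscale_hsum[of "arr u" "fst P" "fst Q" "arr v" a] by (auto simp: Hom_iff)
  qed (auto simp: Hom_iff prod_eq_iff)
qed

sublocale D: linear_category D
  by (rule linear_category_D)

section \<open>Equivariant arrows through their underlying arrows\<close>

lemma arr_simps [simp]:
  "u \<in> Ar D \<Longrightarrow> arr u \<in> Ar C" "u \<in> Ar D \<Longrightarrow> Dom C (arr u) = fst (Dom D u)"
  "u \<in> Ar D \<Longrightarrow> Cod C (arr u) = fst (Cod D u)" "arr (v \<cdot>\<^bsub>D\<^esub> u) = arr v \<cdot>\<^bsub>C\<^esub> arr u"
  "arr (Ident D P) = Ident C (fst P)"
  "arr (hsum D u v) = hsum C (arr u) (arr v)" "arr (hscale D a u) = hscale C a (arr u)"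
  by (simp_all add: D_simps Ar_D)

lemma arr_equivariant:
  assumes "u \<in> Ar D" "g \<in> carrier G"
  shows "snd (Cod D u) g \<cdot>\<^bsub>C\<^esub> arr u = ar_map (\<phi> g) (arr u) \<cdot>\<^bsub>C\<^esub> snd (Dom D u) g"
  using Ar_D_equivariant[OF assms] by (simp add: D_simps)

lemma arr_eqI:
  assumes "Dom D u = Dom D v" "Cod D u = Cod D v" "arr u = arr v"
  shows "u = v"
  using assms by (auto simp: D_simps prod_eq_iff)

lemma Ar_D_exists:
  assumes "P \<in> Ob D" "Q \<in> Ob D" "f \<in> Ar C" "Dom C f = fst P" "Cod C f = fst Q"
    "\<And>g. g \<in> carrier G \<Longrightarrow> snd Q g \<cdot>\<^bsub>C\<^esub> f = ar_map (\<phi> g) f \<cdot>\<^bsub>C\<^esub> snd P g"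
  shows "(P, Q, f) \<in> Ar D" "Dom D (P, Q, f) = P" "Cod D (P, Q, f) = Q"
  using assms by (auto simp: Ar_D_iff D_simps)

lemma isos_D_imp:
  assumes "u \<in> isos D"
  shows "arr u \<in> isos C" "arr (inverse_arrow D u) = inverse_arrow C (arr u)"
proof -
  have "arr (inverse_arrow D u \<cdot>\<^bsub>D\<^esub> u) = arr (Ident D (Dom D u))"
    "arr (u \<cdot>\<^bsub>D\<^esub> inverse_arrow D u) = arr (Ident D (Cod D u))"
    by (simp_all only: D.inverse_arrow_Ar[OF assms])
  then have *: "arr (inverse_arrow D u) \<cdot>\<^bsub>C\<^esub> arr u = Ident C (fst (Dom D u))"
    "arr u \<cdot>\<^bsub>C\<^esub> arr (inverse_arrow D u) = Ident C (fst (Cod D u))"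
    by simp_all
  then show "arr u \<in> isos C"
    using assms by (intro C.isosI[of _ "arr (inverse_arrow D u)"]) auto
  show "arr (inverse_arrow D u) = inverse_arrow C (arr u)"
    using assms * by (intro C.inverse_arrow_unique[symmetric]) auto
qed

text \<open>Inverting the equivariance square of u yields the square of the inverse, so
  invertibility can be tested on underlying arrows.\<close>

lemma isos_D_I:
  assumes u: "u \<in> Ar D" "arr u \<in> isos C"
  shows "u \<in> isos D"
proof -
  let ?i = "inverse_arrow C (arr u)"
  let ?v = "(Cod D u, Dom D u, ?i)"
  have "snd (Dom D u) g \<cdot>\<^bsub>C\<^esub> ?i = ar_map (\<phi> g) ?i \<cdot>\<^bsub>C\<^esub> snd (Cod D u) g" if g: "g \<in> carrier G" for g
  proof -
    have "ar_map (\<phi> g) ?i \<cdot>\<^bsub>C\<^esub> (snd (Cod D u) g \<cdot>\<^bsub>C\<^esub> arr u) \<cdot>\<^bsub>C\<^esub> ?i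
        = snd (Dom D u) g \<cdot>\<^bsub>C\<^esub> ?i"
      using u g by (subst arr_equivariant) auto
    then show ?thesis using u g by simp
  qed
  then have v: "?v \<in> Ar D" "Dom D ?v = Cod D u" "Cod D ?v = Dom D u"
    using u by (auto intro!: Ar_D_exists)
  show "u \<in> isos D"
    using u v by (intro D.isosI[of _ ?v] arr_eqI) auto
qed

end


section \<open>Objects with a compatible action of the dual group\<close>

locale dual_action = dualizable_group G field_type + categorical_action G C \<phi> \<epsilon>
  for G :: "'g monoid" (structure)
    and field_type :: "'k::alg_closed_field itself"
    and C :: "('k, 'o, 'm) lincat"
    and \<phi> :: "'g \<Rightarrow> ('o, 'm, 'o, 'm) functr"
    and \<epsilon> :: "'g \<Rightarrow> 'g \<Rightarrow> 'o \<Rightarrow> 'm"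
begin

text \<open>
  Unfolded, these are the objects of the category of \<open>G\<^sup>\<or>\<close>-equivariant objects in the category of
  \<open>G\<close>-equivariant objects: \<open>a \<chi>\<close> is an isomorphism from \<open>P\<close> to the twist of \<open>P\<close> by \<open>\<chi>\<close>.
\<close>

definition dual_equivariant :: "'o \<times> ('g \<Rightarrow> 'm) \<Rightarrow> (('g \<Rightarrow> 'k) \<Rightarrow> 'm) \<Rightarrow> bool" where
  "dual_equivariant P a \<longleftrightarrow> P \<in> Ob D \<and>
     (\<forall>\<chi> \<in> carrier Gd. a \<chi> \<in> isos C \<and> Dom C (a \<chi>) = fst P \<and> Cod C (a \<chi>) = fst P) \<and>
     (\<forall>\<chi> \<in> carrier Gd. \<forall>\<psi> \<in> carrier Gd. a (\<psi> \<otimes>\<^bsub>Gd\<^esub> \<chi>) = a \<psi> \<cdot>\<^bsub>C\<^esub> a \<chi>) \<and>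
     (\<forall>\<chi> \<in> carrier Gd. \<forall>g \<in> carrier G.
        hscale C (\<chi> g) (snd P g \<cdot>\<^bsub>C\<^esub> a \<chi>) = ar_map (\<phi> g) (a \<chi>) \<cdot>\<^bsub>C\<^esub> snd P g)"

text \<open>The average of the operators \<open>a \<chi>\<close>. In the field |G| is invertible by
  \<open>card_nonzero\<close> and equal to the order of the dual group by
  \<open>card_dual\<close>.\<close>

definition invariant_proj :: "'o \<times> ('g \<Rightarrow> 'm) \<Rightarrow> (('g \<Rightarrow> 'k) \<Rightarrow> 'm) \<Rightarrow> 'm" where
  "invariant_proj P a = hscale C (1 / of_nat (card (carrier G)))
     (Hom_sum C (fst P) (fst P) a (carrier Gd))"

text \<open>Twists leave underlying arrows unchanged, so compatibility with the dual group is plain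
  commutation without scalars.\<close>

definition dual_equivariant_arrow ::
  "'o \<times> ('g \<Rightarrow> 'm) \<Rightarrow> (('g \<Rightarrow> 'k) \<Rightarrow> 'm) \<Rightarrow> 'o \<times> ('g \<Rightarrow> 'm) \<Rightarrow> (('g \<Rightarrow> 'k) \<Rightarrow> 'm) \<Rightarrow> 'm \<Rightarrow> bool" where
  "dual_equivariant_arrow P a Q b f \<longleftrightarrow>
     f \<in> Ar C \<and> Dom C f = fst P \<and> Cod C f = fst Q \<and>
     (\<forall>g \<in> carrier G. snd Q g \<cdot>\<^bsub>C\<^esub> f = ar_map (\<phi> g) f \<cdot>\<^bsub>C\<^esub> snd P g) \<and>
     (\<forall>\<chi> \<in> carrier Gd. b \<chi> \<cdot>\<^bsub>C\<^esub> f = f \<cdot>\<^bsub>C\<^esub> a \<chi>)"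

section \<open>The invariant projector and its translates\<close>

context
  fixes P a assumes Pa: "dual_equivariant P a"
begin

lemma dual_equivariant_simps [simp]:
  shows "P \<in> Ob D" "\<chi> \<in> carrier Gd \<Longrightarrow> a \<chi> \<in> isos C" "\<chi> \<in> carrier Gd \<Longrightarrow> a \<chi> \<in> Ar C"
    "\<chi> \<in> carrier Gd \<Longrightarrow> Dom C (a \<chi>) = fst P" "\<chi> \<in> carrier Gd \<Longrightarrow> Cod C (a \<chi>) = fst P"
  using Pa by (auto simp: dual_equivariant_def)

lemma dual_equivariant_mult:
  "\<chi> \<in> carrier Gd \<Longrightarrow> \<psi> \<in> carrier Gd \<Longrightarrow> a (\<psi> \<otimes>\<^bsub>Gd\<^esub> \<chi>) = a \<psi> \<cdot>\<^bsub>C\<^esub> a \<chi>"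
  using Pa unfolding dual_equivariant_def by blast

lemma dual_equivariant_twist:
  "\<chi> \<in> carrier Gd \<Longrightarrow> g \<in> carrier G \<Longrightarrow>
    ar_map (\<phi> g) (a \<chi>) \<cdot>\<^bsub>C\<^esub> snd P g = hscale C (\<chi> g) (snd P g \<cdot>\<^bsub>C\<^esub> a \<chi>)"
  using Pa unfolding dual_equivariant_def by metis

lemma dual_equivariant_one: "a \<one>\<^bsub>Gd\<^esub> = Ident C (fst P)"
proof (rule C.isos_cancel_left[of "a \<one>\<^bsub>Gd\<^esub>"])
  have "a \<one>\<^bsub>Gd\<^esub> \<cdot>\<^bsub>C\<^esub> a \<one>\<^bsub>Gd\<^esub> = a \<one>\<^bsub>Gd\<^esub>"
    using dual_equivariant_mult[of "\<one>\<^bsub>Gd\<^esub>" "\<one>\<^bsub>Gd\<^esub>"] by simp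
  then show "a \<one>\<^bsub>Gd\<^esub> \<cdot>\<^bsub>C\<^esub> a \<one>\<^bsub>Gd\<^esub> = a \<one>\<^bsub>Gd\<^esub> \<cdot>\<^bsub>C\<^esub> Ident C (fst P)" by simp
qed auto

lemma a_Hom: "\<chi> \<in> carrier Gd \<Longrightarrow> a \<chi> \<in> Hom C (fst P) (fst P)"
  by (simp add: Hom_iff)

lemma sum_a_Ar [simp]:
  "Hom_sum C (fst P) (fst P) a (carrier Gd) \<in> Ar C"
  "Dom C (Hom_sum C (fst P) (fst P) a (carrier Gd)) = fst P"
  "Cod C (Hom_sum C (fst P) (fst P) a (carrier Gd)) = fst P"
  using a_Hom by simp_all

lemma invariant_proj_Ar [simp]:
  "invariant_proj P a \<in> Ar C" "Dom C (invariant_proj P a) = fst P"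
  "Cod C (invariant_proj P a) = fst P"
  unfolding invariant_proj_def by simp_all

text \<open>Multiplication by \<chi> permutes the summands of the average; the dual group is
  commutative, so this works on both sides.\<close>

lemma a_invariant_proj [simp]:
  assumes \<chi>: "\<chi> \<in> carrier Gd"
  shows "a \<chi> \<cdot>\<^bsub>C\<^esub> invariant_proj P a = invariant_proj P a"
    and "invariant_proj P a \<cdot>\<^bsub>C\<^esub> a \<chi> = invariant_proj P a"
proof -
  let ?S = "Hom_sum C (fst P) (fst P)"
  have bij: "bij_betw (\<lambda>\<psi>. \<chi> \<otimes>\<^bsub>Gd\<^esub> \<psi>) (carrier Gd) (carrier Gd)"
    using \<chi> by (intro bij_betwI[of _ _ _ "\<lambda>\<psi>. inv\<^bsub>Gd\<^esub> \<chi> \<otimes>\<^bsub>Gd\<^esub> \<psi>"]) (auto simp: Gd.m_assoc[symmetric])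
  have "a \<chi> \<cdot>\<^bsub>C\<^esub> ?S a (carrier Gd) = ?S (\<lambda>\<psi>. a \<chi> \<cdot>\<^bsub>C\<^esub> a \<psi>) (carrier Gd)"
    using \<chi> a_Hom by (intro C.Comp_Hom_sum_right) auto
  also have "\<dots> = ?S (\<lambda>\<psi>. a (\<chi> \<otimes>\<^bsub>Gd\<^esub> \<psi>)) (carrier Gd)"
    using \<chi> a_Hom by (intro C.Hom_sum_cong) (auto simp: dual_equivariant_mult[symmetric])
  also have "\<dots> = ?S a (carrier Gd)"
    using a_Hom by (intro C.Hom_sum_reindex[OF _ _ bij]) auto
  finally show "a \<chi> \<cdot>\<^bsub>C\<^esub> invariant_proj P a = invariant_proj P a"
    using \<chi> by (simp add: invariant_proj_def)
  have "?S a (carrier Gd) \<cdot>\<^bsub>C\<^esub> a \<chi> = ?S (\<lambda>\<psi>. a \<psi> \<cdot>\<^bsub>C\<^esub> a \<chi>) (carrier Gd)"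
    using \<chi> a_Hom by (intro C.Comp_Hom_sum_left) auto
  also have "\<dots> = ?S (\<lambda>\<psi>. a (\<chi> \<otimes>\<^bsub>Gd\<^esub> \<psi>)) (carrier Gd)"
    using \<chi> a_Hom by (intro C.Hom_sum_cong)
      (auto simp: dual_equivariant_mult[symmetric] Gd.m_comm)
  also have "\<dots> = ?S a (carrier Gd)"
    using a_Hom by (intro C.Hom_sum_reindex[OF _ _ bij]) auto
  finally show "invariant_proj P a \<cdot>\<^bsub>C\<^esub> a \<chi> = invariant_proj P a"
    using \<chi> by (simp add: invariant_proj_def)
qed

text \<open>The projector absorbs every \<open>a \<chi>\<close>, hence only the coefficients
  survive. Coefficients 1 give idempotence, coefficients \<chi>(g) give orthogonality of the
  translates.\<close>

lemma invariant_proj_scaled_sum: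
  "invariant_proj P a \<cdot>\<^bsub>C\<^esub> Hom_sum C (fst P) (fst P) (\<lambda>\<chi>. hscale C (c \<chi>) (a \<chi>)) (carrier Gd)
    = hscale C (\<Sum>\<chi> \<in> carrier Gd. c \<chi>) (invariant_proj P a)"
proof -
  let ?S = "Hom_sum C (fst P) (fst P)"
  have "invariant_proj P a \<cdot>\<^bsub>C\<^esub> ?S (\<lambda>\<chi>. hscale C (c \<chi>) (a \<chi>)) (carrier Gd)
      = ?S (\<lambda>\<chi>. invariant_proj P a \<cdot>\<^bsub>C\<^esub> hscale C (c \<chi>) (a \<chi>)) (carrier Gd)"
    by (intro C.Comp_Hom_sum_right) (auto simp: Hom_iff)
  also have "\<dots> = ?S (\<lambda>\<chi>. hscale C (c \<chi>) (invariant_proj P a)) (carrier Gd)"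
    by (intro C.Hom_sum_cong) (auto simp: Hom_iff)
  also have "\<dots> = hscale C (\<Sum>\<chi> \<in> carrier Gd. c \<chi>) (invariant_proj P a)"
    by (intro C.Hom_sum_scalars) (auto simp: Hom_iff)
  finally show ?thesis .
qed

lemma invariant_proj_idem [simp]:
  "invariant_proj P a \<cdot>\<^bsub>C\<^esub> invariant_proj P a = invariant_proj P a"
proof -
  have "Hom_sum C (fst P) (fst P) (\<lambda>\<chi>. hscale C 1 (a \<chi>)) (carrier Gd)
      = Hom_sum C (fst P) (fst P) a (carrier Gd)"
    by (intro C.Hom_sum_cong) (auto simp: Hom_iff)
  then have "invariant_proj P a \<cdot>\<^bsub>C\<^esub> Hom_sum C (fst P) (fst P) a (carrier Gd)
      = hscale C (of_nat (card (carrier G))) (invariant_proj P a)"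
    using invariant_proj_scaled_sum[of "\<lambda>_. 1"] by (simp add: card_dual)
  then show ?thesis
    by (subst (2) invariant_proj_def) simp
qed

text \<open>Moving \<phi>_g(a_\<chi>) past \<theta>_g costs the scalar \<chi>(g). The result is the
  projector onto the component on which each \<chi> acts by \<chi>(g)^-1, exhibited as a conjugate
  of the translated invariant projector.\<close>

lemma conj_invariant_proj:
  assumes g: "g \<in> carrier G"
  shows "inverse_arrow C (snd P g) \<cdot>\<^bsub>C\<^esub> (ar_map (\<phi> g) (invariant_proj P a) \<cdot>\<^bsub>C\<^esub> snd P g)
    = hscale C (1 / of_nat (card (carrier G)))
        (Hom_sum C (fst P) (fst P) (\<lambda>\<chi>. hscale C (\<chi> g) (a \<chi>)) (carrier Gd))"
proof -
  interpret \<phi>g: linear_functor C C "\<phi> g" using g by (rule linear_functor_\<phi>)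
  let ?X = "fst P" and ?Y = "ob_map (\<phi> g) (fst P)"
  have "ar_map (\<phi> g) (Hom_sum C ?X ?X a (carrier Gd)) \<cdot>\<^bsub>C\<^esub> snd P g
      = Hom_sum C ?Y ?Y (\<lambda>\<chi>. ar_map (\<phi> g) (a \<chi>)) (carrier Gd) \<cdot>\<^bsub>C\<^esub> snd P g"
    using a_Hom by (subst \<phi>g.ar_map_Hom_sum) auto
  also have "\<dots> = Hom_sum C ?X ?Y (\<lambda>\<chi>. ar_map (\<phi> g) (a \<chi>) \<cdot>\<^bsub>C\<^esub> snd P g) (carrier Gd)"
    using g by (intro C.Comp_Hom_sum_left) (auto simp: Hom_iff)
  finally have "inverse_arrow C (snd P g) \<cdot>\<^bsub>C\<^esub>
        (ar_map (\<phi> g) (Hom_sum C ?X ?X a (carrier Gd)) \<cdot>\<^bsub>C\<^esub> snd P g)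
      = inverse_arrow C (snd P g) \<cdot>\<^bsub>C\<^esub>
          Hom_sum C ?X ?Y (\<lambda>\<chi>. ar_map (\<phi> g) (a \<chi>) \<cdot>\<^bsub>C\<^esub> snd P g) (carrier Gd)" by simp
  also have "\<dots> = Hom_sum C ?X ?X (\<lambda>\<chi>. inverse_arrow C (snd P g) \<cdot>\<^bsub>C\<^esub>
      (ar_map (\<phi> g) (a \<chi>) \<cdot>\<^bsub>C\<^esub> snd P g)) (carrier Gd)"
    using g by (intro C.Comp_Hom_sum_right) (auto simp: Hom_iff)
  also have "\<dots> = Hom_sum C ?X ?X (\<lambda>\<chi>. hscale C (\<chi> g) (a \<chi>)) (carrier Gd)"
    using g by (intro C.Hom_sum_cong) (auto simp: Hom_iff dual_equivariant_twist)
  finally show ?thesis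
    using g by (simp add: invariant_proj_def)
qed

text \<open>After the two sums are exchanged, the coefficient of \<open>a \<chi>\<close> contains
  the sum of \<chi>(g) over g, which vanishes unless \<chi> is trivial.\<close>

lemma sum_conj_invariant_proj:
  "Hom_sum C (fst P) (fst P) (\<lambda>g. inverse_arrow C (snd P g) \<cdot>\<^bsub>C\<^esub>
      (ar_map (\<phi> g) (invariant_proj P a) \<cdot>\<^bsub>C\<^esub> snd P g)) (carrier G) = Ident C (fst P)"
proof -
  let ?S = "Hom_sum C (fst P) (fst P)" and ?n = "of_nat (card (carrier G)) :: 'k"
  have "?S (\<lambda>g. inverse_arrow C (snd P g) \<cdot>\<^bsub>C\<^esub>
      (ar_map (\<phi> g) (invariant_proj P a) \<cdot>\<^bsub>C\<^esub> snd P g)) (carrier G)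
    = ?S (\<lambda>g. hscale C (1 / ?n) (?S (\<lambda>\<chi>. hscale C (\<chi> g) (a \<chi>)) (carrier Gd))) (carrier G)"
    by (intro C.Hom_sum_cong conj_invariant_proj) (auto simp: Hom_iff)
  also have "\<dots> = hscale C (1 / ?n) (?S (\<lambda>g. ?S (\<lambda>\<chi>. hscale C (\<chi> g) (a \<chi>)) (carrier Gd)) (carrier G))"
    by (intro C.hscale_Hom_sum[symmetric]) (auto simp: Hom_iff)
  also have "?S (\<lambda>g. ?S (\<lambda>\<chi>. hscale C (\<chi> g) (a \<chi>)) (carrier Gd)) (carrier G)
      = ?S (\<lambda>\<chi>. ?S (\<lambda>g. hscale C (\<chi> g) (a \<chi>)) (carrier G)) (carrier Gd)"
    by (intro C.Hom_sum_swap) (auto simp: Hom_iff)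
  also have "\<dots> = ?S (\<lambda>\<chi>. hscale C (\<Sum>g \<in> carrier G. \<chi> g) (a \<chi>)) (carrier Gd)"
    by (intro C.Hom_sum_cong C.Hom_sum_scalars) (auto simp: Hom_iff)
  also have "\<dots> = hscale C (\<Sum>g \<in> carrier G. \<one>\<^bsub>Gd\<^esub> g) (a \<one>\<^bsub>Gd\<^esub>)"
    by (intro C.Hom_sum_delta) (auto simp: Hom_iff sum_character)
  finally show ?thesis
    by (simp add: dual_equivariant_one)
qed

text \<open>The product is a multiple of the projector by the sum of \<chi>(g) over \<chi>, which
  vanishes since some character is nontrivial on g.\<close>

lemma invariant_proj_conj_invariant_proj:
  assumes g: "g \<in> carrier G" "g \<noteq> \<one>"
  shows "invariant_proj P a \<cdot>\<^bsub>C\<^esub>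
      (inverse_arrow C (snd P g) \<cdot>\<^bsub>C\<^esub> (ar_map (\<phi> g) (invariant_proj P a) \<cdot>\<^bsub>C\<^esub> snd P g))
    = hzero C (fst P) (fst P)"
proof -
  have "hscale C (\<Sum>\<chi> \<in> carrier Gd. \<chi> g) (invariant_proj P a) = hzero C (fst P) (fst P)"
    using g by (simp add: sum_characters_apply)
  then show ?thesis
    unfolding conj_invariant_proj[OF g(1)]
    using invariant_proj_scaled_sum[of "\<lambda>\<chi>. \<chi> g"] by (simp add: Hom_iff)
qed

end

section \<open>Arrows compatible with both structures\<close>

lemma dual_equivariant_arrow_simps:
  assumes "dual_equivariant_arrow P a Q b f"
  shows "f \<in> Ar C" "Dom C f = fst P" "Cod C f = fst Q"
    "g \<in> carrier G \<Longrightarrow> snd Q g \<cdot>\<^bsub>C\<^esub> f = ar_map (\<phi> g) f \<cdot>\<^bsub>C\<^esub> snd P g"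
    "\<chi> \<in> carrier Gd \<Longrightarrow> b \<chi> \<cdot>\<^bsub>C\<^esub> f = f \<cdot>\<^bsub>C\<^esub> a \<chi>"
  using assms unfolding dual_equivariant_arrow_def by blast+

lemma invariant_proj_natural:
  assumes Pa: "dual_equivariant P a" and Qb: "dual_equivariant Q b"
    and f: "dual_equivariant_arrow P a Q b f"
  shows "invariant_proj Q b \<cdot>\<^bsub>C\<^esub> f = f \<cdot>\<^bsub>C\<^esub> invariant_proj P a"
proof -
  note [simp] = dual_equivariant_simps[OF Pa] dual_equivariant_simps[OF Qb]
    dual_equivariant_arrow_simps(1-3)[OF f] sum_a_Ar[OF Pa] sum_a_Ar[OF Qb]
  have "Hom_sum C (fst Q) (fst Q) b (carrier Gd) \<cdot>\<^bsub>C\<^esub> f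
      = Hom_sum C (fst P) (fst Q) (\<lambda>\<chi>. b \<chi> \<cdot>\<^bsub>C\<^esub> f) (carrier Gd)"
    by (intro C.Comp_Hom_sum_left) (auto simp: Hom_iff)
  also have "\<dots> = Hom_sum C (fst P) (fst Q) (\<lambda>\<chi>. f \<cdot>\<^bsub>C\<^esub> a \<chi>) (carrier Gd)"
    using dual_equivariant_arrow_simps(5)[OF f] by (intro C.Hom_sum_cong) (auto simp: Hom_iff)
  also have "\<dots> = f \<cdot>\<^bsub>C\<^esub> Hom_sum C (fst P) (fst P) a (carrier Gd)"
    by (intro C.Comp_Hom_sum_right[symmetric]) (auto simp: Hom_iff)
  finally show ?thesis
    by (simp add: invariant_proj_def)
qed

text \<open>The identity of P is split into the translated projectors, and equivariance of f is
  applied to each summand. Hence f is determined by its restriction to the invariant part, which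
  yields faithfulness of the functor of invariants.\<close>

lemma dual_equivariant_arrow_expand:
  assumes Pa: "dual_equivariant P a" and f: "dual_equivariant_arrow P a Q b f" and Q: "Q \<in> Ob D"
  shows "f = Hom_sum C (fst P) (fst Q) (\<lambda>g. inverse_arrow C (snd Q g) \<cdot>\<^bsub>C\<^esub>
    (ar_map (\<phi> g) (f \<cdot>\<^bsub>C\<^esub> invariant_proj P a) \<cdot>\<^bsub>C\<^esub> snd P g)) (carrier G)"
proof -
  note [simp] = dual_equivariant_simps[OF Pa] dual_equivariant_arrow_simps(1-3)[OF f] Q
    invariant_proj_Ar[OF Pa]
  let ?q = "\<lambda>g. inverse_arrow C (snd P g) \<cdot>\<^bsub>C\<^esub> (ar_map (\<phi> g) (invariant_proj P a) \<cdot>\<^bsub>C\<^esub> snd P g)"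
  have "f = f \<cdot>\<^bsub>C\<^esub> Hom_sum C (fst P) (fst P) ?q (carrier G)"
    by (simp add: sum_conj_invariant_proj[OF Pa])
  also have "\<dots> = Hom_sum C (fst P) (fst Q) (\<lambda>g. f \<cdot>\<^bsub>C\<^esub> ?q g) (carrier G)"
    by (intro C.Comp_Hom_sum_right) (auto simp: Hom_iff)
  also have "\<dots> = Hom_sum C (fst P) (fst Q) (\<lambda>g. inverse_arrow C (snd Q g) \<cdot>\<^bsub>C\<^esub>
    (ar_map (\<phi> g) (f \<cdot>\<^bsub>C\<^esub> invariant_proj P a) \<cdot>\<^bsub>C\<^esub> snd P g)) (carrier G)"
  proof (intro C.Hom_sum_cong)
    fix g assume g: "g \<in> carrier G"
    have "snd Q g \<cdot>\<^bsub>C\<^esub> (f \<cdot>\<^bsub>C\<^esub> ?q g) = (snd Q g \<cdot>\<^bsub>C\<^esub> f) \<cdot>\<^bsub>C\<^esub> ?q g"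
      using g by simp
    also have "\<dots> = (ar_map (\<phi> g) f \<cdot>\<^bsub>C\<^esub> snd P g) \<cdot>\<^bsub>C\<^esub> ?q g"
      using dual_equivariant_arrow_simps(4)[OF f g] by simp
    also have "\<dots> = ar_map (\<phi> g) (f \<cdot>\<^bsub>C\<^esub> invariant_proj P a) \<cdot>\<^bsub>C\<^esub> snd P g"
      using g by simp
    finally have eq: "snd Q g \<cdot>\<^bsub>C\<^esub> (f \<cdot>\<^bsub>C\<^esub> ?q g) = \<dots>" .
    have "f \<cdot>\<^bsub>C\<^esub> ?q g = inverse_arrow C (snd Q g) \<cdot>\<^bsub>C\<^esub> (snd Q g \<cdot>\<^bsub>C\<^esub> (f \<cdot>\<^bsub>C\<^esub> ?q g))"
      using g by simp
    then show "f \<cdot>\<^bsub>C\<^esub> ?q g = inverse_arrow C (snd Q g) \<cdot>\<^bsub>C\<^esub>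
        (ar_map (\<phi> g) (f \<cdot>\<^bsub>C\<^esub> invariant_proj P a) \<cdot>\<^bsub>C\<^esub> snd P g)"
      unfolding eq .
  qed (auto simp: Hom_iff)
  finally show ?thesis .
qed

text \<open>The cocycle condition of an object at the pair (1, 1) makes \<phi>_1(\<theta>_1) inverse
  to \<open>\<epsilon> \<one> \<one>\<close>, which is natural for all arrows of \<open>C\<close>.
  As \<phi>_1 is faithful, \<theta>_1 is natural as well, with f not assumed equivariant.\<close>

lemma action_one_natural:
  assumes "P \<in> Ob D" "Q \<in> Ob D" and f [simp]: "f \<in> Ar C" "Dom C f = fst P" "Cod C f = fst Q"
  shows "ar_map (\<phi> \<one>) f \<cdot>\<^bsub>C\<^esub> snd P \<one> = snd Q \<one> \<cdot>\<^bsub>C\<^esub> f"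
proof (rule \<phi>_faithful[of \<one>])
  note [simp] = assms(1,2)
  have one: "\<epsilon> \<one> \<one> (fst R) \<cdot>\<^bsub>C\<^esub> ar_map (\<phi> \<one>) (snd R \<one>) = Ident C (ob_map (\<phi> \<one>) (fst R))"
    if R: "R \<in> Ob D" for R
    by (rule C.isos_cancel_right[of "snd R \<one>"])
      (use Ob_D_cocycle[OF R, of \<one> \<one>, symmetric] R in auto)
  have "\<epsilon> \<one> \<one> (fst Q) \<cdot>\<^bsub>C\<^esub> ar_map (\<phi> \<one>) (ar_map (\<phi> \<one>) f \<cdot>\<^bsub>C\<^esub> snd P \<one>)
      = (\<epsilon> \<one> \<one> (Cod C f) \<cdot>\<^bsub>C\<^esub> ar_map (\<phi> \<one>) (ar_map (\<phi> \<one>) f)) \<cdot>\<^bsub>C\<^esub> ar_map (\<phi> \<one>) (snd P \<one>)"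
    by simp
  also have "\<dots> = ar_map (\<phi> \<one>) f \<cdot>\<^bsub>C\<^esub> (\<epsilon> \<one> \<one> (fst P) \<cdot>\<^bsub>C\<^esub> ar_map (\<phi> \<one>) (snd P \<one>))"
    by (subst \<epsilon>_natural) simp_all
  also have "\<dots> = (\<epsilon> \<one> \<one> (fst Q) \<cdot>\<^bsub>C\<^esub> ar_map (\<phi> \<one>) (snd Q \<one>)) \<cdot>\<^bsub>C\<^esub> ar_map (\<phi> \<one>) f"
    by (simp only: one assms(1,2)) simp
  also have "\<dots> = \<epsilon> \<one> \<one> (fst Q) \<cdot>\<^bsub>C\<^esub> ar_map (\<phi> \<one>) (snd Q \<one> \<cdot>\<^bsub>C\<^esub> f)"
    by simp
  finally show "ar_map (\<phi> \<one>) (ar_map (\<phi> \<one>) f \<cdot>\<^bsub>C\<^esub> snd P \<one>) = ar_map (\<phi> \<one>) (snd Q \<one> \<cdot>\<^bsub>C\<^esub> f)"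
    by (rule C.isos_cancel_left[rotated -1]) auto
qed (use assms in auto)

text \<open>
  An arrow between the invariant parts is extended by translating it to the other isotypic
  components with the equivariant structures.
\<close>

lemma dual_equivariant_arrow_extend:
  assumes Pa: "dual_equivariant P a" and Qb: "dual_equivariant Q b"
    and f [simp]: "f \<in> Ar C" "Dom C f = fst P" "Cod C f = fst Q"
    and fp: "f \<cdot>\<^bsub>C\<^esub> invariant_proj P a = f" and pf: "invariant_proj Q b \<cdot>\<^bsub>C\<^esub> f = f"
  obtains f' where "dual_equivariant_arrow P a Q b f'" "invariant_proj Q b \<cdot>\<^bsub>C\<^esub> f' = f"
proof -
  note [simp] = dual_equivariant_simps[OF Pa] dual_equivariant_simps[OF Qb]
    invariant_proj_Ar[OF Pa] invariant_proj_Ar[OF Qb]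
  define t where "t g = inverse_arrow C (snd Q g) \<cdot>\<^bsub>C\<^esub> (ar_map (\<phi> g) f \<cdot>\<^bsub>C\<^esub> snd P g)" for g
  have t [simp]: "t g \<in> Ar C" "Dom C (t g) = fst P" "Cod C (t g) = fst Q" if "g \<in> carrier G" for g
    using that by (auto simp: t_def)
  have Qt: "snd Q g \<cdot>\<^bsub>C\<^esub> t g = ar_map (\<phi> g) f \<cdot>\<^bsub>C\<^esub> snd P g" if "g \<in> carrier G" for g
    using that by (simp add: t_def)
  define f' where "f' = Hom_sum C (fst P) (fst Q) t (carrier G)"
  have f' [simp]: "f' \<in> Ar C" "Dom C f' = fst P" "Cod C f' = fst Q"
    by (auto simp: f'_def Hom_iff)
  \<comment> \<open>f starts and ends in invariant parts, so it is fixed by both families.\<close>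
  have bf: "b \<chi> \<cdot>\<^bsub>C\<^esub> f = f" if \<chi>: "\<chi> \<in> carrier Gd" for \<chi>
  proof -
    have "b \<chi> \<cdot>\<^bsub>C\<^esub> (invariant_proj Q b \<cdot>\<^bsub>C\<^esub> f) = (b \<chi> \<cdot>\<^bsub>C\<^esub> invariant_proj Q b) \<cdot>\<^bsub>C\<^esub> f"
      using \<chi> by simp
    then show ?thesis using \<chi> by (simp add: pf a_invariant_proj[OF Qb])
  qed
  have fa: "f \<cdot>\<^bsub>C\<^esub> a \<chi> = f" if \<chi>: "\<chi> \<in> carrier Gd" for \<chi>
  proof -
    have "(f \<cdot>\<^bsub>C\<^esub> invariant_proj P a) \<cdot>\<^bsub>C\<^esub> a \<chi> = f \<cdot>\<^bsub>C\<^esub> (invariant_proj P a \<cdot>\<^bsub>C\<^esub> a \<chi>)"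
      using \<chi> by simp
    then show ?thesis using \<chi> by (simp add: fp a_invariant_proj[OF Pa])
  qed
  \<comment> \<open>Moving \<chi> past the equivariant structures of P and Q produces the same
    factor \<chi>(g); this factor and then \<open>snd Q g\<close> are cancelled.\<close>
  have bt: "b \<chi> \<cdot>\<^bsub>C\<^esub> t g = t g \<cdot>\<^bsub>C\<^esub> a \<chi>" if \<chi>: "\<chi> \<in> carrier Gd" and g: "g \<in> carrier G" for \<chi> g
  proof -
    have "hscale C (\<chi> g) (snd Q g \<cdot>\<^bsub>C\<^esub> (b \<chi> \<cdot>\<^bsub>C\<^esub> t g))
        = hscale C (\<chi> g) (snd Q g \<cdot>\<^bsub>C\<^esub> b \<chi>) \<cdot>\<^bsub>C\<^esub> t g"
      using \<chi> g by simp
    also have "\<dots> = ar_map (\<phi> g) (b \<chi>) \<cdot>\<^bsub>C\<^esub> (snd Q g \<cdot>\<^bsub>C\<^esub> t g)"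
      unfolding dual_equivariant_twist[OF Qb \<chi> g, symmetric] using \<chi> g by simp
    also have "\<dots> = ar_map (\<phi> g) (b \<chi> \<cdot>\<^bsub>C\<^esub> f) \<cdot>\<^bsub>C\<^esub> snd P g"
      using \<chi> g by (simp add: Qt)
    also have "\<dots> = ar_map (\<phi> g) (f \<cdot>\<^bsub>C\<^esub> a \<chi>) \<cdot>\<^bsub>C\<^esub> snd P g"
      using \<chi> by (simp only: fa bf)
    also have "\<dots> = ar_map (\<phi> g) f \<cdot>\<^bsub>C\<^esub> hscale C (\<chi> g) (snd P g \<cdot>\<^bsub>C\<^esub> a \<chi>)"
      unfolding dual_equivariant_twist[OF Pa \<chi> g, symmetric] using \<chi> g by simp
    also have "\<dots> = hscale C (\<chi> g) (snd Q g \<cdot>\<^bsub>C\<^esub> (t g \<cdot>\<^bsub>C\<^esub> a \<chi>))"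
    proof -
      have "snd Q g \<cdot>\<^bsub>C\<^esub> (t g \<cdot>\<^bsub>C\<^esub> a \<chi>) = (snd Q g \<cdot>\<^bsub>C\<^esub> t g) \<cdot>\<^bsub>C\<^esub> a \<chi>"
        using \<chi> g by simp
      then show ?thesis using \<chi> g by (simp add: Qt)
    qed
    finally have "snd Q g \<cdot>\<^bsub>C\<^esub> (b \<chi> \<cdot>\<^bsub>C\<^esub> t g) = snd Q g \<cdot>\<^bsub>C\<^esub> (t g \<cdot>\<^bsub>C\<^esub> a \<chi>)"
      by (rule C.hscale_cancel[rotated -1]) (use \<chi> g in auto)
    then show ?thesis
      by (rule C.isos_cancel_left[rotated -1]) (use \<chi> g in auto)
  qed
  \<comment> \<open>Naturality of \<open>\<epsilon> h g\<close> and the cocycle conditions of P and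
    Q relate the translate at g to the one at g h. Summed over all g this becomes equivariance, by
    reindexing.\<close>
  have t_translate: "ar_map (\<phi> h) (t g) \<cdot>\<^bsub>C\<^esub> snd P h = snd Q h \<cdot>\<^bsub>C\<^esub> t (g \<otimes> h)"
    if gh: "g \<in> carrier G" "h \<in> carrier G" for g h
  proof -
    have "(\<epsilon> h g (fst Q) \<cdot>\<^bsub>C\<^esub> ar_map (\<phi> h) (snd Q g)) \<cdot>\<^bsub>C\<^esub> (ar_map (\<phi> h) (t g) \<cdot>\<^bsub>C\<^esub> snd P h)
        = \<epsilon> h g (fst Q) \<cdot>\<^bsub>C\<^esub> (ar_map (\<phi> h) (snd Q g \<cdot>\<^bsub>C\<^esub> t g) \<cdot>\<^bsub>C\<^esub> snd P h)"
      using gh by simp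
    also have "\<dots> = (\<epsilon> h g (Cod C f) \<cdot>\<^bsub>C\<^esub> ar_map (\<phi> h) (ar_map (\<phi> g) f)) \<cdot>\<^bsub>C\<^esub>
        (ar_map (\<phi> h) (snd P g) \<cdot>\<^bsub>C\<^esub> snd P h)"
      using gh by (simp add: Qt)
    also have "\<dots> = ar_map (\<phi> (g \<otimes> h)) f \<cdot>\<^bsub>C\<^esub>
        (\<epsilon> h g (fst P) \<cdot>\<^bsub>C\<^esub> (ar_map (\<phi> h) (snd P g) \<cdot>\<^bsub>C\<^esub> snd P h))"
      using gh by (subst \<epsilon>_natural) simp_all
    also have "\<dots> = ar_map (\<phi> (g \<otimes> h)) f \<cdot>\<^bsub>C\<^esub> snd P (g \<otimes> h)"
      using gh by (subst Ob_D_cocycle) simp_all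
    also have "\<dots> = snd Q (g \<otimes> h) \<cdot>\<^bsub>C\<^esub> t (g \<otimes> h)"
      using gh by (simp add: Qt)
    also have "\<dots> = (\<epsilon> h g (fst Q) \<cdot>\<^bsub>C\<^esub> ar_map (\<phi> h) (snd Q g)) \<cdot>\<^bsub>C\<^esub> (snd Q h \<cdot>\<^bsub>C\<^esub> t (g \<otimes> h))"
      using gh by (subst Ob_D_cocycle) simp_all
    finally show ?thesis
      by (rule C.isos_cancel_left[rotated -1]) (use gh in auto)
  qed
  have "dual_equivariant_arrow P a Q b f'"
    unfolding dual_equivariant_arrow_def
  proof (intro conjI ballI f')
    fix h assume h: "h \<in> carrier G"
    interpret \<phi>h: linear_functor C C "\<phi> h" using h by (rule linear_functor_\<phi>)
    let ?S = "Hom_sum C (fst P) (ob_map (\<phi> h) (fst Q))"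
    have bij: "bij_betw (\<lambda>g. g \<otimes> h) (carrier G) (carrier G)"
      using h by (intro bij_betwI[of _ _ _ "\<lambda>g. g \<otimes> inv h"]) (auto simp: m_assoc)
    have "ar_map (\<phi> h) f' \<cdot>\<^bsub>C\<^esub> snd P h = Hom_sum C (ob_map (\<phi> h) (fst P)) (ob_map (\<phi> h) (fst Q))
        (\<lambda>g. ar_map (\<phi> h) (t g)) (carrier G) \<cdot>\<^bsub>C\<^esub> snd P h"
      unfolding f'_def by (subst \<phi>h.ar_map_Hom_sum) (auto simp: Hom_iff)
    also have "\<dots> = ?S (\<lambda>g. ar_map (\<phi> h) (t g) \<cdot>\<^bsub>C\<^esub> snd P h) (carrier G)"
      using h by (intro C.Comp_Hom_sum_left) (auto simp: Hom_iff)
    also have "\<dots> = ?S (\<lambda>g. snd Q h \<cdot>\<^bsub>C\<^esub> t (g \<otimes> h)) (carrier G)"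
      using h by (intro C.Hom_sum_cong) (auto simp: Hom_iff t_translate)
    also have "\<dots> = ?S (\<lambda>g. snd Q h \<cdot>\<^bsub>C\<^esub> t g) (carrier G)"
      using h by (intro C.Hom_sum_reindex[OF _ _ bij]) (auto simp: Hom_iff)
    also have "\<dots> = snd Q h \<cdot>\<^bsub>C\<^esub> f'"
      unfolding f'_def using h by (intro C.Comp_Hom_sum_right[symmetric]) (auto simp: Hom_iff)
    finally show "snd Q h \<cdot>\<^bsub>C\<^esub> f' = ar_map (\<phi> h) f' \<cdot>\<^bsub>C\<^esub> snd P h" ..
  next
    fix \<chi> assume \<chi>: "\<chi> \<in> carrier Gd"
    have "b \<chi> \<cdot>\<^bsub>C\<^esub> f' = Hom_sum C (fst P) (fst Q) (\<lambda>g. b \<chi> \<cdot>\<^bsub>C\<^esub> t g) (carrier G)"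
      unfolding f'_def using \<chi> by (intro C.Comp_Hom_sum_right) (auto simp: Hom_iff)
    also have "\<dots> = Hom_sum C (fst P) (fst Q) (\<lambda>g. t g \<cdot>\<^bsub>C\<^esub> a \<chi>) (carrier G)"
      using \<chi> by (intro C.Hom_sum_cong) (auto simp: Hom_iff bt)
    also have "\<dots> = f' \<cdot>\<^bsub>C\<^esub> a \<chi>"
      unfolding f'_def using \<chi> by (intro C.Comp_Hom_sum_left[symmetric]) (auto simp: Hom_iff)
    finally show "b \<chi> \<cdot>\<^bsub>C\<^esub> f' = f' \<cdot>\<^bsub>C\<^esub> a \<chi>" .
  qed
  moreover have "invariant_proj Q b \<cdot>\<^bsub>C\<^esub> f' = f"
  proof -
    \<comment> \<open>Naturality of the structure at the identity stands in for a unit of the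
      action.\<close>
    have "t \<one> = f"
      using action_one_natural[of P Q f] by (simp add: t_def)
    \<comment> \<open>Since the invariant projector of Q fixes f, its conjugate at g fixes
      \<open>t g\<close>, and this conjugate is orthogonal to the invariant projector.\<close>
    have zero: "invariant_proj Q b \<cdot>\<^bsub>C\<^esub> t g = hzero C (fst P) (fst Q)"
      if g: "g \<in> carrier G" "g \<noteq> \<one>" for g
    proof -
      have "(invariant_proj Q b \<cdot>\<^bsub>C\<^esub> (inverse_arrow C (snd Q g) \<cdot>\<^bsub>C\<^esub>
            (ar_map (\<phi> g) (invariant_proj Q b) \<cdot>\<^bsub>C\<^esub> snd Q g))) \<cdot>\<^bsub>C\<^esub> t g
          = invariant_proj Q b \<cdot>\<^bsub>C\<^esub> (inverse_arrow C (snd Q g) \<cdot>\<^bsub>C\<^esub>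
            (ar_map (\<phi> g) (invariant_proj Q b) \<cdot>\<^bsub>C\<^esub> (snd Q g \<cdot>\<^bsub>C\<^esub> t g)))"
        using g by simp
      also have "ar_map (\<phi> g) (invariant_proj Q b) \<cdot>\<^bsub>C\<^esub> (snd Q g \<cdot>\<^bsub>C\<^esub> t g)
          = ar_map (\<phi> g) (invariant_proj Q b \<cdot>\<^bsub>C\<^esub> f) \<cdot>\<^bsub>C\<^esub> snd P g"
        using g by (simp add: Qt)
      also have "inverse_arrow C (snd Q g) \<cdot>\<^bsub>C\<^esub> \<dots> = t g"
        unfolding pf t_def ..
      finally show ?thesis
        using g by (simp add: invariant_proj_conj_invariant_proj[OF Qb])
    qed
    have "invariant_proj Q b \<cdot>\<^bsub>C\<^esub> f'
        = Hom_sum C (fst P) (fst Q) (\<lambda>g. invariant_proj Q b \<cdot>\<^bsub>C\<^esub> t g) (carrier G)"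
      unfolding f'_def by (intro C.Comp_Hom_sum_right) (auto simp: Hom_iff)
    also have "\<dots> = invariant_proj Q b \<cdot>\<^bsub>C\<^esub> t \<one>"
      using zero by (intro C.Hom_sum_delta) (auto simp: Hom_iff)
    finally show ?thesis using \<open>t \<one> = f\<close> pf by simp
  qed
  ultimately show ?thesis using that by blast
qed

end


section \<open>Finite biproducts and induced objects\<close>

text \<open>Indexed families replace iterated binary biproducts because the summands of an induced
  object are indexed by G and get permuted by translation.\<close>

definition finite_biproduct ::
  "('k, 'o, 'm) lincat \<Rightarrow> 'i set \<Rightarrow> ('i \<Rightarrow> 'o) \<Rightarrow> 'o \<Rightarrow> ('i \<Rightarrow> 'm) \<Rightarrow> ('i \<Rightarrow> 'm) \<Rightarrow> bool" where
  "finite_biproduct C I Z S i p \<longleftrightarrow> finite I \<and> S \<in> Ob C \<and>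
     (\<forall>x \<in> I. i x \<in> Hom C (Z x) S \<and> p x \<in> Hom C S (Z x)) \<and>
     (\<forall>x \<in> I. \<forall>y \<in> I. p x \<cdot>\<^bsub>C\<^esub> i y = (if x = y then Ident C (Z x) else hzero C (Z y) (Z x))) \<and>
     Hom_sum C S S (\<lambda>x. i x \<cdot>\<^bsub>C\<^esub> p x) I = Ident C S"

context linear_category
begin

context
  fixes I :: "'i set" and Z S i p
  assumes bi: "finite_biproduct C I Z S i p"
begin

lemma finite_biproduct_simps [simp]:
  shows "S \<in> Ob C" "x \<in> I \<Longrightarrow> i x \<in> Ar C" "x \<in> I \<Longrightarrow> Dom C (i x) = Z x" "x \<in> I \<Longrightarrow> Cod C (i x) = S"
    "x \<in> I \<Longrightarrow> p x \<in> Ar C" "x \<in> I \<Longrightarrow> Dom C (p x) = S" "x \<in> I \<Longrightarrow> Cod C (p x) = Z x"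
  using bi by (auto simp: finite_biproduct_def Hom_iff)

text \<open>The identity of S is the sum of all i_x p_x, so an arrow into S is the sum of its
  components followed by the inclusions.\<close>

lemma finite_biproduct_ext:
  assumes "u \<in> Ar C" "v \<in> Ar C" "Dom C u = Dom C v" "Cod C u = S" "Cod C v = S"
    "\<And>x. x \<in> I \<Longrightarrow> p x \<cdot> u = p x \<cdot> v"
  shows "u = v"
proof -
  have I: "finite I" "Hom_sum C S S (\<lambda>x. i x \<cdot> p x) I = Ident C S"
    using bi by (auto simp: finite_biproduct_def)
  have expand: "w = Hom_sum C (Dom C w) S (\<lambda>x. i x \<cdot> (p x \<cdot> w)) I"
    if w: "w \<in> Ar C" "Cod C w = S" for w
  proof -
    have "w = Hom_sum C S S (\<lambda>x. i x \<cdot> p x) I \<cdot> w" using w I by simp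
    also have "\<dots> = Hom_sum C (Dom C w) S (\<lambda>x. i x \<cdot> p x \<cdot> w) I"
      using w I by (intro Comp_Hom_sum_left) (auto simp: Hom_iff)
    also have "\<dots> = Hom_sum C (Dom C w) S (\<lambda>x. i x \<cdot> (p x \<cdot> w)) I"
      using w by (intro Hom_sum_cong) (auto simp: Hom_iff)
    finally show ?thesis .
  qed
  have "Hom_sum C (Dom C u) S (\<lambda>x. i x \<cdot> (p x \<cdot> u)) I = Hom_sum C (Dom C v) S (\<lambda>x. i x \<cdot> (p x \<cdot> v)) I"
    using assms by (simp only: assms(3)) (intro Hom_sum_cong, auto simp: Hom_iff)
  then show ?thesis using expand[of u] expand[of v] assms by metis
qed

lemma finite_biproduct_arrow:
  assumes W: "W \<in> Ob C" and u: "\<And>x. x \<in> I \<Longrightarrow> u x \<in> Hom C W (Z x)"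
  shows "\<exists>w. w \<in> Ar C \<and> Dom C w = W \<and> Cod C w = S \<and> (\<forall>x \<in> I. p x \<cdot> w = u x)"
proof (intro exI conjI ballI)
  have I: "finite I" "\<And>x y. x \<in> I \<Longrightarrow> y \<in> I \<Longrightarrow>
      p x \<cdot> i y = (if x = y then Ident C (Z x) else hzero C (Z y) (Z x))"
    using bi by (auto simp: finite_biproduct_def)
  let ?w = "Hom_sum C W S (\<lambda>x. i x \<cdot> u x) I"
  have u' [simp]: "u x \<in> Ar C" "Dom C (u x) = W" "Cod C (u x) = Z x" "Z x \<in> Ob C" if "x \<in> I" for x
    using u[OF that] Cod_Ob[of "u x"] by (auto simp: Hom_iff)
  show "?w \<in> Ar C" "Dom C ?w = W" "Cod C ?w = S"
    using W by (auto simp: Hom_iff)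
  fix x assume x: "x \<in> I"
  have "p x \<cdot> ?w = Hom_sum C W (Z x) (\<lambda>y. p x \<cdot> (i y \<cdot> u y)) I"
    using x W I by (intro Comp_Hom_sum_right) (auto simp: Hom_iff)
  also have "\<dots> = Hom_sum C W (Z x) (\<lambda>y. (p x \<cdot> i y) \<cdot> u y) I"
    using x W by (intro Hom_sum_cong) (auto simp: Hom_iff)
  also have "\<dots> = (p x \<cdot> i x) \<cdot> u x"
    using x W I by (intro Hom_sum_delta) (auto simp: Hom_iff)
  also have "\<dots> = u x" using x I by simp
  finally show "p x \<cdot> ?w = u x" .
qed

end

end

text \<open>The defining equations involve only sums, composites, identities and zero arrows, all
  preserved by a linear functor. This permits reading arrows into \<phi>_h(S) by components.\<close>

lemma (in linear_functor) finite_biproduct_map: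
  assumes bi: "finite_biproduct A I Z S i p"
  shows "finite_biproduct B I (\<lambda>x. ob_map F (Z x)) (ob_map F S) (\<lambda>x. ar_map F (i x)) (\<lambda>x. ar_map F (p x))"
proof -
  note [simp] = A.finite_biproduct_simps[OF bi]
  have I: "finite I" "\<And>x y. x \<in> I \<Longrightarrow> y \<in> I \<Longrightarrow>
      p x \<cdot>\<^bsub>A\<^esub> i y = (if x = y then Ident A (Z x) else hzero A (Z y) (Z x))"
      "Hom_sum A S S (\<lambda>x. i x \<cdot>\<^bsub>A\<^esub> p x) I = Ident A S"
    using bi by (auto simp: finite_biproduct_def)
  have Z: "Z x \<in> Ob A" if "x \<in> I" for x
    using A.Dom_Ob[of "i x"] that by simp
  have comp: "ar_map F (p x) \<cdot>\<^bsub>B\<^esub> ar_map F (i y)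
      = (if x = y then Ident B (ob_map F (Z x)) else hzero B (ob_map F (Z y)) (ob_map F (Z x)))"
    if "x \<in> I" "y \<in> I" for x y
  proof -
    have "ar_map F (p x) \<cdot>\<^bsub>B\<^esub> ar_map F (i y) = ar_map F (p x \<cdot>\<^bsub>A\<^esub> i y)"
      using that by simp
    then show ?thesis using I(2)[OF that] that Z by simp
  qed
  have sum: "Hom_sum B (ob_map F S) (ob_map F S) (\<lambda>x. ar_map F (i x) \<cdot>\<^bsub>B\<^esub> ar_map F (p x)) I
      = Ident B (ob_map F S)"
  proof -
    have "Hom_sum B (ob_map F S) (ob_map F S) (\<lambda>x. ar_map F (i x) \<cdot>\<^bsub>B\<^esub> ar_map F (p x)) I
        = Hom_sum B (ob_map F S) (ob_map F S) (\<lambda>x. ar_map F (i x \<cdot>\<^bsub>A\<^esub> p x)) I"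
      by (intro B.Hom_sum_cong) (auto simp: Hom_iff)
    also have "\<dots> = ar_map F (Hom_sum A S S (\<lambda>x. i x \<cdot>\<^bsub>A\<^esub> p x) I)"
      using I by (intro ar_map_Hom_sum[symmetric]) (auto simp: Hom_iff)
    finally show ?thesis using I by simp
  qed
  show ?thesis
    unfolding finite_biproduct_def
    by (intro conjI ballI comp sum I(1)) (auto simp: Hom_iff)
qed

lemma (in additive_category) finite_biproduct_exists:
  assumes "finite I" "\<And>x. x \<in> I \<Longrightarrow> Z x \<in> Ob C"
  shows "\<exists>S i p. finite_biproduct C I Z S i p"
  using assms
proof (induction I rule: finite_induct)
  case empty
  obtain N where N: "is_zero_object C N" using has_zero_object by blast
  then have "N \<in> Ob C" "Ident C N = hzero C N N"
    using Ident_Hom hzero_Ar[of N N] unfolding is_zero_object_def by (auto simp: Hom_iff)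
  \<comment> \<open>Without indices the two families are never evaluated. What remains is that the
    empty sum is the identity, which characterises a zero object.\<close>
  then have "finite_biproduct C {} Z N undefined undefined"
    unfolding finite_biproduct_def using Hom_sum_empty[of N N] by (simp only:) blast
  then show ?case by blast
next
  case (insert x I)
  then obtain S i p where bi: "finite_biproduct C I Z S i p" by auto
  note [simp] = finite_biproduct_simps[OF bi]
  have I: "\<And>x y. x \<in> I \<Longrightarrow> y \<in> I \<Longrightarrow>
      p x \<cdot> i y = (if x = y then Ident C (Z x) else hzero C (Z y) (Z x))"
      "Hom_sum C S S (\<lambda>x. i x \<cdot> p x) I = Ident C S"
    using bi by (auto simp: finite_biproduct_def)
  obtain T i1 j p1 q where T: "is_biproduct C (Z x) S T i1 j p1 q"
    using has_biproducts[of "Z x" S] insert.prems by auto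
  then have [simp]: "T \<in> Ob C" "i1 \<in> Ar C" "Dom C i1 = Z x" "Cod C i1 = T"
      "j \<in> Ar C" "Dom C j = S" "Cod C j = T" "p1 \<in> Ar C" "Dom C p1 = T" "Cod C p1 = Z x"
      "q \<in> Ar C" "Dom C q = T" "Cod C q = S"
    and T_eq: "p1 \<cdot> i1 = Ident C (Z x)" "q \<cdot> j = Ident C S" "p1 \<cdot> j = hzero C S (Z x)"
      "q \<cdot> i1 = hzero C (Z x) S" "hsum C (i1 \<cdot> p1) (j \<cdot> q) = Ident C T"
    by (auto simp: is_biproduct_def Hom_iff)
  have Z [simp]: "Z x \<in> Ob C" "\<And>y. y \<in> I \<Longrightarrow> Z y \<in> Ob C" using insert.prems by auto
  define i' where "i' y = (if y = x then i1 else j \<cdot> i y)" for y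
  define p' where "p' y = (if y = x then p1 else p y \<cdot> q)" for y
  have ip [simp]: "i' y \<in> Ar C" "Dom C (i' y) = Z y" "Cod C (i' y) = T"
      "p' y \<in> Ar C" "Dom C (p' y) = T" "Cod C (p' y) = Z y" if "y \<in> insert x I" for y
    using that by (auto simp: i'_def p'_def)
  have comp: "p' y \<cdot> i' z = (if y = z then Ident C (Z y) else hzero C (Z z) (Z y))"
    if yz: "y \<in> insert x I" "z \<in> insert x I" for y z
  proof -
    have 1: "p1 \<cdot> (j \<cdot> i z) = hzero C (Z z) (Z x)" if "z \<in> I" for z
      using Comp_assoc_Ar[of "i z" j p1] that by (simp add: T_eq del: Comp_assoc_Ar)
    have 2: "(p y \<cdot> q) \<cdot> i1 = hzero C (Z x) (Z y)" if "y \<in> I" for y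
      using that T_eq by simp
    have 3: "q \<cdot> (j \<cdot> i z) = i z" if "z \<in> I" for z
      using Comp_assoc_Ar[of "i z" j q] that by (simp add: T_eq del: Comp_assoc_Ar)
    show ?thesis
      using yz insert.hyps 1 2 3 I(1) T_eq by (auto simp: i'_def p'_def)
  qed
  have "Hom_sum C T T (\<lambda>y. i' y \<cdot> p' y) (insert x I)
      = hsum C (i' x \<cdot> p' x) (Hom_sum C T T (\<lambda>y. i' y \<cdot> p' y) I)"
    using insert.hyps by (intro Hom_sum_insert) (auto simp: Hom_iff)
  also have "Hom_sum C T T (\<lambda>y. i' y \<cdot> p' y) I = Hom_sum C T T (\<lambda>y. j \<cdot> (i y \<cdot> p y) \<cdot> q) I"
    using insert.hyps by (intro Hom_sum_cong) (auto simp: Hom_iff i'_def p'_def)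
  also have "\<dots> = Hom_sum C S T (\<lambda>y. j \<cdot> (i y \<cdot> p y)) I \<cdot> q"
    using insert.hyps by (intro Comp_Hom_sum_left[symmetric]) (auto simp: Hom_iff)
  also have "Hom_sum C S T (\<lambda>y. j \<cdot> (i y \<cdot> p y)) I = j \<cdot> Hom_sum C S S (\<lambda>y. i y \<cdot> p y) I"
    using insert.hyps by (intro Comp_Hom_sum_right[symmetric]) (auto simp: Hom_iff)
  also have "\<dots> = j" using I by simp
  also have "hsum C (i' x \<cdot> p' x) (j \<cdot> q) = Ident C T"
    using T_eq by (simp add: i'_def p'_def)
  finally have "finite_biproduct C (insert x I) Z T i' p'"
    unfolding finite_biproduct_def using insert.hyps comp by (auto simp: Hom_iff)
  then show ?case by blast
qed

context dual_action
begin

text \<open>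
  The induced object is the sum of all \<open>\<phi>\<^sub>g(Z)\<close>; its equivariant structure permutes the summands
  and \<open>\<chi>\<close> acts on the summand of \<open>g\<close> by \<open>\<chi>(g)\<inverse>\<close>, so that the invariant part is \<open>\<phi>\<^sub>1(Z)\<close>.
\<close>

lemma induced_object:
  assumes additive: "additive_category C" and Z: "Z \<in> Ob C"
  obtains P a i s where "dual_equivariant P a"
    "i \<in> Hom C (ob_map (\<phi> \<one>) Z) (fst P)" "s \<in> Hom C (fst P) (ob_map (\<phi> \<one>) Z)"
    "s \<cdot>\<^bsub>C\<^esub> i = Ident C (ob_map (\<phi> \<one>) Z)" "i \<cdot>\<^bsub>C\<^esub> s = invariant_proj P a"
proof -
  interpret additive_category C by fact
  note [simp] = Z
  obtain S i p where bi: "finite_biproduct C (carrier G) (\<lambda>g. ob_map (\<phi> g) Z) S i p"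
    using finite_biproduct_exists[of "carrier G" "\<lambda>g. ob_map (\<phi> g) Z"] by auto
  note bi_simps [simp] = C.finite_biproduct_simps[OF bi]
  note S_ext = C.finite_biproduct_ext[OF bi]
  \<comment> \<open>\<phi>_h(S) is again a biproduct, so arrows into it are compared after the
    projections \<phi>_h(p_g).\<close>
  have \<phi>S_ext: "u = v" if "h \<in> carrier G" "u \<in> Ar C" "v \<in> Ar C" "Dom C u = Dom C v"
      "Cod C u = ob_map (\<phi> h) S" "Cod C v = ob_map (\<phi> h) S"
      "\<And>g. g \<in> carrier G \<Longrightarrow> ar_map (\<phi> h) (p g) \<cdot>\<^bsub>C\<^esub> u = ar_map (\<phi> h) (p g) \<cdot>\<^bsub>C\<^esub> v" for h u v
    using C.finite_biproduct_ext[OF linear_functor.finite_biproduct_map[OF linear_functor_\<phi>[OF that(1)] bi]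
        that(2-)] .
  \<comment> \<open>The summand of \<phi>_h(S) at g is \<phi>_h(\<phi>_g(Z)), which
    \<open>\<epsilon> h g Z\<close> identifies with the summand of S at g h. This prescribes the
    components of the structure map \<alpha>_h.\<close>
  have "\<forall>h \<in> carrier G. \<exists>w. w \<in> Ar C \<and> Dom C w = S \<and> Cod C w = ob_map (\<phi> h) S \<and>
      (\<forall>g \<in> carrier G. ar_map (\<phi> h) (p g) \<cdot>\<^bsub>C\<^esub> w = inverse_arrow C (\<epsilon> h g Z) \<cdot>\<^bsub>C\<^esub> p (g \<otimes> h))"
    by (intro ballI C.finite_biproduct_arrow[OF linear_functor.finite_biproduct_map[OF linear_functor_\<phi> bi]])
      (auto simp: Hom_iff)
  from bchoice[OF this] obtain \<alpha> where \<alpha>': "\<forall>h \<in> carrier G.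
      \<alpha> h \<in> Ar C \<and> Dom C (\<alpha> h) = S \<and> Cod C (\<alpha> h) = ob_map (\<phi> h) S \<and>
      (\<forall>g \<in> carrier G. ar_map (\<phi> h) (p g) \<cdot>\<^bsub>C\<^esub> \<alpha> h = inverse_arrow C (\<epsilon> h g Z) \<cdot>\<^bsub>C\<^esub> p (g \<otimes> h))" ..
  then have \<alpha> [simp]: "\<And>h. h \<in> carrier G \<Longrightarrow> \<alpha> h \<in> Ar C" "\<And>h. h \<in> carrier G \<Longrightarrow> Dom C (\<alpha> h) = S"
      "\<And>h. h \<in> carrier G \<Longrightarrow> Cod C (\<alpha> h) = ob_map (\<phi> h) S"
    and p\<alpha>: "\<And>h g. h \<in> carrier G \<Longrightarrow> g \<in> carrier G \<Longrightarrow>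
      ar_map (\<phi> h) (p g) \<cdot>\<^bsub>C\<^esub> \<alpha> h = inverse_arrow C (\<epsilon> h g Z) \<cdot>\<^bsub>C\<^esub> p (g \<otimes> h)"
    by blast+
  have p\<alpha>': "ar_map (\<phi> h) (p g) \<cdot>\<^bsub>C\<^esub> (\<alpha> h \<cdot>\<^bsub>C\<^esub> w) = inverse_arrow C (\<epsilon> h g Z) \<cdot>\<^bsub>C\<^esub> (p (g \<otimes> h) \<cdot>\<^bsub>C\<^esub> w)"
    if "h \<in> carrier G" "g \<in> carrier G" "w \<in> Ar C" "Cod C w = S" for h g w
  proof -
    have "(ar_map (\<phi> h) (p g) \<cdot>\<^bsub>C\<^esub> \<alpha> h) \<cdot>\<^bsub>C\<^esub> w = (inverse_arrow C (\<epsilon> h g Z) \<cdot>\<^bsub>C\<^esub> p (g \<otimes> h)) \<cdot>\<^bsub>C\<^esub> w"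
      using p\<alpha>[OF that(1,2)] by (rule arg_cong)
    then show ?thesis using that by simp
  qed
  have \<alpha>_isos [simp]: "\<alpha> h \<in> isos C" if h: "h \<in> carrier G" for h
  proof -
    \<comment> \<open>The inverse uses the same identification backwards: the summand of S at k
      corresponds to g = k h^-1.\<close>
    have "\<exists>w. w \<in> Ar C \<and> Dom C w = ob_map (\<phi> h) S \<and> Cod C w = S \<and> (\<forall>k \<in> carrier G.
        p k \<cdot>\<^bsub>C\<^esub> w = \<epsilon> h (k \<otimes> inv h) Z \<cdot>\<^bsub>C\<^esub> ar_map (\<phi> h) (p (k \<otimes> inv h)))"
      using h by (intro C.finite_biproduct_arrow[OF bi]) (auto simp: Hom_iff m_assoc)
    then obtain \<beta> where \<beta> [simp]: "\<beta> \<in> Ar C" "Dom C \<beta> = ob_map (\<phi> h) S" "Cod C \<beta> = S"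
      and p\<beta>: "\<And>k. k \<in> carrier G \<Longrightarrow>
        p k \<cdot>\<^bsub>C\<^esub> \<beta> = \<epsilon> h (k \<otimes> inv h) Z \<cdot>\<^bsub>C\<^esub> ar_map (\<phi> h) (p (k \<otimes> inv h))"
      by blast
    have p\<beta>': "p k \<cdot>\<^bsub>C\<^esub> (\<beta> \<cdot>\<^bsub>C\<^esub> w) = \<epsilon> h (k \<otimes> inv h) Z \<cdot>\<^bsub>C\<^esub> (ar_map (\<phi> h) (p (k \<otimes> inv h)) \<cdot>\<^bsub>C\<^esub> w)"
      if "k \<in> carrier G" "w \<in> Ar C" "Cod C w = ob_map (\<phi> h) S" for k w
    proof -
      have "(p k \<cdot>\<^bsub>C\<^esub> \<beta>) \<cdot>\<^bsub>C\<^esub> w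
          = (\<epsilon> h (k \<otimes> inv h) Z \<cdot>\<^bsub>C\<^esub> ar_map (\<phi> h) (p (k \<otimes> inv h))) \<cdot>\<^bsub>C\<^esub> w"
        using p\<beta>[OF that(1)] by (rule arg_cong)
      then show ?thesis using that h by simp
    qed
    have "\<beta> \<cdot>\<^bsub>C\<^esub> \<alpha> h = Ident C S"
      by (rule S_ext) (use h in \<open>auto simp: p\<beta>' p\<alpha> m_assoc\<close>)
    moreover have "\<alpha> h \<cdot>\<^bsub>C\<^esub> \<beta> = Ident C (ob_map (\<phi> h) S)"
      by (rule \<phi>S_ext[OF h]) (use h in \<open>auto simp: p\<alpha>' p\<beta> m_assoc\<close>)
    ultimately show ?thesis using h by (intro C.isosI[of _ \<beta>]) auto
  qed
  have \<alpha>_cocycle: "\<alpha> (h \<otimes> g) = \<epsilon> g h S \<cdot>\<^bsub>C\<^esub> (ar_map (\<phi> g) (\<alpha> h) \<cdot>\<^bsub>C\<^esub> \<alpha> g)"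
    if gh: "g \<in> carrier G" "h \<in> carrier G" for g h
  proof (rule \<phi>S_ext[of "h \<otimes> g"])
    fix u assume u: "u \<in> carrier G"
    have "ar_map (\<phi> (h \<otimes> g)) (p u) \<cdot>\<^bsub>C\<^esub> (\<epsilon> g h S \<cdot>\<^bsub>C\<^esub> (ar_map (\<phi> g) (\<alpha> h) \<cdot>\<^bsub>C\<^esub> \<alpha> g))
        = (ar_map (\<phi> (h \<otimes> g)) (p u) \<cdot>\<^bsub>C\<^esub> \<epsilon> g h (Dom C (p u))) \<cdot>\<^bsub>C\<^esub> (ar_map (\<phi> g) (\<alpha> h) \<cdot>\<^bsub>C\<^esub> \<alpha> g)"
      using gh u by simp
    also have "\<dots> = \<epsilon> g h (ob_map (\<phi> u) Z) \<cdot>\<^bsub>C\<^esub>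
        (ar_map (\<phi> g) (ar_map (\<phi> h) (p u) \<cdot>\<^bsub>C\<^esub> \<alpha> h) \<cdot>\<^bsub>C\<^esub> \<alpha> g)"
      using gh u by (subst \<epsilon>_natural[symmetric]) simp_all
    also have "\<dots> = \<epsilon> g h (ob_map (\<phi> u) Z) \<cdot>\<^bsub>C\<^esub> (inverse_arrow C (ar_map (\<phi> g) (\<epsilon> h u Z)) \<cdot>\<^bsub>C\<^esub>
        (inverse_arrow C (\<epsilon> g (u \<otimes> h) Z) \<cdot>\<^bsub>C\<^esub> p (u \<otimes> h \<otimes> g)))"
      using gh u by (simp add: p\<alpha>)
    finally have lhs: "ar_map (\<phi> (h \<otimes> g)) (p u) \<cdot>\<^bsub>C\<^esub> (\<epsilon> g h S \<cdot>\<^bsub>C\<^esub> (ar_map (\<phi> g) (\<alpha> h) \<cdot>\<^bsub>C\<^esub> \<alpha> g)) = \<dots>" .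
    \<comment> \<open>Composition with this isomorphism turns the claim into the cocycle condition
      of the action at (g, h, u), whose two factors cancel the inverses.\<close>
    have "\<epsilon> (h \<otimes> g) u Z \<cdot>\<^bsub>C\<^esub> (\<epsilon> g h (ob_map (\<phi> u) Z) \<cdot>\<^bsub>C\<^esub> (inverse_arrow C (ar_map (\<phi> g) (\<epsilon> h u Z)) \<cdot>\<^bsub>C\<^esub>
        (inverse_arrow C (\<epsilon> g (u \<otimes> h) Z) \<cdot>\<^bsub>C\<^esub> p (u \<otimes> h \<otimes> g))))
      = (\<epsilon> (h \<otimes> g) u Z \<cdot>\<^bsub>C\<^esub> \<epsilon> g h (ob_map (\<phi> u) Z)) \<cdot>\<^bsub>C\<^esub> (inverse_arrow C (ar_map (\<phi> g) (\<epsilon> h u Z)) \<cdot>\<^bsub>C\<^esub>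
        (inverse_arrow C (\<epsilon> g (u \<otimes> h) Z) \<cdot>\<^bsub>C\<^esub> p (u \<otimes> h \<otimes> g)))"
      using gh u by (simp add: m_assoc)
    also have "\<dots> = p (u \<otimes> h \<otimes> g)"
      using gh u by (subst cocycle[symmetric]) (simp_all add: m_assoc)
    also have "\<dots> = \<epsilon> (h \<otimes> g) u Z \<cdot>\<^bsub>C\<^esub> (ar_map (\<phi> (h \<otimes> g)) (p u) \<cdot>\<^bsub>C\<^esub> \<alpha> (h \<otimes> g))"
      using gh u by (simp add: p\<alpha> m_assoc)
    finally have eq: "\<epsilon> (h \<otimes> g) u Z \<cdot>\<^bsub>C\<^esub> (\<epsilon> g h (ob_map (\<phi> u) Z) \<cdot>\<^bsub>C\<^esub>
        (inverse_arrow C (ar_map (\<phi> g) (\<epsilon> h u Z)) \<cdot>\<^bsub>C\<^esub>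
        (inverse_arrow C (\<epsilon> g (u \<otimes> h) Z) \<cdot>\<^bsub>C\<^esub> p (u \<otimes> h \<otimes> g)))) = \<dots>" .
    show "ar_map (\<phi> (h \<otimes> g)) (p u) \<cdot>\<^bsub>C\<^esub> \<alpha> (h \<otimes> g)
        = ar_map (\<phi> (h \<otimes> g)) (p u) \<cdot>\<^bsub>C\<^esub> (\<epsilon> g h S \<cdot>\<^bsub>C\<^esub> (ar_map (\<phi> g) (\<alpha> h) \<cdot>\<^bsub>C\<^esub> \<alpha> g))"
      unfolding lhs
      by (rule C.isos_cancel_left[OF _ _ _ _ _ eq[symmetric]])
        (use gh u in \<open>auto simp: m_assoc\<close>)
  qed (use gh in auto)
  have "\<forall>\<chi> \<in> carrier Gd. \<exists>w. w \<in> Ar C \<and> Dom C w = S \<and> Cod C w = S \<and>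
      (\<forall>g \<in> carrier G. p g \<cdot>\<^bsub>C\<^esub> w = hscale C (inverse (\<chi> g)) (p g))"
    by (intro ballI C.finite_biproduct_arrow[OF bi]) (auto simp: Hom_iff)
  from bchoice[OF this] obtain a where a': "\<forall>\<chi> \<in> carrier Gd.
      a \<chi> \<in> Ar C \<and> Dom C (a \<chi>) = S \<and> Cod C (a \<chi>) = S \<and>
      (\<forall>g \<in> carrier G. p g \<cdot>\<^bsub>C\<^esub> a \<chi> = hscale C (inverse (\<chi> g)) (p g))" ..
  then have a [simp]: "\<And>\<chi>. \<chi> \<in> carrier Gd \<Longrightarrow> a \<chi> \<in> Ar C" "\<And>\<chi>. \<chi> \<in> carrier Gd \<Longrightarrow> Dom C (a \<chi>) = S"
      "\<And>\<chi>. \<chi> \<in> carrier Gd \<Longrightarrow> Cod C (a \<chi>) = S"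
    and pa: "\<And>\<chi> g. \<chi> \<in> carrier Gd \<Longrightarrow> g \<in> carrier G \<Longrightarrow> p g \<cdot>\<^bsub>C\<^esub> a \<chi> = hscale C (inverse (\<chi> g)) (p g)"
    by blast+
  have pa': "p g \<cdot>\<^bsub>C\<^esub> (a \<chi> \<cdot>\<^bsub>C\<^esub> w) = hscale C (inverse (\<chi> g)) (p g \<cdot>\<^bsub>C\<^esub> w)"
    if "\<chi> \<in> carrier Gd" "g \<in> carrier G" "w \<in> Ar C" "Cod C w = S" for \<chi> g w
  proof -
    have "(p g \<cdot>\<^bsub>C\<^esub> a \<chi>) \<cdot>\<^bsub>C\<^esub> w = hscale C (inverse (\<chi> g)) (p g) \<cdot>\<^bsub>C\<^esub> w"
      using pa[OF that(1,2)] by (rule arg_cong)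
    then show ?thesis using that by simp
  qed
  have a_mult: "a (\<psi> \<otimes>\<^bsub>Gd\<^esub> \<chi>) = a \<psi> \<cdot>\<^bsub>C\<^esub> a \<chi>" if "\<chi> \<in> carrier Gd" "\<psi> \<in> carrier Gd" for \<chi> \<psi>
    by (rule S_ext) (use that in \<open>auto simp: pa' pa mult.commute\<close>)
  have a_isos: "a \<chi> \<in> isos C" if \<chi>: "\<chi> \<in> carrier Gd" for \<chi>
  proof -
    have "a (inv\<^bsub>Gd\<^esub> \<chi>) \<cdot>\<^bsub>C\<^esub> a \<chi> = Ident C S" "a \<chi> \<cdot>\<^bsub>C\<^esub> a (inv\<^bsub>Gd\<^esub> \<chi>) = Ident C S"
      by (rule S_ext; use \<chi> in \<open>auto simp: pa' pa dual_inv_apply\<close>)+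
    then show ?thesis
      using \<chi> by (intro C.isosI[of _ "a (inv\<^bsub>Gd\<^esub> \<chi>)"]) auto
  qed
  \<comment> \<open>On the component at g both sides carry \<chi>(h) \<chi>(g h)^-1 = \<chi>(g)^-1;
    this is the reason for letting \<chi> act through inverses.\<close>
  have a_twist: "hscale C (\<chi> h) (\<alpha> h \<cdot>\<^bsub>C\<^esub> a \<chi>) = ar_map (\<phi> h) (a \<chi>) \<cdot>\<^bsub>C\<^esub> \<alpha> h"
    if \<chi>: "\<chi> \<in> carrier Gd" and h: "h \<in> carrier G" for \<chi> h
  proof (rule \<phi>S_ext[OF h])
    fix g assume g: "g \<in> carrier G"
    have "ar_map (\<phi> h) (p g) \<cdot>\<^bsub>C\<^esub> (ar_map (\<phi> h) (a \<chi>) \<cdot>\<^bsub>C\<^esub> \<alpha> h) = ar_map (\<phi> h) (p g \<cdot>\<^bsub>C\<^esub> a \<chi>) \<cdot>\<^bsub>C\<^esub> \<alpha> h"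
      using \<chi> h g by simp
    then show "ar_map (\<phi> h) (p g) \<cdot>\<^bsub>C\<^esub> hscale C (\<chi> h) (\<alpha> h \<cdot>\<^bsub>C\<^esub> a \<chi>)
        = ar_map (\<phi> h) (p g) \<cdot>\<^bsub>C\<^esub> (ar_map (\<phi> h) (a \<chi>) \<cdot>\<^bsub>C\<^esub> \<alpha> h)"
      using \<chi> h g by (simp add: pa p\<alpha> p\<alpha>' field_simps)
  qed (use \<chi> h in auto)
  define P where "P = (S, \<lambda>h \<in> carrier G. \<alpha> h)"
  have "P \<in> Ob D"
    unfolding P_def by (rule Ob_DI) (auto simp: \<alpha>_cocycle)
  then have Pa: "dual_equivariant P a"
    unfolding dual_equivariant_def using a_mult a_isos a_twist by (auto simp: P_def)
  \<comment> \<open>The average of \<chi>(g)^-1 = \<chi>(g^-1) over all \<chi> is 1 at g = 1 and 0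
    elsewhere, so the projector keeps exactly the summand at the identity.\<close>
  have "i \<one> \<cdot>\<^bsub>C\<^esub> p \<one> = invariant_proj P a"
  proof (rule S_ext)
    fix g assume g: "g \<in> carrier G"
    have "p g \<cdot>\<^bsub>C\<^esub> Hom_sum C S S a (carrier Gd)
        = Hom_sum C S (ob_map (\<phi> g) Z) (\<lambda>\<chi>. p g \<cdot>\<^bsub>C\<^esub> a \<chi>) (carrier Gd)"
      using g by (intro C.Comp_Hom_sum_right) (auto simp: Hom_iff)
    also have "\<dots> = Hom_sum C S (ob_map (\<phi> g) Z) (\<lambda>\<chi>. hscale C (\<chi> (inv g)) (p g)) (carrier Gd)"
      using g by (intro C.Hom_sum_cong) (auto simp: Hom_iff pa character_inv)
    also have "\<dots> = hscale C (\<Sum>\<chi> \<in> carrier Gd. \<chi> (inv g)) (p g)"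
      using g by (intro C.Hom_sum_scalars) (auto simp: Hom_iff)
    finally have "p g \<cdot>\<^bsub>C\<^esub> invariant_proj P a
        = hscale C (1 / of_nat (card (carrier G)) * (\<Sum>\<chi> \<in> carrier Gd. \<chi> (inv g))) (p g)"
      using g by (simp add: invariant_proj_def P_def Hom_iff)
    also have "\<dots> = (if g = \<one> then p \<one> else hzero C S (ob_map (\<phi> g) Z))"
      using g sum_characters_apply[of "inv g"] by (auto simp: card_dual)
    finally have *: "p g \<cdot>\<^bsub>C\<^esub> invariant_proj P a = \<dots>" .
    have "p g \<cdot>\<^bsub>C\<^esub> i \<one> = (if g = \<one> then Ident C (ob_map (\<phi> \<one>) Z) else hzero C (ob_map (\<phi> \<one>) Z) (ob_map (\<phi> g) Z))"
      using bi g unfolding finite_biproduct_def by auto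
    then have "(p g \<cdot>\<^bsub>C\<^esub> i \<one>) \<cdot>\<^bsub>C\<^esub> p \<one> = (if g = \<one> then p \<one> else hzero C S (ob_map (\<phi> g) Z))"
      using g by simp
    then show "p g \<cdot>\<^bsub>C\<^esub> (i \<one> \<cdot>\<^bsub>C\<^esub> p \<one>) = p g \<cdot>\<^bsub>C\<^esub> invariant_proj P a"
      using * g by simp
  qed (use invariant_proj_Ar[OF Pa] in \<open>auto simp: P_def\<close>)
  moreover have "p \<one> \<cdot>\<^bsub>C\<^esub> i \<one> = Ident C (ob_map (\<phi> \<one>) Z)"
    using bi unfolding finite_biproduct_def by auto
  ultimately show ?thesis
    using that[OF Pa, of "i \<one>" "p \<one>"] by (simp add: Hom_iff P_def)
qed

end


section \<open>The dual action\<close>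

context dual_action
begin

text \<open>Restriction to the carrier keeps the family extensional; this makes the laws of the
  twists equalities instead of isomorphisms.\<close>

definition twist_ob :: "('g \<Rightarrow> 'k) \<Rightarrow> 'o \<times> ('g \<Rightarrow> 'm) \<Rightarrow> 'o \<times> ('g \<Rightarrow> 'm)" where
  "twist_ob \<chi> P = (fst P, \<lambda>g \<in> carrier G. hscale C (\<chi> g) (snd P g))"

definition twist :: "('g \<Rightarrow> 'k) \<Rightarrow> ('o \<times> ('g \<Rightarrow> 'm), ('o \<times> ('g \<Rightarrow> 'm)) \<times> ('o \<times> ('g \<Rightarrow> 'm)) \<times> 'm,
    'o \<times> ('g \<Rightarrow> 'm), ('o \<times> ('g \<Rightarrow> 'm)) \<times> ('o \<times> ('g \<Rightarrow> 'm)) \<times> 'm) functr" where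
  "twist \<chi> = \<lparr>ob_map = twist_ob \<chi>, ar_map = (\<lambda>u. (twist_ob \<chi> (fst u), twist_ob \<chi> (fst (snd u)), arr u))\<rparr>"

lemma twist_apply [simp]:
  "fst (ob_map (twist \<chi>) P) = fst P"
  "g \<in> carrier G \<Longrightarrow> snd (ob_map (twist \<chi>) P) g = hscale C (\<chi> g) (snd P g)"
  "arr (ar_map (twist \<chi>) u) = arr u"
  by (auto simp: twist_def twist_ob_def)

lemma twist_Dom_Cod:
  "Dom D (ar_map (twist \<chi>) u) = ob_map (twist \<chi>) (Dom D u)"
  "Cod D (ar_map (twist \<chi>) u) = ob_map (twist \<chi>) (Cod D u)"
  by (auto simp: twist_def D_simps)

lemma twist_Ob:
  assumes "\<chi> \<in> carrier Gd" "P \<in> Ob D"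
  shows "ob_map (twist \<chi>) P \<in> Ob D"
proof -
  have "(fst P, \<lambda>g \<in> carrier G. hscale C (\<chi> g) (snd P g)) \<in> Ob D"
    by (rule Ob_DI) (use assms in \<open>auto simp: Ob_D_cocycle mult.commute\<close>)
  then show ?thesis by (simp add: twist_def twist_ob_def)
qed

lemma twist_Ar:
  assumes "\<chi> \<in> carrier Gd" "u \<in> Ar D"
  shows "ar_map (twist \<chi>) u \<in> Ar D"
proof -
  have "(ob_map (twist \<chi>) (Dom D u), ob_map (twist \<chi>) (Cod D u), arr u) \<in> Ar D"
    using assms arr_equivariant[OF assms(2)] by (intro Ar_D_exists) (auto simp: twist_Ob)
  then show ?thesis by (simp add: twist_def D_simps)
qed

lemma linear_functor_twist: "\<chi> \<in> carrier Gd \<Longrightarrow> linear_functor D D (twist \<chi>)"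
  by unfold_locales
    (auto simp: Hom_iff twist_Ob twist_Ar twist_Dom_Cod intro!: arr_eqI)

lemmas twist_simps [simp] =
  linear_functor.ob_map_in_Ob[OF linear_functor_twist] linear_functor.ar_map_Ar[OF linear_functor_twist]
  linear_functor.ar_map_Ident_Comp[OF linear_functor_twist] linear_functor.ar_map_isos[OF linear_functor_twist]

lemma twist_twist:
  assumes "\<chi> \<in> carrier Gd" "\<psi> \<in> carrier Gd"
  shows "P \<in> Ob D \<Longrightarrow> ob_map (twist \<chi>) (ob_map (twist \<psi>) P) = ob_map (twist (\<psi> \<otimes>\<^bsub>Gd\<^esub> \<chi>)) P"
    and "u \<in> Ar D \<Longrightarrow> ar_map (twist \<chi>) (ar_map (twist \<psi>) u) = ar_map (twist (\<psi> \<otimes>\<^bsub>Gd\<^esub> \<chi>)) u"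
proof -
  show *: "ob_map (twist \<chi>) (ob_map (twist \<psi>) P) = ob_map (twist (\<psi> \<otimes>\<^bsub>Gd\<^esub> \<chi>)) P" if "P \<in> Ob D" for P
    using that assms by (auto simp: twist_def twist_ob_def mult.commute intro!: restrict_ext)
  show "ar_map (twist \<chi>) (ar_map (twist \<psi>) u) = ar_map (twist (\<psi> \<otimes>\<^bsub>Gd\<^esub> \<chi>)) u" if "u \<in> Ar D"
    by (rule arr_eqI) (use that assms in \<open>auto simp: *\<close>)
qed

lemma twist_one:
  assumes "P \<in> Ob D"
  shows "ob_map (twist \<one>\<^bsub>Gd\<^esub>) P = P"
proof -
  have "snd P \<in> extensional (carrier G)" using assms unfolding Ob_D_iff by blast
  then have "(\<lambda>g \<in> carrier G. hscale C (\<one>\<^bsub>Gd\<^esub> g) (snd P g)) = snd P"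
    using assms by (auto intro!: extensionalityI[of _ "carrier G"])
  then show ?thesis by (simp add: twist_def twist_ob_def)
qed

lemma twist_one_Ar: "u \<in> Ar D \<Longrightarrow> ar_map (twist \<one>\<^bsub>Gd\<^esub>) u = u"
  by (rule arr_eqI) (auto simp: twist_one)

text \<open>The twist by the inverse character is a strict inverse on objects and on arrows.\<close>

lemma linear_equivalence_twist:
  assumes \<chi>: "\<chi> \<in> carrier Gd"
  shows "linear_equivalence D D (twist \<chi>)"
proof (rule linear_equivalenceI)
  let ?\<psi> = "inv\<^bsub>Gd\<^esub> \<chi>"
  have inv: "ar_map (twist ?\<psi>) (ar_map (twist \<chi>) u) = u" "ar_map (twist \<chi>) (ar_map (twist ?\<psi>) u) = u"
    if "u \<in> Ar D" for u
    using that \<chi> by (simp_all add: twist_twist twist_one_Ar)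
  have inv_ob: "ob_map (twist ?\<psi>) (ob_map (twist \<chi>) P) = P" "ob_map (twist \<chi>) (ob_map (twist ?\<psi>) P) = P"
    if "P \<in> Ob D" for P
    using that \<chi> by (simp_all add: twist_twist twist_one)
  show "linear_functor D D (twist \<chi>)" using \<chi> by (rule linear_functor_twist)
  then show "fully_faithful D D (twist \<chi>)"
  proof (rule fully_faithfulI)
    fix u v assume "u \<in> Ar D" "v \<in> Ar D" "ar_map (twist \<chi>) u = ar_map (twist \<chi>) v"
    then show "u = v" using inv(1) by metis
  next
    fix P Q v assume PQ: "P \<in> Ob D" "Q \<in> Ob D"
      and v: "v \<in> Hom D (ob_map (twist \<chi>) P) (ob_map (twist \<chi>) Q)"
    then show "\<exists>u \<in> Hom D P Q. ar_map (twist \<chi>) u = v"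
      using \<chi> by (intro bexI[of _ "ar_map (twist ?\<psi>) v"]) (auto simp: Hom_iff inv inv_ob)
  qed
  show "essentially_surjective D D (twist \<chi>)"
    unfolding essentially_surjective_def
  proof
    fix P assume P: "P \<in> Ob D"
    then show "\<exists>Q \<in> Ob D. \<exists>f \<in> isos D. Dom D f = ob_map (twist \<chi>) Q \<and> Cod D f = P"
      using \<chi> by (intro bexI[of _ "ob_map (twist ?\<psi>) P"] bexI[of _ "Ident D P"]) (auto simp: inv_ob)
  qed
qed

end

text \<open>The natural isomorphisms are parameters, since the counit \<open>\<eta>'\<close> enters
  the definition of the transported action and must be one fixed choice.\<close>

locale dual_equivalence = dual_action G field_type C \<phi> \<epsilon> + B: linear_category B +
    F: linear_functor B "equivariant_category G C \<phi> \<epsilon>" F +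
    F': linear_functor "equivariant_category G C \<phi> \<epsilon>" B F' +
    \<eta>: natural_isomorphism B B "comp_functr F' F" id_functr \<eta> +
    \<eta>': natural_isomorphism "equivariant_category G C \<phi> \<epsilon>" "equivariant_category G C \<phi> \<epsilon>"
      "comp_functr F F'" id_functr \<eta>'
  for G :: "'g monoid" (structure)
    and field_type :: "'k::alg_closed_field itself"
    and C :: "('k, 'o, 'm) lincat"
    and \<phi> :: "'g \<Rightarrow> ('o, 'm, 'o, 'm) functr"
    and \<epsilon> :: "'g \<Rightarrow> 'g \<Rightarrow> 'o \<Rightarrow> 'm"
    and B :: "('k, 'p, 'n) lincat"
    and F F' \<eta> \<eta>'
begin

section \<open>Transport of the twists along the equivalence\<close>

lemmas \<eta>'_simps [simp] = \<eta>'.component[unfolded comp_functr_simps id_functr_simps]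
  \<eta>'.component_Ar
lemmas \<eta>'_natural = \<eta>'.naturality_Ar[unfolded comp_functr_simps id_functr_simps]

lemma linear_equivalence_F: "linear_equivalence B D F" and linear_equivalence_F': "linear_equivalence D B F'"
  unfolding linear_equivalence_def
  using F.linear_functor_axioms F'.linear_functor_axioms \<eta>.natural_isomorphism_axioms
    \<eta>'.natural_isomorphism_axioms by blast+

definition dual_functor where
  "dual_functor \<chi> = comp_functr F' (comp_functr (twist \<chi>) F)"

text \<open>A composite of two transported functors contains \<open>F\<close> after
  \<open>F'\<close> in the middle. The counit removes this pair, and strictness of the twists makes
  the target the functor of the product.\<close>

definition dual_comparison where
  "dual_comparison \<chi> \<psi> Y = ar_map F' (ar_map (twist \<chi>) (\<eta>' (ob_map (twist \<psi>) (ob_map F Y))))"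

lemma dual_functor_simps [simp]:
  "ob_map (dual_functor \<chi>) Y = ob_map F' (ob_map (twist \<chi>) (ob_map F Y))"
  "ar_map (dual_functor \<chi>) u = ar_map F' (ar_map (twist \<chi>) (ar_map F u))"
  by (simp_all add: dual_functor_def)

lemma linear_equivalence_dual_functor:
  "\<chi> \<in> carrier Gd \<Longrightarrow> linear_equivalence B B (dual_functor \<chi>)"
  unfolding dual_functor_def
  by (rule linear_equivalence_comp[OF linear_equivalence_comp[OF linear_equivalence_F
          linear_equivalence_twist] linear_equivalence_F'])

lemma dual_categorical_action: "categorical_action Gd B dual_functor dual_comparison"
proof (intro categorical_action.intro categorical_action_axioms.intro)
  show "group Gd" by (rule Gd.is_group)
  show "linear_category B" by (rule B.linear_category_axioms)
  show "linear_equivalence B B (dual_functor \<chi>)" if "\<chi> \<in> carrier Gd" for \<chi>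
    using that by (rule linear_equivalence_dual_functor)
next
  fix \<chi> \<psi> assume *: "\<chi> \<in> carrier Gd" "\<psi> \<in> carrier Gd"
  show "natural_isomorphism B B (comp_functr (dual_functor \<chi>) (dual_functor \<psi>))
      (dual_functor (\<psi> \<otimes>\<^bsub>Gd\<^esub> \<chi>)) (dual_comparison \<chi> \<psi>)"
  proof (intro natural_isomorphism.intro natural_isomorphism_axioms.intro)
    have lin: "linear_functor B B (dual_functor \<chi>)" if "\<chi> \<in> carrier Gd" for \<chi>
      using linear_equivalence_dual_functor[OF that] by (simp add: linear_equivalence_def)
    show "linear_functor B B (comp_functr (dual_functor \<chi>) (dual_functor \<psi>))"
      by (rule linear_functor_comp[OF lin[OF *(2)] lin[OF *(1)]])
    show "linear_functor B B (dual_functor (\<psi> \<otimes>\<^bsub>Gd\<^esub> \<chi>))"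
      using * by (intro lin) auto
  next
    fix Y assume "Y \<in> Ob B"
    then show "is_iso B (ob_map (comp_functr (dual_functor \<chi>) (dual_functor \<psi>)) Y)
        (ob_map (dual_functor (\<psi> \<otimes>\<^bsub>Gd\<^esub> \<chi>)) Y) (dual_comparison \<chi> \<psi> Y)"
      using * by (auto simp: is_iso_iff dual_comparison_def twist_twist)
  next
    fix u X Y assume "u \<in> Hom B X Y"
    then have u: "u \<in> Ar B" "X = Dom B u" "Y = Cod B u" by (auto simp: Hom_iff)
    let ?v = "ar_map (twist \<psi>) (ar_map F u)"
    have "ar_map F' (ar_map (twist \<chi>) (\<eta>' (Cod D ?v) \<cdot>\<^bsub>D\<^esub> ar_map F (ar_map F' ?v)))
        = ar_map F' (ar_map (twist \<chi>) (?v \<cdot>\<^bsub>D\<^esub> \<eta>' (Dom D ?v)))"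
      using u * by (subst \<eta>'_natural) auto
    then show "dual_comparison \<chi> \<psi> Y \<cdot>\<^bsub>B\<^esub> ar_map (comp_functr (dual_functor \<chi>) (dual_functor \<psi>)) u
        = ar_map (dual_functor (\<psi> \<otimes>\<^bsub>Gd\<^esub> \<chi>)) u \<cdot>\<^bsub>B\<^esub> dual_comparison \<chi> \<psi> X"
      using u * by (simp add: dual_comparison_def twist_twist)
  qed
next
  fix \<chi> \<psi> \<omega> X assume *: "\<chi> \<in> carrier Gd" "\<psi> \<in> carrier Gd" "\<omega> \<in> carrier Gd" "X \<in> Ob B"
  \<comment> \<open>Both sides of the cocycle condition remove two such pairs, in opposite orders;
    naturality of the counit at a twisted counit arrow says that the order is irrelevant.\<close>
  let ?v = "ar_map (twist \<psi>) (\<eta>' (ob_map (twist \<omega>) (ob_map F X)))"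
  have "ar_map F' (ar_map (twist \<chi>) (\<eta>' (Cod D ?v) \<cdot>\<^bsub>D\<^esub> ar_map F (ar_map F' ?v)))
      = ar_map F' (ar_map (twist \<chi>) (?v \<cdot>\<^bsub>D\<^esub> \<eta>' (Dom D ?v)))"
    using * by (subst \<eta>'_natural) auto
  then show "dual_comparison \<chi> (\<omega> \<otimes>\<^bsub>Gd\<^esub> \<psi>) X \<cdot>\<^bsub>B\<^esub> ar_map (dual_functor \<chi>) (dual_comparison \<psi> \<omega> X)
      = dual_comparison (\<psi> \<otimes>\<^bsub>Gd\<^esub> \<chi>) \<omega> X \<cdot>\<^bsub>B\<^esub> dual_comparison \<chi> \<psi> (ob_map (dual_functor \<omega>) X)"
    using * by (simp add: dual_comparison_def twist_twist)
qed

sublocale E: categorical_action Gd B dual_functor dual_comparison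
  by (rule dual_categorical_action)

section \<open>Equivariant objects of \<open>B\<close> seen in the equivariant category of
  \<open>C\<close>\<close>

definition base :: "'p \<times> (('g \<Rightarrow> 'k) \<Rightarrow> 'n) \<Rightarrow> 'o \<times> ('g \<Rightarrow> 'm)" where
  "base Y = ob_map F (fst Y)"

text \<open>A structure map of Y ends in \<open>F'\<close> of a twist of F(Y). Applying F and then
  the counit turns it into an arrow from F(Y) to its twist, and the underlying arrow in
  \<open>C\<close> is the automorphism a_\<chi>.\<close>

definition translation where
  "translation Y \<chi> = \<eta>' (ob_map (twist \<chi>) (base Y)) \<cdot>\<^bsub>D\<^esub> ar_map F (snd Y \<chi>)"

lemma base_Ob [simp]: "Y \<in> Ob E.D \<Longrightarrow> base Y \<in> Ob D"
  by (simp add: base_def)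

lemma translation_simps [simp]:
  assumes "Y \<in> Ob E.D" "\<chi> \<in> carrier Gd"
  shows "translation Y \<chi> \<in> isos D" "translation Y \<chi> \<in> Ar D" "Dom D (translation Y \<chi>) = base Y"
    "Cod D (translation Y \<chi>) = ob_map (twist \<chi>) (base Y)"
  using assms by (auto simp: translation_def base_def)

text \<open>Naturality of the counit absorbs the comparison isomorphisms of the transported
  action.\<close>

lemma translation_mult:
  assumes Y: "Y \<in> Ob E.D" and *: "\<chi> \<in> carrier Gd" "\<psi> \<in> carrier Gd"
  shows "translation Y (\<psi> \<otimes>\<^bsub>Gd\<^esub> \<chi>) = ar_map (twist \<chi>) (translation Y \<psi>) \<cdot>\<^bsub>D\<^esub> translation Y \<chi>"
proof -
  let ?v = "ar_map (twist \<chi>) (translation Y \<psi>)"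
  have "snd Y (\<psi> \<otimes>\<^bsub>Gd\<^esub> \<chi>) = ar_map F' ?v \<cdot>\<^bsub>B\<^esub> snd Y \<chi>"
    using Y * by (simp add: E.Ob_D_cocycle dual_comparison_def translation_def base_def)
  then have "translation Y (\<psi> \<otimes>\<^bsub>Gd\<^esub> \<chi>)
      = (\<eta>' (Cod D ?v) \<cdot>\<^bsub>D\<^esub> ar_map F (ar_map F' ?v)) \<cdot>\<^bsub>D\<^esub> ar_map F (snd Y \<chi>)"
    using Y * unfolding translation_def[of Y "\<psi> \<otimes>\<^bsub>Gd\<^esub> \<chi>"] by (simp add: twist_twist base_def)
  also have "\<dots> = ?v \<cdot>\<^bsub>D\<^esub> translation Y \<chi>"
    using Y * by (subst \<eta>'_natural) (auto simp: translation_def[of Y \<chi>] base_def)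
  finally show ?thesis .
qed

text \<open>The structure of a twist is multiplied by \<chi>(g), so equivariance of an arrow from an
  object to its twist is exactly the scalar relation.\<close>

lemma dual_equivariant_base:
  assumes Y: "Y \<in> Ob E.D"
  shows "dual_equivariant (base Y) (\<lambda>\<chi>. arr (translation Y \<chi>))"
  unfolding dual_equivariant_def
proof (intro conjI ballI)
  fix \<chi> g assume *: "\<chi> \<in> carrier Gd" "g \<in> carrier G"
  show "hscale C (\<chi> g) (snd (base Y) g \<cdot>\<^bsub>C\<^esub> arr (translation Y \<chi>))
      = ar_map (\<phi> g) (arr (translation Y \<chi>)) \<cdot>\<^bsub>C\<^esub> snd (base Y) g"
    using arr_equivariant[of "translation Y \<chi>" g] Y * by simp
qed (use Y in \<open>auto simp: isos_D_imp translation_mult\<close>)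

lemma dual_equivariant_arrow_base:
  assumes u: "u \<in> Ar E.D"
  shows "dual_equivariant_arrow (base (Dom E.D u)) (\<lambda>\<chi>. arr (translation (Dom E.D u) \<chi>))
    (base (Cod E.D u)) (\<lambda>\<chi>. arr (translation (Cod E.D u) \<chi>)) (arr (ar_map F (arr u)))"
  unfolding dual_equivariant_arrow_def
proof (intro conjI ballI)
  let ?Fu = "ar_map F (arr u)"
  fix \<chi> assume \<chi>: "\<chi> \<in> carrier Gd"
  let ?v = "ar_map (twist \<chi>) ?Fu"
  have "ar_map F (snd (Cod E.D u) \<chi> \<cdot>\<^bsub>B\<^esub> arr u) = ar_map F (ar_map F' ?v \<cdot>\<^bsub>B\<^esub> snd (Dom E.D u) \<chi>)"
    using E.arr_equivariant[OF u \<chi>] by simp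
  then have eq: "ar_map F (snd (Cod E.D u) \<chi>) \<cdot>\<^bsub>D\<^esub> ?Fu = ar_map F (ar_map F' ?v) \<cdot>\<^bsub>D\<^esub> ar_map F (snd (Dom E.D u) \<chi>)"
    using u \<chi> by simp
  have "translation (Cod E.D u) \<chi> \<cdot>\<^bsub>D\<^esub> ?Fu
      = \<eta>' (Cod D ?v) \<cdot>\<^bsub>D\<^esub> (ar_map F (snd (Cod E.D u) \<chi>) \<cdot>\<^bsub>D\<^esub> ?Fu)"
    using u \<chi> by (simp add: translation_def base_def)
  also have "\<dots> = (\<eta>' (Cod D ?v) \<cdot>\<^bsub>D\<^esub> ar_map F (ar_map F' ?v)) \<cdot>\<^bsub>D\<^esub> ar_map F (snd (Dom E.D u) \<chi>)"
    unfolding eq using u \<chi> by simp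
  also have "\<dots> = ?v \<cdot>\<^bsub>D\<^esub> translation (Dom E.D u) \<chi>"
    using u \<chi> by (subst \<eta>'_natural) (auto simp: translation_def base_def)
  finally have "arr (translation (Cod E.D u) \<chi> \<cdot>\<^bsub>D\<^esub> ?Fu) = arr (?v \<cdot>\<^bsub>D\<^esub> translation (Dom E.D u) \<chi>)"
    by (rule arg_cong)
  then show "arr (translation (Cod E.D u) \<chi>) \<cdot>\<^bsub>C\<^esub> arr ?Fu = arr ?Fu \<cdot>\<^bsub>C\<^esub> arr (translation (Dom E.D u) \<chi>)"
    by simp
next
  fix g assume "g \<in> carrier G"
  then show "snd (base (Cod E.D u)) g \<cdot>\<^bsub>C\<^esub> arr (ar_map F (arr u))
      = ar_map (\<phi> g) (arr (ar_map F (arr u))) \<cdot>\<^bsub>C\<^esub> snd (base (Dom E.D u)) g"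
    using u arr_equivariant[of "ar_map F (arr u)" g] by (simp add: base_def)
qed (use u in \<open>auto simp: base_def\<close>)

text \<open>Full faithfulness of F provides the arrow in \<open>B\<close>. Its compatibility with
  the structure maps is checked after F, where the invertible counit cancels.\<close>

lemma dual_equivariant_arrow_lift:
  assumes Y: "Y\<^sub>1 \<in> Ob E.D" "Y\<^sub>2 \<in> Ob E.D"
    and f: "dual_equivariant_arrow (base Y\<^sub>1) (\<lambda>\<chi>. arr (translation Y\<^sub>1 \<chi>))
      (base Y\<^sub>2) (\<lambda>\<chi>. arr (translation Y\<^sub>2 \<chi>)) f"
  obtains u where "u \<in> Ar E.D" "Dom E.D u = Y\<^sub>1" "Cod E.D u = Y\<^sub>2" "arr (ar_map F (arr u)) = f"
proof -
  note f_simps = dual_equivariant_arrow_simps[OF f]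
  let ?v = "(base Y\<^sub>1, base Y\<^sub>2, f)"
  have v [simp]: "?v \<in> Ar D" "Dom D ?v = base Y\<^sub>1" "Cod D ?v = base Y\<^sub>2"
    by (rule Ar_D_exists; use Y f_simps(1-4) in auto)+
  note ff = linear_equivalence_imp(1)[OF linear_equivalence_F]
  obtain w where w [simp]: "w \<in> Ar B" "Dom B w = fst Y\<^sub>1" "Cod B w = fst Y\<^sub>2" and Fw: "ar_map F w = ?v"
    by (rule fully_faithful_full[OF ff, of "fst Y\<^sub>1" "fst Y\<^sub>2" ?v]) (use Y in \<open>auto simp: base_def[symmetric]\<close>)
  have "snd Y\<^sub>2 \<chi> \<cdot>\<^bsub>B\<^esub> w = ar_map (dual_functor \<chi>) w \<cdot>\<^bsub>B\<^esub> snd Y\<^sub>1 \<chi>" if \<chi>: "\<chi> \<in> carrier Gd" for \<chi>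
  proof (rule fully_faithful_faithful[OF ff F.linear_functor_axioms])
    let ?z = "ar_map (twist \<chi>) (ar_map F w)"
    have z [simp]: "?z \<in> Ar D" "Dom D ?z = ob_map (twist \<chi>) (base Y\<^sub>1)" "Cod D ?z = ob_map (twist \<chi>) (base Y\<^sub>2)"
      using \<chi> by (auto simp: base_def)
    have "translation Y\<^sub>2 \<chi> \<cdot>\<^bsub>D\<^esub> ar_map F w = ?z \<cdot>\<^bsub>D\<^esub> translation Y\<^sub>1 \<chi>"
      by (rule arr_eqI) (use Y \<chi> f_simps(5)[OF \<chi>] in \<open>auto simp: Fw\<close>)
    also have "\<dots> = (?z \<cdot>\<^bsub>D\<^esub> \<eta>' (Dom D ?z)) \<cdot>\<^bsub>D\<^esub> ar_map F (snd Y\<^sub>1 \<chi>)"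
      using Y \<chi> by (simp add: translation_def base_def)
    also have "\<dots> = \<eta>' (Cod D ?z) \<cdot>\<^bsub>D\<^esub> (ar_map F (ar_map F' ?z) \<cdot>\<^bsub>D\<^esub> ar_map F (snd Y\<^sub>1 \<chi>))"
      using Y \<chi> by (subst \<eta>'_natural[symmetric]) (auto simp: base_def)
    also have "translation Y\<^sub>2 \<chi> \<cdot>\<^bsub>D\<^esub> ar_map F w
        = \<eta>' (Cod D ?z) \<cdot>\<^bsub>D\<^esub> (ar_map F (snd Y\<^sub>2 \<chi>) \<cdot>\<^bsub>D\<^esub> ar_map F w)"
      using Y \<chi> by (simp add: translation_def base_def)
    finally have "ar_map F (snd Y\<^sub>2 \<chi>) \<cdot>\<^bsub>D\<^esub> ar_map F w = ar_map F (ar_map F' ?z) \<cdot>\<^bsub>D\<^esub> ar_map F (snd Y\<^sub>1 \<chi>)"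
      by (rule D.isos_cancel_left[rotated -1]) (use Y \<chi> in \<open>auto simp: base_def\<close>)
    then show "ar_map F (snd Y\<^sub>2 \<chi> \<cdot>\<^bsub>B\<^esub> w) = ar_map F (ar_map (dual_functor \<chi>) w \<cdot>\<^bsub>B\<^esub> snd Y\<^sub>1 \<chi>)"
      using Y \<chi> by (simp add: base_def)
  qed (use Y \<chi> in auto)
  then have "(Y\<^sub>1, Y\<^sub>2, w) \<in> Ar E.D" "Dom E.D (Y\<^sub>1, Y\<^sub>2, w) = Y\<^sub>1" "Cod E.D (Y\<^sub>1, Y\<^sub>2, w) = Y\<^sub>2"
    by (rule E.Ar_D_exists[rotated -1]; use Y in auto)+
  then show ?thesis using that Fw by auto
qed

text \<open>The structure maps on \<open>F'(P)\<close> are forced by the demand that the counit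
  intertwine the two families: they are the images under \<open>F'\<close> of a_\<chi> followed by
  the twisted inverse counit.\<close>

lemma dual_equivariant_lift:
  assumes Pa: "dual_equivariant P a"
  obtains Y where "Y \<in> Ob E.D" "fst Y = ob_map F' P"
    "dual_equivariant_arrow (base Y) (\<lambda>\<chi>. arr (translation Y \<chi>)) P a (arr (\<eta>' P))"
proof -
  note [simp] = dual_equivariant_simps[OF Pa]
  define A where "A \<chi> = (P, ob_map (twist \<chi>) P, a \<chi>)" for \<chi>
  have A_Ar [simp]: "A \<chi> \<in> Ar D" "Dom D (A \<chi>) = P" "Cod D (A \<chi>) = ob_map (twist \<chi>) P" "arr (A \<chi>) = a \<chi>"
    if \<chi>: "\<chi> \<in> carrier Gd" for \<chi>
    unfolding A_def by (rule Ar_D_exists; use \<chi> in \<open>simp add: dual_equivariant_twist[OF Pa]\<close>)+ simp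
  have A_isos [simp]: "A \<chi> \<in> isos D" if "\<chi> \<in> carrier Gd" for \<chi>
    using that by (intro isos_D_I) auto
  have A_mult: "A (\<psi> \<otimes>\<^bsub>Gd\<^esub> \<chi>) = ar_map (twist \<chi>) (A \<psi>) \<cdot>\<^bsub>D\<^esub> A \<chi>"
    if "\<chi> \<in> carrier Gd" "\<psi> \<in> carrier Gd" for \<chi> \<psi>
    by (rule arr_eqI) (use that in \<open>auto simp: twist_twist dual_equivariant_mult[OF Pa]\<close>)
  define m where "m \<chi> = ar_map (twist \<chi>) (inverse_arrow D (\<eta>' P)) \<cdot>\<^bsub>D\<^esub> A \<chi>" for \<chi>
  have m [simp]: "m \<chi> \<in> isos D" "m \<chi> \<in> Ar D" "Dom D (m \<chi>) = P"
      "Cod D (m \<chi>) = ob_map (twist \<chi>) (ob_map F (ob_map F' P))" if "\<chi> \<in> carrier Gd" for \<chi>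
    using that by (auto simp: m_def)
  define Y where "Y = (ob_map F' P, \<lambda>\<chi> \<in> carrier Gd. ar_map F' (m \<chi>))"
  have tr: "\<eta>' (ob_map (twist \<chi>) (ob_map F (ob_map F' P))) \<cdot>\<^bsub>D\<^esub> ar_map F (ar_map F' (m \<chi>)) = m \<chi> \<cdot>\<^bsub>D\<^esub> \<eta>' P"
    if "\<chi> \<in> carrier Gd" for \<chi>
    using \<eta>'_natural[of "m \<chi>"] that by simp
  have "Y \<in> Ob E.D"
    unfolding Y_def
  proof (rule E.Ob_DI)
    fix \<chi> \<psi> assume *: "\<chi> \<in> carrier Gd" "\<psi> \<in> carrier Gd"
    have "\<eta>' (ob_map (twist \<psi>) (ob_map F (ob_map F' P))) \<cdot>\<^bsub>D\<^esub> ar_map F (ar_map F' (m \<psi>))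
        = ar_map (twist \<psi>) (inverse_arrow D (\<eta>' P)) \<cdot>\<^bsub>D\<^esub> (A \<psi> \<cdot>\<^bsub>D\<^esub> \<eta>' P)"
      using * by (simp add: tr) (simp add: m_def)
    then have "ar_map (twist \<chi>) (\<eta>' (ob_map (twist \<psi>) (ob_map F (ob_map F' P))) \<cdot>\<^bsub>D\<^esub> ar_map F (ar_map F' (m \<psi>)))
          \<cdot>\<^bsub>D\<^esub> m \<chi>
        = ar_map (twist \<chi>) (ar_map (twist \<psi>) (inverse_arrow D (\<eta>' P)) \<cdot>\<^bsub>D\<^esub> (A \<psi> \<cdot>\<^bsub>D\<^esub> \<eta>' P)) \<cdot>\<^bsub>D\<^esub> m \<chi>"
      by simp
    also have "\<dots> = m (\<psi> \<otimes>\<^bsub>Gd\<^esub> \<chi>)"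
    proof -
      have "ar_map (twist \<chi>) (\<eta>' P) \<cdot>\<^bsub>D\<^esub> m \<chi> = ar_map (twist \<chi>) (\<eta>' P \<cdot>\<^bsub>D\<^esub> inverse_arrow D (\<eta>' P)) \<cdot>\<^bsub>D\<^esub> A \<chi>"
        unfolding m_def by (subst twist_simps) (use * in auto)
      then have "ar_map (twist \<chi>) (\<eta>' P) \<cdot>\<^bsub>D\<^esub> m \<chi> = A \<chi>"
        using * by simp
      then show ?thesis using * by (simp add: twist_twist m_def[of "\<psi> \<otimes>\<^bsub>Gd\<^esub> \<chi>"] A_mult)
    qed
    finally have "ar_map F' (m (\<psi> \<otimes>\<^bsub>Gd\<^esub> \<chi>)) = ar_map F' (ar_map (twist \<chi>)
        (\<eta>' (ob_map (twist \<psi>) (ob_map F (ob_map F' P))) \<cdot>\<^bsub>D\<^esub> ar_map F (ar_map F' (m \<psi>))) \<cdot>\<^bsub>D\<^esub> m \<chi>)"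
      by (rule arg_cong[OF sym])
    then show "(\<lambda>\<chi> \<in> carrier Gd. ar_map F' (m \<chi>)) (\<psi> \<otimes>\<^bsub>Gd\<^esub> \<chi>) = dual_comparison \<chi> \<psi> (ob_map F' P) \<cdot>\<^bsub>B\<^esub>
        (ar_map (dual_functor \<chi>) ((\<lambda>\<chi> \<in> carrier Gd. ar_map F' (m \<chi>)) \<psi>) \<cdot>\<^bsub>B\<^esub>
          (\<lambda>\<chi> \<in> carrier Gd. ar_map F' (m \<chi>)) \<chi>)"
      using * by (simp add: dual_comparison_def)
  qed auto
  moreover have "fst Y = ob_map F' P" by (simp add: Y_def)
  moreover have "dual_equivariant_arrow (base Y) (\<lambda>\<chi>. arr (translation Y \<chi>)) P a (arr (\<eta>' P))"
    unfolding dual_equivariant_arrow_def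
  proof (intro conjI ballI)
    fix \<chi> assume \<chi>: "\<chi> \<in> carrier Gd"
    have "translation Y \<chi> = m \<chi> \<cdot>\<^bsub>D\<^esub> \<eta>' P"
      using \<chi> by (simp add: translation_def base_def Y_def tr)
    then have "arr (translation Y \<chi>) = arr (m \<chi> \<cdot>\<^bsub>D\<^esub> \<eta>' P)"
      by simp
    then show "a \<chi> \<cdot>\<^bsub>C\<^esub> arr (\<eta>' P) = arr (\<eta>' P) \<cdot>\<^bsub>C\<^esub> arr (translation Y \<chi>)"
      using \<chi> isos_D_imp[of "\<eta>' P"] by (simp add: m_def)
  next
    fix g assume "g \<in> carrier G"
    then show "snd P g \<cdot>\<^bsub>C\<^esub> arr (\<eta>' P) = ar_map (\<phi> g) (arr (\<eta>' P)) \<cdot>\<^bsub>C\<^esub> snd (base Y) g"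
      using arr_equivariant[of "\<eta>' P" g] by (simp add: base_def Y_def)
  qed (auto simp: base_def Y_def)
  ultimately show ?thesis using that by blast
qed

end


section \<open>The functor of invariants\<close>

context dual_equivalence
begin

abbreviation projector where
  "projector Y \<equiv> invariant_proj (base Y) (\<lambda>\<chi>. arr (translation Y \<chi>))"

text \<open>Idempotent completeness realises the invariant part as an object, and an arrow is
  compressed to it. Faithfulness comes from \<open>dual_equivariant_arrow_expand\<close>, fullness
  from \<open>dual_equivariant_arrow_extend\<close> and \<open>dual_equivariant_arrow_lift\<close>,
  essential surjectivity from \<open>induced_object\<close>.\<close>

lemma invariants_equivalence:
  assumes "additive_category C" "idempotent_complete C"
  shows "\<exists>K. linear_equivalence E.D C K"
proof -
  note proj_simps [simp] = invariant_proj_Ar[OF dual_equivariant_base] invariant_proj_idem[OF dual_equivariant_base]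
  \<comment> \<open>Image, inclusion and retraction are packed into a triple so that one choice
    fixes the whole splitting.\<close>
  have "\<forall>Y \<in> Ob E.D. \<exists>s. fst s \<in> Ob C \<and> fst (snd s) \<in> Hom C (fst s) (fst (base Y)) \<and>
      arr s \<in> Hom C (fst (base Y)) (fst s) \<and> projector Y = fst (snd s) \<cdot>\<^bsub>C\<^esub> arr s \<and>
      arr s \<cdot>\<^bsub>C\<^esub> fst (snd s) = Ident C (fst s)"
  proof
    fix Y assume Y: "Y \<in> Ob E.D"
    have "fst (base Y) \<in> Ob C" "projector Y \<in> Hom C (fst (base Y)) (fst (base Y))"
      using Y by (auto simp: Hom_iff)
    then obtain Z i s where "Z \<in> Ob C" "i \<in> Hom C Z (fst (base Y))" "s \<in> Hom C (fst (base Y)) Z"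
        "projector Y = i \<cdot>\<^bsub>C\<^esub> s" "s \<cdot>\<^bsub>C\<^esub> i = Ident C Z"
      using assms(2) invariant_proj_idem[OF dual_equivariant_base[OF Y]]
      unfolding idempotent_complete_def by blast
    then show "\<exists>s. fst s \<in> Ob C \<and> fst (snd s) \<in> Hom C (fst s) (fst (base Y)) \<and>
      arr s \<in> Hom C (fst (base Y)) (fst s) \<and> projector Y = fst (snd s) \<cdot>\<^bsub>C\<^esub> arr s \<and>
      arr s \<cdot>\<^bsub>C\<^esub> fst (snd s) = Ident C (fst s)"
      by (intro exI[of _ "(Z, i, s)"]) simp
  qed
  from bchoice[OF this] obtain sp where sp: "\<forall>Y \<in> Ob E.D. fst (sp Y) \<in> Ob C \<and>
      fst (snd (sp Y)) \<in> Hom C (fst (sp Y)) (fst (base Y)) \<and>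
      arr (sp Y) \<in> Hom C (fst (base Y)) (fst (sp Y)) \<and>
      projector Y = fst (snd (sp Y)) \<cdot>\<^bsub>C\<^esub> arr (sp Y) \<and>
      arr (sp Y) \<cdot>\<^bsub>C\<^esub> fst (snd (sp Y)) = Ident C (fst (sp Y))" ..
  define im inc ret where "im Y = fst (sp Y)" and "inc Y = fst (snd (sp Y))" and "ret Y = arr (sp Y)" for Y
  have im [simp]: "im Y \<in> Ob C" "inc Y \<in> Ar C" "Dom C (inc Y) = im Y" "Cod C (inc Y) = fst (base Y)"
      "ret Y \<in> Ar C" "Dom C (ret Y) = fst (base Y)" "Cod C (ret Y) = im Y"
      "ret Y \<cdot>\<^bsub>C\<^esub> inc Y = Ident C (im Y)"
    and inc_ret: "inc Y \<cdot>\<^bsub>C\<^esub> ret Y = projector Y" if "Y \<in> Ob E.D" for Y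
    using bspec[OF sp that] unfolding im_def inc_def ret_def by (simp_all add: Hom_iff)
  have ret_inc [simp]: "ret Y \<cdot>\<^bsub>C\<^esub> (inc Y \<cdot>\<^bsub>C\<^esub> w) = w" if "Y \<in> Ob E.D" "w \<in> Ar C" "Cod C w = im Y" for Y w
    using C.Comp_assoc_Ar[of w "inc Y" "ret Y"] that by (simp del: C.Comp_assoc_Ar)
  have proj_inc [simp]: "projector Y \<cdot>\<^bsub>C\<^esub> inc Y = inc Y" "ret Y \<cdot>\<^bsub>C\<^esub> projector Y = ret Y"
    if "Y \<in> Ob E.D" for Y
    using that by (simp_all add: inc_ret[symmetric])
  define \<Phi> where "\<Phi> u = arr (ar_map F (arr u))" for u :: "('p \<times> (('g \<Rightarrow> 'k) \<Rightarrow> 'n)) \<times> ('p \<times> (('g \<Rightarrow> 'k) \<Rightarrow> 'n)) \<times> 'n"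
  have \<Phi> [simp]: "\<Phi> u \<in> Ar C" "Dom C (\<Phi> u) = fst (base (Dom E.D u))" "Cod C (\<Phi> u) = fst (base (Cod E.D u))"
    if "u \<in> Ar E.D" for u
    using that by (auto simp: \<Phi>_def base_def)
  have \<Phi>_arrow: "dual_equivariant_arrow (base (Dom E.D u)) (\<lambda>\<chi>. arr (translation (Dom E.D u) \<chi>))
      (base (Cod E.D u)) (\<lambda>\<chi>. arr (translation (Cod E.D u) \<chi>)) (\<Phi> u)" if "u \<in> Ar E.D" for u
    unfolding \<Phi>_def using that by (rule dual_equivariant_arrow_base)
  have \<Phi>_proj: "projector (Cod E.D u) \<cdot>\<^bsub>C\<^esub> \<Phi> u = \<Phi> u \<cdot>\<^bsub>C\<^esub> projector (Dom E.D u)" if "u \<in> Ar E.D" for u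
    using that by (intro invariant_proj_natural dual_equivariant_base \<Phi>_arrow) auto
  define K where "K = \<lparr>ob_map = im, ar_map = (\<lambda>u. ret (Cod E.D u) \<cdot>\<^bsub>C\<^esub> (\<Phi> u \<cdot>\<^bsub>C\<^esub> inc (Dom E.D u)))\<rparr>"
  have K_simps [simp]: "ob_map K Y = im Y"
      "ar_map K u = ret (Cod E.D u) \<cdot>\<^bsub>C\<^esub> (\<Phi> u \<cdot>\<^bsub>C\<^esub> inc (Dom E.D u))" for Y u
    by (auto simp: K_def)
  have lin: "linear_functor E.D C K"
  proof (intro linear_functor.intro linear_functor_axioms.intro)
    show "linear_category E.D" by (rule E.linear_category_D)
    show "linear_category C" by (rule C.linear_category_axioms)
    show "ob_map K Y \<in> Ob C" if "Y \<in> Ob E.D" for Y using that by simp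
    show "ar_map K u \<in> Hom C (ob_map K Y) (ob_map K Y')" if "u \<in> Hom E.D Y Y'" for u Y Y'
      using that by (auto simp: Hom_iff)
    show "ar_map K (Ident E.D Y) = Ident C (ob_map K Y)" if "Y \<in> Ob E.D" for Y
      using that by (simp add: \<Phi>_def base_def[symmetric])
    show "ar_map K (hscale E.D c u) = hscale C c (ar_map K u)" if "u \<in> Hom E.D Y Y'" for u Y Y' c
    proof -
      have u: "u \<in> Ar E.D" using that by (simp add: Hom_iff)
      then have "\<Phi> (hscale E.D c u) = hscale C c (\<Phi> u)" by (simp add: \<Phi>_def)
      then show ?thesis using u by simp
    qed
    show "ar_map K (hsum E.D u v) = hsum C (ar_map K u) (ar_map K v)"
      if "u \<in> Hom E.D Y Y'" "v \<in> Hom E.D Y Y'" for u v Y Y'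
    proof -
      have uv: "u \<in> Ar E.D" "v \<in> Ar E.D" "Dom E.D u = Dom E.D v" "Cod E.D u = Cod E.D v"
        using that by (auto simp: Hom_iff)
      then have "\<Phi> (hsum E.D u v) = hsum C (\<Phi> u) (\<Phi> v)" by (simp add: \<Phi>_def)
      then show ?thesis using uv by simp
    qed
    show "ar_map K (v \<cdot>\<^bsub>E.D\<^esub> u) = ar_map K v \<cdot>\<^bsub>C\<^esub> ar_map K u"
      if "u \<in> Hom E.D Y Y'" "v \<in> Hom E.D Y' Y''" for u v Y Y' Y''
    proof -
      have uv: "u \<in> Ar E.D" "v \<in> Ar E.D" "Dom E.D v = Cod E.D u"
        using that by (auto simp: Hom_iff)
      \<comment> \<open>The idempotent between the two compressed arrows commutes with
        \<open>\<Phi> u\<close> and is then absorbed by the inclusion.\<close>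
      have "ar_map K v \<cdot>\<^bsub>C\<^esub> ar_map K u
          = ret (Cod E.D v) \<cdot>\<^bsub>C\<^esub> (\<Phi> v \<cdot>\<^bsub>C\<^esub> ((inc (Cod E.D u) \<cdot>\<^bsub>C\<^esub> ret (Cod E.D u)) \<cdot>\<^bsub>C\<^esub> \<Phi> u) \<cdot>\<^bsub>C\<^esub> inc (Dom E.D u))"
        using uv by simp
      also have "\<dots> = ret (Cod E.D v) \<cdot>\<^bsub>C\<^esub> (\<Phi> v \<cdot>\<^bsub>C\<^esub> (\<Phi> u \<cdot>\<^bsub>C\<^esub> inc (Dom E.D u)))"
        using uv by (simp only: inc_ret E.D.Dom_Cod_Ob \<Phi>_proj) simp
      also have "\<dots> = ar_map K (v \<cdot>\<^bsub>E.D\<^esub> u)"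
      proof -
        have "\<Phi> (v \<cdot>\<^bsub>E.D\<^esub> u) = \<Phi> v \<cdot>\<^bsub>C\<^esub> \<Phi> u" using uv by (simp add: \<Phi>_def)
        then show ?thesis using uv by simp
      qed
      finally show ?thesis ..
    qed
  qed
  \<comment> \<open>The compression remembers \<open>\<Phi> u\<close> on the invariant part, and the
    expansion into translates recovers the rest.\<close>
  have K_proj: "inc (Cod E.D u) \<cdot>\<^bsub>C\<^esub> (ar_map K u \<cdot>\<^bsub>C\<^esub> ret (Dom E.D u)) = \<Phi> u \<cdot>\<^bsub>C\<^esub> projector (Dom E.D u)"
    if u: "u \<in> Ar E.D" for u
  proof -
    have "inc (Cod E.D u) \<cdot>\<^bsub>C\<^esub> (ar_map K u \<cdot>\<^bsub>C\<^esub> ret (Dom E.D u))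
        = (inc (Cod E.D u) \<cdot>\<^bsub>C\<^esub> ret (Cod E.D u)) \<cdot>\<^bsub>C\<^esub> (\<Phi> u \<cdot>\<^bsub>C\<^esub> (inc (Dom E.D u) \<cdot>\<^bsub>C\<^esub> ret (Dom E.D u)))"
      using u by simp
    also have "\<dots> = (projector (Cod E.D u) \<cdot>\<^bsub>C\<^esub> \<Phi> u) \<cdot>\<^bsub>C\<^esub> projector (Dom E.D u)"
      using u by (simp add: inc_ret)
    also have "\<dots> = \<Phi> u \<cdot>\<^bsub>C\<^esub> projector (Dom E.D u)"
      using u by (simp add: \<Phi>_proj)
    finally show ?thesis .
  qed
  have ff: "fully_faithful E.D C K"
  proof (rule fully_faithfulI[OF lin])
    fix u v assume uv: "u \<in> Ar E.D" "v \<in> Ar E.D" "Dom E.D u = Dom E.D v" "Cod E.D u = Cod E.D v"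
      and eq: "ar_map K u = ar_map K v"
    have "\<Phi> u \<cdot>\<^bsub>C\<^esub> projector (Dom E.D v) = \<Phi> v \<cdot>\<^bsub>C\<^esub> projector (Dom E.D v)"
      using K_proj[OF uv(1)] K_proj[OF uv(2)] unfolding eq uv(3,4) by simp
    then have "\<Phi> u = \<Phi> v"
      using dual_equivariant_arrow_expand[OF dual_equivariant_base \<Phi>_arrow[OF uv(1)]]
        dual_equivariant_arrow_expand[OF dual_equivariant_base \<Phi>_arrow[OF uv(2)]] uv
      by simp
    then have "ar_map F (arr u) = ar_map F (arr v)"
      using uv by (intro arr_eqI) (auto simp: \<Phi>_def)
    then have "arr u = arr v"
      by (rule fully_faithful_faithful[OF linear_equivalence_imp(1)[OF linear_equivalence_F]
            F.linear_functor_axioms, rotated -1]) (use uv in auto)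
    then show "u = v" using uv(3,4) by (intro E.arr_eqI)
  next
    fix Y Y' v assume Y: "Y \<in> Ob E.D" "Y' \<in> Ob E.D" and "v \<in> Hom C (ob_map K Y) (ob_map K Y')"
    then have v [simp]: "v \<in> Ar C" "Dom C v = im Y" "Cod C v = im Y'" by (auto simp: Hom_iff)
    note [simp] = Y
    \<comment> \<open>Composing with a retraction and an inclusion gives an arrow fixed by both
      projectors, as the extension to all components requires.\<close>
    let ?f = "inc Y' \<cdot>\<^bsub>C\<^esub> (v \<cdot>\<^bsub>C\<^esub> ret Y)"
    have "projector Y' \<cdot>\<^bsub>C\<^esub> ?f = (projector Y' \<cdot>\<^bsub>C\<^esub> inc Y') \<cdot>\<^bsub>C\<^esub> (v \<cdot>\<^bsub>C\<^esub> ret Y)"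
      by (simp del: proj_inc)
    then have pf: "projector Y' \<cdot>\<^bsub>C\<^esub> ?f = ?f" using Y by (simp only: proj_inc)
    have fp: "?f \<cdot>\<^bsub>C\<^esub> projector Y = ?f" by simp
    obtain f where f: "dual_equivariant_arrow (base Y) (\<lambda>\<chi>. arr (translation Y \<chi>))
        (base Y') (\<lambda>\<chi>. arr (translation Y' \<chi>)) f" and pf': "projector Y' \<cdot>\<^bsub>C\<^esub> f = ?f"
      by (rule dual_equivariant_arrow_extend[OF dual_equivariant_base[OF Y(1)] dual_equivariant_base[OF Y(2)]
            _ _ _ fp pf]) auto
    obtain u where u: "u \<in> Ar E.D" "Dom E.D u = Y" "Cod E.D u = Y'" and \<Phi>u: "\<Phi> u = f"
      unfolding \<Phi>_def using dual_equivariant_arrow_lift[OF Y f] .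
    note [simp] = dual_equivariant_arrow_simps(1-3)[OF f]
    have "ar_map K u = (ret Y' \<cdot>\<^bsub>C\<^esub> projector Y') \<cdot>\<^bsub>C\<^esub> (f \<cdot>\<^bsub>C\<^esub> inc Y)"
      using u by (simp add: \<Phi>u)
    also have "\<dots> = ret Y' \<cdot>\<^bsub>C\<^esub> ((projector Y' \<cdot>\<^bsub>C\<^esub> f) \<cdot>\<^bsub>C\<^esub> inc Y)"
      by (simp del: proj_inc)
    also have "\<dots> = v" unfolding pf' by simp
    finally show "\<exists>u \<in> Hom E.D Y Y'. ar_map K u = v"
      using u by (intro bexI[of _ u]) (auto simp: Hom_iff)
  qed
  have es: "essentially_surjective E.D C K"
    unfolding essentially_surjective_def
  proof
    fix Z assume "Z \<in> Ob C"
    \<comment> \<open>The invariant part of an induced object is \<phi>_1 of the inducing object, so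
      Z is first written as \<phi>_1(Z') up to isomorphism.\<close>
    then obtain Z' e where Z': "Z' \<in> Ob C" and e [simp]: "e \<in> isos C" "Dom C e = ob_map (\<phi> \<one>) Z'" "Cod C e = Z"
      using linear_equivalence_imp(2)[OF autoequivalence[OF one_closed]]
      unfolding essentially_surjective_def by blast
    obtain P a i s where Pa: "dual_equivariant P a"
      and "i \<in> Hom C (ob_map (\<phi> \<one>) Z') (fst P)" "s \<in> Hom C (fst P) (ob_map (\<phi> \<one>) Z')"
      and si: "s \<cdot>\<^bsub>C\<^esub> i = Ident C (ob_map (\<phi> \<one>) Z')" and is_P: "i \<cdot>\<^bsub>C\<^esub> s = invariant_proj P a"
      using induced_object[OF assms(1) Z'] .
    then have is_simps [simp]: "i \<in> Ar C" "Dom C i = ob_map (\<phi> \<one>) Z'" "Cod C i = fst P"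
        "s \<in> Ar C" "Dom C s = fst P" "Cod C s = ob_map (\<phi> \<one>) Z'"
      by (auto simp: Hom_iff)
    note [simp] = dual_equivariant_simps[OF Pa] Z'
    obtain Y where Y [simp]: "Y \<in> Ob E.D" and Y_base: "fst Y = ob_map F' P"
      and arrow: "dual_equivariant_arrow (base Y) (\<lambda>\<chi>. arr (translation Y \<chi>)) P a (arr (\<eta>' P))"
      using dual_equivariant_lift[OF Pa] .
    let ?t = "arr (\<eta>' P)" and ?t' = "inverse_arrow C (arr (\<eta>' P))"
    have t [simp]: "?t \<in> isos C" "?t \<in> Ar C" "Dom C ?t = fst (base Y)" "Cod C ?t = fst P"
      using isos_D_imp[of "\<eta>' P"] by (auto simp: base_def Y_base)
    have nat: "invariant_proj P a \<cdot>\<^bsub>C\<^esub> ?t = ?t \<cdot>\<^bsub>C\<^esub> projector Y"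
      by (rule invariant_proj_natural[OF dual_equivariant_base[OF Y] Pa arrow])
    \<comment> \<open>The counit matches two split idempotents, hence their images:
      \<open>?m\<close> and \<open>?n\<close> are the compressions of it and of its inverse.\<close>
    let ?m = "s \<cdot>\<^bsub>C\<^esub> (?t \<cdot>\<^bsub>C\<^esub> inc Y)" and ?n = "ret Y \<cdot>\<^bsub>C\<^esub> (?t' \<cdot>\<^bsub>C\<^esub> i)"
    have "?m \<cdot>\<^bsub>C\<^esub> ?n = s \<cdot>\<^bsub>C\<^esub> ((?t \<cdot>\<^bsub>C\<^esub> (inc Y \<cdot>\<^bsub>C\<^esub> ret Y)) \<cdot>\<^bsub>C\<^esub> (?t' \<cdot>\<^bsub>C\<^esub> i))"
      by simp
    also have "\<dots> = s \<cdot>\<^bsub>C\<^esub> (((i \<cdot>\<^bsub>C\<^esub> s) \<cdot>\<^bsub>C\<^esub> ?t) \<cdot>\<^bsub>C\<^esub> (?t' \<cdot>\<^bsub>C\<^esub> i))"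
      by (simp only: inc_ret[OF Y] nat[symmetric] is_P)
    also have "\<dots> = (s \<cdot>\<^bsub>C\<^esub> i) \<cdot>\<^bsub>C\<^esub> (s \<cdot>\<^bsub>C\<^esub> i)"
      by simp
    also have "\<dots> = Ident C (ob_map (\<phi> \<one>) Z')"
      by (simp only: si) simp
    finally have mn: "?m \<cdot>\<^bsub>C\<^esub> ?n = Ident C (Cod C ?m)" by simp
    have "?n \<cdot>\<^bsub>C\<^esub> ?m = ret Y \<cdot>\<^bsub>C\<^esub> (?t' \<cdot>\<^bsub>C\<^esub> (((i \<cdot>\<^bsub>C\<^esub> s) \<cdot>\<^bsub>C\<^esub> ?t) \<cdot>\<^bsub>C\<^esub> inc Y))"
      by simp
    also have "\<dots> = ret Y \<cdot>\<^bsub>C\<^esub> (?t' \<cdot>\<^bsub>C\<^esub> ((?t \<cdot>\<^bsub>C\<^esub> projector Y) \<cdot>\<^bsub>C\<^esub> inc Y))"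
      by (simp only: is_P nat)
    also have "\<dots> = Ident C (Dom C ?m)" by simp
    finally have "?m \<in> isos C"
      using mn by (intro C.isosI[of _ ?n]) auto
    then show "\<exists>Y \<in> Ob E.D. \<exists>f \<in> isos C. Dom C f = ob_map K Y \<and> Cod C f = Z"
      by (intro bexI[of _ Y] bexI[of _ "e \<cdot>\<^bsub>C\<^esub> ?m"]) auto
  qed
  show ?thesis
    using linear_equivalenceI[OF lin ff es] by blast
qed

end

theorem theorem1p3:
  fixes G :: "'g monoid"
    and B :: "('k::alg_closed_field, 'p, 'n) lincat"
    and C :: "('k, 'o, 'm) lincat"
  assumes "comm_group G" and "finite (carrier G)"
    and "\<not> CHAR('k) dvd card (carrier G)"
    and "additive_category B" and "idempotent_complete B"
    and "additive_category C" and "idempotent_complete C"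
    and "\<exists>\<phi> \<epsilon>. categorical_action G C \<phi> \<epsilon> \<and> B \<cong>\<^sub>l\<^sub>i\<^sub>n equivariant_category G C \<phi> \<epsilon>"
  shows "\<exists>\<psi> \<delta>. categorical_action (dual_group G :: ('g \<Rightarrow> 'k) monoid) B \<psi> \<delta> \<and>
           C \<cong>\<^sub>l\<^sub>i\<^sub>n equivariant_category (dual_group G :: ('g \<Rightarrow> 'k) monoid) B \<psi> \<delta>"
proof -
  obtain \<phi> \<epsilon> F where action: "categorical_action G C \<phi> \<epsilon>"
    and eq: "linear_equivalence B (equivariant_category G C \<phi> \<epsilon>) F"
    using assms(8) unfolding equivalent_categories_def by blast
  then obtain F' \<eta> \<eta>' where F: "linear_functor B (equivariant_category G C \<phi> \<epsilon>) F"
      "linear_functor (equivariant_category G C \<phi> \<epsilon>) B F'"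
      "natural_isomorphism B B (comp_functr F' F) id_functr \<eta>"
      "natural_isomorphism (equivariant_category G C \<phi> \<epsilon>) (equivariant_category G C \<phi> \<epsilon>)
        (comp_functr F F') id_functr \<eta>'"
    unfolding linear_equivalence_def by blast
  interpret dual_equivalence G "TYPE('k)" C \<phi> \<epsilon> B F F' \<eta> \<eta>'
    using assms(1-3) action F additive_category.axioms(1)[OF assms(4)]
    by (intro dual_equivalence.intro dual_action.intro dualizable_group.intro
        dualizable_group_axioms.intro)
  \<comment> \<open>The equivalence found runs from the equivariant category of the transported
    action to \<open>C\<close>; it is reversed in the last step.\<close>
  obtain K where "linear_equivalence E.D C K"
    using invariants_equivalence[OF assms(6,7)] by blast
  then show ?thesis
    using dual_categorical_action linear_equivalence_sym by blast
qed

end
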